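(* Let $\alpha,\beta,\gamma,\delta$ be real constants with $\alpha^2-\beta^2+4\gamma\delta\neq 0$. Up to similarity, the surfaces in Euclidean space $\mathbb{R}^3$ free of umbilical points, whose curvatures $K$, $H$ and $H'$ satisfy the linear relation $$\delta K=\alpha H+\beta H'+\gamma,$$ are described by the natural PDE's of the ten basic classes of surfaces listed below. That is: (i) every such surface is locally, up to similarity, equal or parallel to a surface belonging to one of the ten basic classes, and hence its natural PDE is that of the basic class; (ii) the natural PDE of each basic class, in suitable natural principal parameters $(x,y)$, is the one indicated. (In the list, $\beta,\gamma$ denote the constants of the respective basic class; $\Delta,\bar\Delta,\Delta^*,\bar\Delta^*$ and the geometric function $\nu$ are as in the context.) 1. $H=0$: $\nu=-e^{\lambda}$, $\ \Delta\lambda=-e^{\lambda}$. 2. $H=\frac12$: $\nu=\frac12(1-e^{\lambda})$, $\ \Delta\lambda=-\sinh\lambda$. 3. $H'=1$: $\ \Delta^*(e^{\nu})=-2\,\nu(\nu+2)$. 4. $H=\beta H'$, $\beta^2>1$: $\ \Delta^*(\nu^{\beta})=-2\,\frac{\beta(\beta+1)}{(\beta-1)^2}\,\nu$. 5. $H=\beta H'$, $\beta^2<1$, $\beta\neq0$: $\ \bar\Delta^*(\nu^{\beta})=-2\,\frac{\beta(\beta+1)}{(\beta-1)^2}\,\nu$. 6. $H=\beta H'+1$, $\beta^2>1$: $\nu=\frac{(\beta-1)\lambda+2}{2}$, $\ \Delta^*(\lambda^{\beta})=-\frac{\beta\,((\beta-1)\lambda+2)((\beta+1)\lambda+2)}{2(\beta-1)\lambda}$.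 7. $H=\beta H'+1$, $\beta^2<1$, $\beta\neq0$: $\nu=\frac{(\beta-1)\lambda+2}{2}$, $\ \bar\Delta^*(\lambda^{\beta})=-\frac{\beta\,((\beta-1)\lambda+2)((\beta+1)\lambda+2)}{2(\beta-1)\lambda}$. 8. $K=-1$: $\nu=\tan\frac{\lambda}{2}$, $\ \bar\Delta\lambda=\sin\lambda$. 9. $K=2H'$: $\nu=\frac{\lambda-4}{\lambda-2}$, $\ \Delta^*(e^{\lambda})=-2$. 10. $K=\beta H'+\gamma$, $\beta\neq0$, $\gamma<0$: $\nu=\lambda+\frac{\beta}{2}$, $\ \mathcal{I}=\frac{1}{\sqrt{-\gamma}}\arctan\frac{\lambda}{\sqrt{-\gamma}}$, $\ \Delta^*(e^{\beta\mathcal{I}})=\frac{\beta\gamma}{2}\,\frac{\lambda(\beta\lambda+2\gamma)}{\lambda^2-\gamma}$.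
   Context: Surfaces are sufficiently smooth, $S: z=z(u,v)$, $(u,v)\in\mathcal{D}$ ($\mathcal D\subset\mathbb{R}^2$ open and connected), in Euclidean $\mathbb{R}^3$, without umbilical points, parameterized by principal parameters (the coefficients of the first and second fundamental forms satisfy $F=M=0$), with unit normal $l$ such that $(z_u,z_v,l)$ is positively oriented. Principal curvatures: $\nu_1=L/E$, $\nu_2=N/G$, with $\nu_1-\nu_2>0$ throughout. $K=\nu_1\nu_2$, $H=\frac{\nu_1+\nu_2}{2}$, $H'=\frac{\nu_1-\nu_2}{2}=\sqrt{H^2-K}$. With the principal geodesic curvatures $\gamma_1=-\frac{E_v}{2E\sqrt G}$, $\gamma_2=\frac{G_u}{2G\sqrt E}$, the surfaces considered satisfy either $\gamma_1\gamma_2\neq0$ everywhere, or $\gamma_1=0$ and $\gamma_2\neq 0$ everywhere. Weingarten surface: there are differentiable functions $f,g$ on an interval with $f-g\neq0$, $f'g'\neq0$ and a function $\nu(u,v)$ (the geometric function) with $(\nu_u,\nu_v)\neq(0,0)$ such that $\nu_1=f(\nu)$, $\nu_2=g(\nu)$. Natural principal parameters: principal parameters $(u,v)$ on a Weingarten surface for which the functions $\sqrt E\exp\left(\int\frac{f'd\nu}{f-g}\right)$ and $\sqrt G\exp\left(\int\frac{g'd\nu}{g-f}\right)$ (evaluated at $\nu=\nu(u,v)$) are constant. They exist locally on any Weingarten surface, and each parameter may be rescaled by a nonzero constant. Natural PDE: with respect to natural principal parameters, fix $(u_0,v_0)\in\mathcal D$, put $\nu_0=\nu(u_0,v_0)$,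 and let $\mathfrak{a},\mathfrak{b}$ be nonzero constants with $\mathfrak{a}^2E(u_0,v_0)=1$, $\mathfrak{b}^2G(u_0,v_0)=1$. The natural PDE of the Weingarten surface is $$\mathfrak{b}^2\exp\left(2\int_{\nu_0}^{\nu}\frac{g'd\nu}{g-f}\right)\left[f'\nu_{vv}+\left(f''-\frac{2f'^2}{f-g}\right)\nu_v^2\right]-\mathfrak{a}^2\exp\left(2\int_{\nu_0}^{\nu}\frac{f'd\nu}{f-g}\right)\left[g'\nu_{uu}+\left(g''-\frac{2g'^2}{g-f}\right)\nu_u^2\right]-fg(f-g)=0.$$ Saying that a listed PDE is the natural PDE of a basic class means that, for a suitable normalization of the constants $\mathfrak a,\mathfrak b,\nu_0$ (i.e. a suitable rescaling of the natural principal parameters), this equation becomes the listed PDE under the listed substitution, with $(x,y)=(u,v)$. Choice of geometric function: in classes 1–7, $\nu=\nu_2$ (so in classes 6 and 7, $\lambda=2H'>0$). In class 8, $\nu=\nu_1$. In class 9, $\nu=\nu_1+1$. In class 10, $\nu=\nu_1+\frac{\beta}{2}$ (i.e. $\lambda=\nu_1$). In classes 4 and 5, where $\nu<0$, the PDE is to be read with $|\nu|$ in place of $\nu$. Parallel surfaces: $\bar S(a): \bar z=z+a\,l$, $a=\mathrm{const}\neq0$, considered where $(1-a\nu_1)(1-a\nu_2)\neq0$. Similarities include reversal of the orientation of the normal. Operators: $\Delta\lambda=\lambda_{xx}+\lambda_{yy}$, $\ \bar\Delta\lambda=\lambda_{xx}-\lambda_{yy}$, $\ \Delta^*\lambda=\lambda_{xx}+(\lambda^{-1})_{yy}$,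 $\ \bar\Delta^*\lambda=\lambda_{xx}-(\lambda^{-1})_{yy}$. *)

theory Defs
  imports "HOL-Analysis.Analysis"
begin

section \<open>Smooth functions of two variables\<close>

definition pd_u :: "(real \<times> real \<Rightarrow> 'a::real_normed_vector) \<Rightarrow> real \<times> real \<Rightarrow> 'a" where
  "pd_u f p = vector_derivative (\<lambda>t. f (t, snd p)) (at (fst p))"

definition pd_v :: "(real \<times> real \<Rightarrow> 'a::real_normed_vector) \<Rightarrow> real \<times> real \<Rightarrow> 'a" where
  "pd_v f p = vector_derivative (\<lambda>t. f (fst p, t)) (at (snd p))"

text \<open>The following notions are meant for open sets only.\<close>

fun Ck_on :: "nat \<Rightarrow> (real \<times> real) set \<Rightarrow> (real \<times> real \<Rightarrow> 'a::real_normed_vector) \<Rightarrow> bool" where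
  "Ck_on 0 D f \<longleftrightarrow> continuous_on D f"
| "Ck_on (Suc k) D f \<longleftrightarrow> f differentiable_on D \<and> Ck_on k D (pd_u f) \<and> Ck_on k D (pd_v f)"

definition smooth_on :: "(real \<times> real) set \<Rightarrow> (real \<times> real \<Rightarrow> 'a::real_normed_vector) \<Rightarrow> bool" where
  "smooth_on D f \<longleftrightarrow> (\<forall>k. Ck_on k D f)"


section \<open>Surfaces in principal parameters\<close>

type_synonym surf = "real \<times> real \<Rightarrow> real^3"

definition normal :: "surf \<Rightarrow> surf" where
  "normal z p = sgn (cross3 (pd_u z p) (pd_v z p))"

definition coeffE :: "surf \<Rightarrow> real \<times> real \<Rightarrow> real" where "coeffE z p = pd_u z p \<bullet> pd_u z p"
definition coeffF :: "surf \<Rightarrow> real \<times> real \<Rightarrow> real" where "coeffF z p = pd_u z p \<bullet> pd_v z p"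
definition coeffG :: "surf \<Rightarrow> real \<times> real \<Rightarrow> real" where "coeffG z p = pd_v z p \<bullet> pd_v z p"
definition coeffL :: "surf \<Rightarrow> real \<times> real \<Rightarrow> real" where "coeffL z p = pd_u (pd_u z) p \<bullet> normal z p"
definition coeffM :: "surf \<Rightarrow> real \<times> real \<Rightarrow> real" where "coeffM z p = pd_v (pd_u z) p \<bullet> normal z p"
definition coeffN :: "surf \<Rightarrow> real \<times> real \<Rightarrow> real" where "coeffN z p = pd_v (pd_v z) p \<bullet> normal z p"

definition nu1 :: "surf \<Rightarrow> real \<times> real \<Rightarrow> real" where "nu1 z p = coeffL z p / coeffE z p"
definition nu2 :: "surf \<Rightarrow> real \<times> real \<Rightarrow> real" where "nu2 z p = coeffN z p / coeffG z p"

definition curvK :: "surf \<Rightarrow> real \<times> real \<Rightarrow> real" where "curvK z p = nu1 z p * nu2 z p"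
definition curvH :: "surf \<Rightarrow> real \<times> real \<Rightarrow> real" where "curvH z p = (nu1 z p + nu2 z p) / 2"
definition curvH' :: "surf \<Rightarrow> real \<times> real \<Rightarrow> real" where "curvH' z p = (nu1 z p - nu2 z p) / 2"

definition gam1 :: "surf \<Rightarrow> real \<times> real \<Rightarrow> real" where
  "gam1 z p = - (pd_v (coeffE z) p / (2 * coeffE z p * sqrt (coeffG z p)))"
definition gam2 :: "surf \<Rightarrow> real \<times> real \<Rightarrow> real" where
  "gam2 z p = pd_u (coeffG z) p / (2 * coeffG z p * sqrt (coeffE z p))"

definition principal_surface :: "surf \<Rightarrow> (real \<times> real) set \<Rightarrow> bool" where
  "principal_surface z D \<longleftrightarrow> open D \<and> connected D \<and> smooth_on D z \<and>
     (\<forall>p\<in>D. cross3 (pd_u z p) (pd_v z p) \<noteq> 0 \<and> coeffF z p = 0 \<and> coeffM z p = 0 \<and> nu1 z p > nu2 z p)"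

definition surface :: "surf \<Rightarrow> (real \<times> real) set \<Rightarrow> bool" where
  "surface z D \<longleftrightarrow> principal_surface z D \<and>
     ((\<forall>p\<in>D. gam1 z p * gam2 z p \<noteq> 0) \<or> (\<forall>p\<in>D. gam1 z p = 0 \<and> gam2 z p \<noteq> 0))"

text \<open>
  Reversing the normal replaces the principal curvatures by their negatives; since the larger one
  has to be called \<open>nu1\<close>, the two parameters change roles, and so do \<open>gam1\<close> and \<open>gam2\<close>.
  Hence a reversed surface may have \<open>gam2 = 0\<close> and \<open>gam1 \<noteq> 0\<close>.
\<close>

definition oriented_surface :: "surf \<Rightarrow> (real \<times> real) set \<Rightarrow> bool" where
  "oriented_surface z D \<longleftrightarrow> surface z D \<or>
     (principal_surface z D \<and> (\<forall>p\<in>D. gam1 z p \<noteq> 0 \<and> gam2 z p = 0))"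


section \<open>Changes of parameters, parallel surfaces, similarities\<close>

definition reparam :: "(real \<times> real \<Rightarrow> real \<times> real) \<Rightarrow> (real \<times> real) set \<Rightarrow> (real \<times> real) set \<Rightarrow> bool" where
  "reparam \<phi> U V \<longleftrightarrow> open U \<and> connected U \<and> open V \<and> bij_betw \<phi> U V \<and>
     smooth_on U \<phi> \<and> smooth_on V (the_inv_into U \<phi>)"

definition parallel :: "real \<Rightarrow> surf \<Rightarrow> surf" where
  "parallel a z p = z p + a *\<^sub>R normal z p"

definition parallel_domain :: "real \<Rightarrow> surf \<Rightarrow> (real \<times> real) set \<Rightarrow> (real \<times> real) set" where
  "parallel_domain a z D = {p \<in> D. (1 - a * nu1 z p) * (1 - a * nu2 z p) \<noteq> 0}"

definition similarity :: "(real^3 \<Rightarrow> real^3) \<Rightarrow> bool" where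
  "similarity T \<longleftrightarrow> (\<exists>c>0. \<forall>x y. dist (T x) (T y) = c * dist x y)"


section \<open>Weingarten surfaces, natural principal parameters, natural PDE\<close>

definition weingarten ::
  "surf \<Rightarrow> (real \<times> real) set \<Rightarrow> real set \<Rightarrow> (real \<Rightarrow> real) \<Rightarrow> (real \<Rightarrow> real) \<Rightarrow> (real \<times> real \<Rightarrow> real) \<Rightarrow> bool" where
  "weingarten z D I f g \<nu> \<longleftrightarrow> principal_surface z D \<and> open I \<and> is_interval I \<and>
     (\<forall>t\<in>I. f differentiable (at t) \<and> deriv f differentiable (at t) \<and>
            g differentiable (at t) \<and> deriv g differentiable (at t) \<and>
            f t - g t \<noteq> 0 \<and> deriv f t * deriv g t \<noteq> 0) \<and>
     smooth_on D \<nu> \<and> \<nu> ` D \<subseteq> I \<and>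
     (\<forall>p\<in>D. (pd_u \<nu> p, pd_v \<nu> p) \<noteq> (0, 0) \<and> nu1 z p = f (\<nu> p) \<and> nu2 z p = g (\<nu> p))"

definition int_f :: "(real \<Rightarrow> real) \<Rightarrow> (real \<Rightarrow> real) \<Rightarrow> real \<Rightarrow> real \<Rightarrow> real" where
  "int_f f g a b = (LBINT t=ereal a..ereal b. deriv f t / (f t - g t))"

definition int_g :: "(real \<Rightarrow> real) \<Rightarrow> (real \<Rightarrow> real) \<Rightarrow> real \<Rightarrow> real \<Rightarrow> real" where
  "int_g f g a b = (LBINT t=ereal a..ereal b. deriv g t / (g t - f t))"

definition natural_params ::
  "surf \<Rightarrow> (real \<times> real) set \<Rightarrow> (real \<Rightarrow> real) \<Rightarrow> (real \<Rightarrow> real) \<Rightarrow> (real \<times> real \<Rightarrow> real) \<Rightarrow> bool" where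
  "natural_params z D f g \<nu> \<longleftrightarrow> (\<forall>t0 \<in> \<nu> ` D.
     (\<lambda>p. sqrt (coeffE z p) * exp (int_f f g t0 (\<nu> p))) constant_on D \<and>
     (\<lambda>p. sqrt (coeffG z p) * exp (int_g f g t0 (\<nu> p))) constant_on D)"

definition natural_pde ::
  "(real \<Rightarrow> real) \<Rightarrow> (real \<Rightarrow> real) \<Rightarrow> real \<Rightarrow> real \<Rightarrow> real \<Rightarrow> (real \<times> real \<Rightarrow> real) \<Rightarrow> real \<times> real \<Rightarrow> bool" where
  "natural_pde f g a b \<nu>\<^sub>0 \<nu> p \<longleftrightarrow>
     (let t = \<nu> p; f1 = deriv f t; f2 = deriv (deriv f) t; g1 = deriv g t; g2 = deriv (deriv g) t in
      b\<^sup>2 * exp (2 * int_g f g \<nu>\<^sub>0 t) *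
        (f1 * pd_v (pd_v \<nu>) p + (f2 - 2 * f1\<^sup>2 / (f t - g t)) * (pd_v \<nu> p)\<^sup>2)
      - a\<^sup>2 * exp (2 * int_f f g \<nu>\<^sub>0 t) *
        (g1 * pd_u (pd_u \<nu>) p + (g2 - 2 * g1\<^sup>2 / (g t - f t)) * (pd_u \<nu> p)\<^sup>2)
      - f t * g t * (f t - g t) = 0)"


section \<open>The ten basic classes\<close>

datatype basic_class =
    Class1 | Class2 | Class3
  | Class4 (beta: real) | Class5 (beta: real) | Class6 (beta: real) | Class7 (beta: real)
  | Class8 | Class9
  | Class10 (beta: real) (gamma: real)

fun valid_class :: "basic_class \<Rightarrow> bool" where
  "valid_class (Class4 \<beta>) \<longleftrightarrow> \<beta>\<^sup>2 > 1"
| "valid_class (Class5 \<beta>) \<longleftrightarrow> \<beta>\<^sup>2 < 1 \<and> \<beta> \<noteq> 0"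
| "valid_class (Class6 \<beta>) \<longleftrightarrow> \<beta>\<^sup>2 > 1"
| "valid_class (Class7 \<beta>) \<longleftrightarrow> \<beta>\<^sup>2 < 1 \<and> \<beta> \<noteq> 0"
| "valid_class (Class10 \<beta> \<gamma>) \<longleftrightarrow> \<beta> \<noteq> 0 \<and> \<gamma> < 0"
| "valid_class _ \<longleftrightarrow> True"

fun curvature_relation :: "basic_class \<Rightarrow> real \<Rightarrow> real \<Rightarrow> real \<Rightarrow> bool" where
  "curvature_relation Class1 K H H' \<longleftrightarrow> H = 0"
| "curvature_relation Class2 K H H' \<longleftrightarrow> H = 1 / 2"
| "curvature_relation Class3 K H H' \<longleftrightarrow> H' = 1"
| "curvature_relation (Class4 \<beta>) K H H' \<longleftrightarrow> H = \<beta> * H'"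
| "curvature_relation (Class5 \<beta>) K H H' \<longleftrightarrow> H = \<beta> * H'"
| "curvature_relation (Class6 \<beta>) K H H' \<longleftrightarrow> H = \<beta> * H' + 1"
| "curvature_relation (Class7 \<beta>) K H H' \<longleftrightarrow> H = \<beta> * H' + 1"
| "curvature_relation Class8 K H H' \<longleftrightarrow> K = -1"
| "curvature_relation Class9 K H H' \<longleftrightarrow> K = 2 * H'"
| "curvature_relation (Class10 \<beta> \<gamma>) K H H' \<longleftrightarrow> K = \<beta> * H' + \<gamma>"

definition basic_surface :: "basic_class \<Rightarrow> surf \<Rightarrow> (real \<times> real) set \<Rightarrow> bool" where
  "basic_surface c z D \<longleftrightarrow> oriented_surface z D \<and>
     (\<forall>p\<in>D. curvature_relation c (curvK z p) (curvH z p) (curvH' z p))"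

fun geometric_function :: "basic_class \<Rightarrow> surf \<Rightarrow> real \<times> real \<Rightarrow> real" where
  "geometric_function Class8 z p = nu1 z p"
| "geometric_function Class9 z p = nu1 z p + 1"
| "geometric_function (Class10 \<beta> \<gamma>) z p = nu1 z p + \<beta> / 2"
| "geometric_function _ z p = nu2 z p"

text \<open>
  The listed substitution, giving \<open>\<nu>\<close> in terms of \<open>\<lambda>\<close>. In the third, fourth and fifth class the
  PDE is an equation for \<open>\<nu>\<close> itself.
\<close>

fun substitution :: "basic_class \<Rightarrow> real \<Rightarrow> real" where
  "substitution Class1 l = - exp l"
| "substitution Class2 l = (1 - exp l) / 2"
| "substitution Class3 l = l"
| "substitution (Class4 \<beta>) l = l"
| "substitution (Class5 \<beta>) l = l"
| "substitution (Class6 \<beta>) l = ((\<beta> - 1) * l + 2) / 2"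
| "substitution (Class7 \<beta>) l = ((\<beta> - 1) * l + 2) / 2"
| "substitution Class8 l = tan (l / 2)"
| "substitution Class9 l = (l - 4) / (l - 2)"
| "substitution (Class10 \<beta> \<gamma>) l = l + \<beta> / 2"

definition Lap :: "(real \<times> real \<Rightarrow> real) \<Rightarrow> real \<times> real \<Rightarrow> real" where
  "Lap h p = pd_u (pd_u h) p + pd_v (pd_v h) p"
definition Lap_bar :: "(real \<times> real \<Rightarrow> real) \<Rightarrow> real \<times> real \<Rightarrow> real" where
  "Lap_bar h p = pd_u (pd_u h) p - pd_v (pd_v h) p"
definition Lap_star :: "(real \<times> real \<Rightarrow> real) \<Rightarrow> real \<times> real \<Rightarrow> real" where
  "Lap_star h p = pd_u (pd_u h) p + pd_v (pd_v (\<lambda>q. inverse (h q))) p"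
definition Lap_bar_star :: "(real \<times> real \<Rightarrow> real) \<Rightarrow> real \<times> real \<Rightarrow> real" where
  "Lap_bar_star h p = pd_u (pd_u h) p - pd_v (pd_v (\<lambda>q. inverse (h q))) p"

fun class_pde :: "basic_class \<Rightarrow> (real \<times> real \<Rightarrow> real) \<Rightarrow> real \<times> real \<Rightarrow> bool" where
  "class_pde Class1 l p \<longleftrightarrow> Lap l p = - exp (l p)"
| "class_pde Class2 l p \<longleftrightarrow> Lap l p = - sinh (l p)"
| "class_pde Class3 l p \<longleftrightarrow> Lap_star (\<lambda>q. exp (l q)) p = - 2 * l p * (l p + 2)"
| "class_pde (Class4 \<beta>) l p \<longleftrightarrow>
     Lap_star (\<lambda>q. \<bar>l q\<bar> powr \<beta>) p = - 2 * (\<beta> * (\<beta> + 1) / (\<beta> - 1)\<^sup>2) * \<bar>l p\<bar>"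
| "class_pde (Class5 \<beta>) l p \<longleftrightarrow>
     Lap_bar_star (\<lambda>q. \<bar>l q\<bar> powr \<beta>) p = - 2 * (\<beta> * (\<beta> + 1) / (\<beta> - 1)\<^sup>2) * \<bar>l p\<bar>"
| "class_pde (Class6 \<beta>) l p \<longleftrightarrow>
     Lap_star (\<lambda>q. l q powr \<beta>) p =
       - (\<beta> * ((\<beta> - 1) * l p + 2) * ((\<beta> + 1) * l p + 2) / (2 * (\<beta> - 1) * l p))"
| "class_pde (Class7 \<beta>) l p \<longleftrightarrow>
     Lap_bar_star (\<lambda>q. l q powr \<beta>) p =
       - (\<beta> * ((\<beta> - 1) * l p + 2) * ((\<beta> + 1) * l p + 2) / (2 * (\<beta> - 1) * l p))"
| "class_pde Class8 l p \<longleftrightarrow> Lap_bar l p = sin (l p)"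
| "class_pde Class9 l p \<longleftrightarrow> Lap_star (\<lambda>q. exp (l q)) p = - 2"
| "class_pde (Class10 \<beta> \<gamma>) l p \<longleftrightarrow>
     Lap_star (\<lambda>q. exp (\<beta> * (1 / sqrt (- \<gamma>) * arctan (l q / sqrt (- \<gamma>))))) p =
       \<beta> * \<gamma> / 2 * (l p * (\<beta> * l p + 2 * \<gamma>) / ((l p)\<^sup>2 - \<gamma>))"

text \<open>
  With the constants \<open>a\<close>, \<open>b\<close>, \<open>\<nu>\<^sub>0\<close>, the natural PDE for the curvature functions \<open>f\<close>, \<open>g\<close> on \<open>I\<close> is,
  under the substitution, the same equation as the listed PDE: the two are equivalent at every point
  for every unknown function whose substituted values lie in \<open>I\<close>.
\<close>

definition pde_becomes ::
  "basic_class \<Rightarrow> real set \<Rightarrow> (real \<Rightarrow> real) \<Rightarrow> (real \<Rightarrow> real) \<Rightarrow> real \<Rightarrow> real \<Rightarrow> real \<Rightarrow> bool" where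
  "pde_becomes c I f g a b \<nu>\<^sub>0 \<longleftrightarrow>
     (\<forall>\<Omega> l. open \<Omega> \<and> Ck_on 2 \<Omega> l \<and> (\<forall>q\<in>\<Omega>. substitution c (l q) \<in> I) \<longrightarrow>
       (\<forall>q\<in>\<Omega>. natural_pde f g a b \<nu>\<^sub>0 (\<lambda>r. substitution c (l r)) q \<longleftrightarrow> class_pde c l q))"

text \<open>
  The parameters of \<open>z\<close> on \<open>D\<close> are natural principal parameters with respect to the geometric function
  \<open>\<nu>\<close>, they are scaled such that the natural PDE of \<open>z\<close> is that of the class \<open>c\<close>, and the function
  \<open>\<lambda>\<close> that corresponds to \<open>\<nu>\<close> solves it. On the range of \<open>\<nu>\<close>, the functions \<open>f\<close> and \<open>g\<close> are determined
  by \<open>z\<close> and \<open>\<nu>\<close>. The base point \<open>p0\<close> is arbitrary, and \<open>a\<close>, \<open>b\<close> are determined up to sign.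
\<close>

definition has_natural_pde_of ::
  "surf \<Rightarrow> (real \<times> real) set \<Rightarrow> (real \<times> real \<Rightarrow> real) \<Rightarrow> basic_class \<Rightarrow> bool" where
  "has_natural_pde_of z D \<nu> c \<longleftrightarrow>
     (\<exists>f g. weingarten z D (\<nu> ` D) f g \<nu> \<and> natural_params z D f g \<nu> \<and>
        (\<forall>p0\<in>D. \<forall>a b. a\<^sup>2 * coeffE z p0 = 1 \<and> b\<^sup>2 * coeffG z p0 = 1 \<longrightarrow>
           pde_becomes c (\<nu> ` D) f g a b (\<nu> p0))) \<and>
     (\<exists>l. smooth_on D l \<and> (\<forall>p\<in>D. \<nu> p = substitution c (l p) \<and> class_pde c l p))"

end

theory Submission
  imports Defs
begin

text \<open>
  Reversing the normal, passing to a parallel surface and scaling act on the principal curvatures by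
  Moebius maps, which transform the linear relation linearly. The first two preserve \<open>\<gamma>\<close>,
  \<open>\<alpha>\<^sup>2 + 4 \<gamma> \<delta>\<close> and, up to sign, \<open>\<beta>\<close>; a case distinction on these leads to one of the ten classes.

  Write \<open>\<nu>\<^sub>1 = f(\<nu>)\<close>, \<open>\<nu>\<^sub>2 = g(\<nu>)\<close> and let \<open>\<Phi>\<close>, \<open>\<Psi>\<close> be positive with \<open>\<Phi>' / \<Phi> = 2 f' / (f - g)\<close> and
  \<open>\<Phi> \<Psi> = (f - g)\<^sup>2\<close>. By the Codazzi equations \<open>E \<Phi>\<close> depends on \<open>u\<close> only and \<open>G \<Psi>\<close> on \<open>v\<close> only, so
  both become constants \<open>1 / A\<close> and \<open>1 / B\<close> after rescaling each parameter separately. Then the Gauss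
  equation is the natural PDE, and it reads \<open>B m(\<nu>)\<^sub>v\<^sub>v - A n(\<nu>)\<^sub>u\<^sub>u = f g / (f - g)\<close> with
  \<open>m' = f' / \<Phi>\<close> and \<open>n' = g' / \<Psi>\<close>. Applying \<open>x \<mapsto> k x / (1 + k a x)\<close> to \<open>f\<close> and \<open>g\<close> multiplies \<open>m\<close> and
  the right-hand side by a factor \<open>k\<close> and \<open>n\<close> by \<open>1 / k\<close>, so it is absorbed into \<open>A\<close>: parallel and
  similar surfaces have the same natural PDE.
\<close>

section \<open>Calculus in the plane\<close>

text \<open>At distance a the coefficient of K becomes \<delta> - \<alpha> a - \<gamma> a^2 and that
  of H becomes \<alpha> + 2 \<gamma> a, up to sign and scale. A real root of the former leaves a
  relation between H and H'; without one, the vertex of the quadratic removes H and keeps K. Where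
  (1 - a \<nu>1) (1 - a \<nu>2) < 0 the parallel surface has the opposite normal, hence a sign
  \<epsilon>. It is constant only locally, so the work is done near a point p0. Exchanging the two
  parameters realises a reversal of the normal. The natural PDE is that of the original surface z,
  whereas the geometric function comes from the basic surface y parallel to z. So f and g for z are
  Moebius images of those of y; z is brought to natural parameters and y is carried along. The ten
  classes enter through one list of functions and constants, verified by computation in each class.
  \<open>has_pd\<close> keeps a total derivative together with its two columns, because partial
  derivatives alone would not obey the chain rule.\<close>

definition has_pd :: "(real \<times> real \<Rightarrow> 'a::real_normed_vector) \<Rightarrow> 'a \<Rightarrow> 'a \<Rightarrow> real \<times> real \<Rightarrow> bool" where
  "has_pd f a b p \<longleftrightarrow> (f has_derivative (\<lambda>h. fst h *\<^sub>R a + snd h *\<^sub>R b)) (at p)"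

lemma has_pd_u: assumes "has_pd f a b p" shows "((\<lambda>t. f (t, snd p)) has_vector_derivative a) (at (fst p))"
proof -
  have "((\<lambda>t. (t, snd p)) has_derivative (\<lambda>h. (h, 0))) (at (fst p))"
    by (auto intro!: derivative_eq_intros)
  from diff_chain_at[OF this, of f "\<lambda>h. fst h *\<^sub>R a + snd h *\<^sub>R b"] assms
  show ?thesis by (simp add: has_pd_def has_vector_derivative_def o_def)
qed

lemma has_pd_v: assumes "has_pd f a b p" shows "((\<lambda>t. f (fst p, t)) has_vector_derivative b) (at (snd p))"
proof -
  have "((\<lambda>t. (fst p, t)) has_derivative (\<lambda>h. (0, h))) (at (snd p))"
    by (auto intro!: derivative_eq_intros)
  from diff_chain_at[OF this, of f "\<lambda>h. fst h *\<^sub>R a + snd h *\<^sub>R b"] assms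
  show ?thesis by (simp add: has_pd_def has_vector_derivative_def o_def)
qed

lemma has_pd_imp: assumes "has_pd f a b p" shows "pd_u f p = a" "pd_v f p = b"
  using has_pd_u[OF assms] has_pd_v[OF assms] by (simp_all add: pd_u_def pd_v_def vector_derivative_at)

lemma differentiable_has_pd:
  assumes "f differentiable (at p)" shows "has_pd f (pd_u f p) (pd_v f p) p"
proof -
  obtain f' where f': "(f has_derivative f') (at p)" using assms by (auto simp: differentiable_def)
  interpret bounded_linear f' using f' by (rule has_derivative_bounded_linear)
  have "f' h = fst h *\<^sub>R f' (1,0) + snd h *\<^sub>R f' (0,1)" for h
  proof -
    have "h = fst h *\<^sub>R (1,0) + snd h *\<^sub>R (0,1)" by (simp add: prod_eq_iff)
    then show ?thesis by (metis add scaleR)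
  qed
  then have "f' = (\<lambda>h. fst h *\<^sub>R f' (1,0) + snd h *\<^sub>R f' (0,1))" by (rule ext)
  then have "has_pd f (f' (1,0)) (f' (0,1)) p" using f' by (simp add: has_pd_def)
  then show ?thesis using has_pd_imp by metis
qed

lemma has_pd_differentiable: "has_pd f a b p \<Longrightarrow> f differentiable (at p)"
  by (auto simp: has_pd_def differentiable_def)

text \<open>A formula for \<open>pd_u f\<close> or \<open>pd_v f\<close> is usually known on an open
  set only; this rule lets such a formula be differentiated once more.\<close>

lemma has_pd_cong:
  assumes "has_pd f a b p" "open S" "p \<in> S" "\<And>q. q \<in> S \<Longrightarrow> f q = g q" shows "has_pd g a b p"
  using assms unfolding has_pd_def by (auto intro: has_derivative_transform_within_open)

lemma has_pd_eq: "has_pd f a b p \<Longrightarrow> a = a' \<Longrightarrow> b = b' \<Longrightarrow> has_pd f a' b' p" by simp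

lemma has_pd_const: "has_pd (\<lambda>p. c) 0 0 p"
  by (simp add: has_pd_def)

lemma has_pd_fst: "has_pd fst 1 0 p"
  unfolding has_pd_def by (auto intro!: derivative_eq_intros)

lemma has_pd_snd: "has_pd snd 0 1 p"
  unfolding has_pd_def by (auto intro!: derivative_eq_intros)

lemma has_pd_add: "has_pd f a b p \<Longrightarrow> has_pd g c d p \<Longrightarrow> has_pd (\<lambda>p. f p + g p) (a + c) (b + d) p"
  unfolding has_pd_def by (auto intro!: derivative_eq_intros simp: algebra_simps)

lemma has_pd_linear:
  assumes "bounded_linear T" "has_pd f a b p" shows "has_pd (\<lambda>p. T (f p)) (T a) (T b) p"
proof -
  interpret bounded_linear T by fact
  from bounded_linear.has_derivative[OF assms(1) assms(2)[unfolded has_pd_def]]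
  show ?thesis by (simp add: has_pd_def add scaleR)
qed

lemma has_pd_Pair: "has_pd f a b p \<Longrightarrow> has_pd g c d p \<Longrightarrow> has_pd (\<lambda>p. (f p, g p)) (a, c) (b, d) p"
  unfolding has_pd_def by (auto intro!: derivative_eq_intros)

lemma has_pd_bilinear:
  assumes "bounded_bilinear B" "has_pd f a b p" "has_pd g c d p"
  shows "has_pd (\<lambda>p. B (f p) (g p)) (B (f p) c + B a (g p)) (B (f p) d + B b (g p)) p"
proof -
  interpret bounded_bilinear B by fact
  from FDERIV[OF assms(2)[unfolded has_pd_def] assms(3)[unfolded has_pd_def]]
  show ?thesis unfolding has_pd_def
    by (rule back_subst[of "\<lambda>F. (_ has_derivative F) _"]) (simp add: fun_eq_iff add_left add_right scaleR_left
        scaleR_right algebra_simps)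
qed

lemmas has_pd_inner = has_pd_bilinear[OF bounded_bilinear_inner]
lemmas has_pd_mult = has_pd_bilinear[OF bounded_bilinear_mult]
lemmas has_pd_scaleR = has_pd_bilinear[OF bounded_bilinear_scaleR]

lemma bounded_bilinear_cross3: "bounded_bilinear cross3"
  using bilinear_cross bilinear_conv_bounded_bilinear by blast

lemma has_pd_minus: "has_pd f a b p \<Longrightarrow> has_pd (\<lambda>p. - f p) (- a) (- b) p"
  by (rule has_pd_linear) (auto intro: bounded_linear_minus bounded_linear_ident)

lemma has_pd_diff: "has_pd f a b p \<Longrightarrow> has_pd g c d p \<Longrightarrow> has_pd (\<lambda>p. f p - g p) (a - c) (b - d) p"
  using has_pd_add[OF _ has_pd_minus, of f a b p g c d] by simp

lemma has_pd_real_comp: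
  fixes f :: "real \<times> real \<Rightarrow> real"
  assumes "(h has_real_derivative h') (at (f p))" "has_pd f a b p"
  shows "has_pd (\<lambda>p. h (f p)) (h' * a) (h' * b) p"
proof -
  from diff_chain_at[OF assms(2)[unfolded has_pd_def] assms(1)[unfolded has_field_derivative_def]]
  show ?thesis unfolding has_pd_def o_def
    by (rule back_subst[of "\<lambda>F. (_ has_derivative F) _"]) (simp add: fun_eq_iff algebra_simps)
qed

text \<open>The pairs \<open>c\<close> and \<open>d\<close> are the columns of the Jacobian of
  \<phi>; for a change of parameters that preserves the parameter lines they have the form
  (\<alpha>, 0) and (0, \<beta>).\<close>

lemma has_pd_comp:
  fixes F :: "real \<times> real \<Rightarrow> 'a::real_normed_vector"
  assumes "has_pd F a b (\<phi> p)" "has_pd \<phi> c d p"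
  shows "has_pd (F \<circ> \<phi>) (fst c *\<^sub>R a + snd c *\<^sub>R b) (fst d *\<^sub>R a + snd d *\<^sub>R b) p"
proof -
  from diff_chain_at[OF assms(2)[unfolded has_pd_def] assms(1)[unfolded has_pd_def]]
  show ?thesis unfolding has_pd_def
    by (rule back_subst[of "\<lambda>F. (_ has_derivative F) _"]) (simp add: fun_eq_iff algebra_simps)
qed

lemma has_pd_swap: "has_pd f a b (prod.swap p) \<Longrightarrow> has_pd (f \<circ> prod.swap) b a p"
  using has_pd_comp[of f a b prod.swap p "(0,1)" "(1,0)"] has_pd_Pair[OF has_pd_snd has_pd_fst, of p]
  by (simp add: prod.swap_def[abs_def])

lemma has_pd_continuous: "has_pd f a b p \<Longrightarrow> isCont f p"
  unfolding has_pd_def by (rule has_derivative_continuous)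

lemma swap_geometry:
  "pd_u (f \<circ> prod.swap) = pd_v f \<circ> prod.swap" "pd_v (f \<circ> prod.swap) = pd_u f \<circ> prod.swap"
  by (auto simp: pd_u_def pd_v_def fun_eq_iff)

subsection \<open>Functions of class Ck\<close>

lemma Ck_on_cong:
  assumes "open D" "\<And>p. p \<in> D \<Longrightarrow> f p = g p" "Ck_on k D f" shows "Ck_on k D g"
  using assms(2,3)
proof (induction k arbitrary: f g)
  case 0 then show ?case by (metis Ck_on.simps(1) continuous_on_cong)
next
  case (Suc k)
  have pd: "has_pd g (pd_u f p) (pd_v f p) p" if "p \<in> D" for p
  proof (rule has_pd_cong[of f])
    show "has_pd f (pd_u f p) (pd_v f p) p" using Suc.prems that assms(1)
      by (intro differentiable_has_pd) (auto simp: differentiable_on_eq_differentiable_at)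
  qed (use Suc.prems that assms in auto)
  have "g differentiable_on D"
    unfolding differentiable_on_eq_differentiable_at[OF assms(1)] by (blast intro: has_pd_differentiable pd)
  moreover have "Ck_on k D (pd_u g)"
    by (rule Suc.IH[of "pd_u f"]) (use Suc.prems has_pd_imp[OF pd] in auto)
  moreover have "Ck_on k D (pd_v g)"
    by (rule Suc.IH[of "pd_v f"]) (use Suc.prems has_pd_imp[OF pd] in auto)
  ultimately show ?case by simp
qed

text \<open>Any formulas \<open>a\<close>, \<open>b\<close> for the partial derivatives will do.
  Regularity of a composite expression thus follows by induction from its differentiation rule,
  without handling \<open>pd_u\<close> of the expression itself.\<close>

lemma Ck_SucI:
  assumes "open D" "\<And>p. p \<in> D \<Longrightarrow> has_pd f (a p) (b p) p" "Ck_on k D a" "Ck_on k D b"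
  shows "Ck_on (Suc k) D f"
proof -
  have "f differentiable_on D"
    unfolding differentiable_on_eq_differentiable_at[OF assms(1)] by (blast intro: has_pd_differentiable assms(2))
  moreover have "Ck_on k D (pd_u f)"
    by (rule Ck_on_cong[OF assms(1) _ assms(3)]) (simp add: has_pd_imp[OF assms(2)])
  moreover have "Ck_on k D (pd_v f)"
    by (rule Ck_on_cong[OF assms(1) _ assms(4)]) (simp add: has_pd_imp[OF assms(2)])
  ultimately show ?thesis by simp
qed

lemma Ck_SucD:
  assumes "open D" "Ck_on (Suc k) D f"
  shows "\<And>p. p \<in> D \<Longrightarrow> has_pd f (pd_u f p) (pd_v f p) p" "Ck_on k D (pd_u f)" "Ck_on k D (pd_v f)"
  using assms by (auto intro!: differentiable_has_pd simp: differentiable_on_eq_differentiable_at)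

lemma Ck_pred: "Ck_on (Suc k) D f \<Longrightarrow> Ck_on k D f"
proof (induction k arbitrary: f)
  case 0 then show ?case by (auto intro: differentiable_imp_continuous_on)
next
  case (Suc k) then show ?case by (metis Ck_on.simps(2))
qed

lemma Ck_continuous: "Ck_on k D f \<Longrightarrow> continuous_on D f"
  by (cases k) (auto intro: differentiable_imp_continuous_on)

lemma Ck_subset: "Ck_on k D f \<Longrightarrow> S \<subseteq> D \<Longrightarrow> Ck_on k S f"
  by (induction k arbitrary: f) (auto intro: continuous_on_subset differentiable_on_subset)

lemma Ck_const: "Ck_on k D (\<lambda>p. c)"
proof (induction k arbitrary: c)
  case (Suc k)
  have "pd_u (\<lambda>p. c) = (\<lambda>p. 0)" "pd_v (\<lambda>p. c) = (\<lambda>p. 0)"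
    using has_pd_imp[OF has_pd_const] by (auto simp: fun_eq_iff)
  then show ?case using Suc by simp
qed simp

lemma Ck_fst: "open D \<Longrightarrow> Ck_on k D fst"
  by (cases k) (auto intro: continuous_intros Ck_SucI[OF _ has_pd_fst] Ck_const simp del: Ck_on.simps(2))

lemma Ck_snd: "open D \<Longrightarrow> Ck_on k D snd"
  by (cases k) (auto intro: continuous_intros Ck_SucI[OF _ has_pd_snd] Ck_const simp del: Ck_on.simps(2))

lemma Ck_add:
  assumes "open D" "Ck_on k D f" "Ck_on k D g" shows "Ck_on k D (\<lambda>p. f p + g p)"
  using assms(2,3)
proof (induction k arbitrary: f g)
  case (Suc k)
  note f = Ck_SucD[OF assms(1) Suc.prems(1)] and g = Ck_SucD[OF assms(1) Suc.prems(2)]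
  show ?case by (rule Ck_SucI[OF assms(1) has_pd_add[OF f(1) g(1)]]) (auto intro!: Suc.IH f g)
qed (auto intro: continuous_intros)

lemma Ck_linear:
  assumes "open D" "bounded_linear T" "Ck_on k D f" shows "Ck_on k D (\<lambda>p. T (f p))"
  using assms(3)
proof (induction k arbitrary: f)
  case 0 then show ?case by (auto intro: bounded_linear.continuous_on[OF assms(2)])
next
  case (Suc k)
  note f = Ck_SucD[OF assms(1) Suc.prems(1)]
  show ?case by (rule Ck_SucI[OF assms(1) has_pd_linear[OF assms(2) f(1)]]) (auto intro!: Suc.IH f)
qed

lemma Ck_Pair:
  assumes "open D" "Ck_on k D f" "Ck_on k D g" shows "Ck_on k D (\<lambda>p. (f p, g p))"
  using assms(2,3)
proof (induction k arbitrary: f g)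
  case (Suc k)
  note f = Ck_SucD[OF assms(1) Suc.prems(1)] and g = Ck_SucD[OF assms(1) Suc.prems(2)]
  show ?case by (rule Ck_SucI[OF assms(1) has_pd_Pair[OF f(1) g(1)]]) (auto intro!: Suc.IH f g)
qed (auto intro: continuous_intros)

lemma Ck_bilinear:
  assumes "open D" "bounded_bilinear B" "Ck_on k D f" "Ck_on k D g" shows "Ck_on k D (\<lambda>p. B (f p) (g p))"
  using assms(3,4)
proof (induction k arbitrary: f g)
  case 0 then show ?case by (auto intro: bounded_bilinear.continuous_on[OF assms(2)])
next
  case (Suc k)
  note f = Ck_SucD[OF assms(1) Suc.prems(1)] and g = Ck_SucD[OF assms(1) Suc.prems(2)]
  note p = Ck_pred[OF Suc.prems(1)] Ck_pred[OF Suc.prems(2)]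
  show ?case by (rule Ck_SucI[OF assms(1) has_pd_bilinear[OF assms(2) f(1) g(1)]]) (auto intro!: Ck_add assms(1)
      Suc.IH f g p)
qed

lemmas Ck_mult = Ck_bilinear[OF _ bounded_bilinear_mult]

text \<open>The partial derivatives of \<open>F \<circ> \<phi>\<close> are combinations of
  \<open>pd_u F \<circ> \<phi>\<close> and \<open>pd_v F \<circ> \<phi>\<close>. The induction
  therefore varies the outer function and keeps \<phi>, whose surplus regularity is discarded by
  \<open>Ck_pred\<close>.\<close>

lemma Ck_comp:
  fixes F :: "real \<times> real \<Rightarrow> 'a::real_normed_vector"
  assumes "open V" "open U" "Ck_on k V F" "Ck_on k U \<phi>" "\<phi> ` U \<subseteq> V" shows "Ck_on k U (F \<circ> \<phi>)"
  using assms(3,4)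
proof (induction k arbitrary: F)
  case 0
  then show ?case using continuous_on_compose[of U \<phi> F] continuous_on_subset[OF _ assms(5), of F] by simp
next
  case (Suc k)
  note f = Ck_SucD[OF assms(1) Suc.prems(1)] and g = Ck_SucD[OF assms(2) Suc.prems(2)]
  note p = Ck_pred[OF Suc.prems(2)]
  have sc: "Ck_on k U (\<lambda>p. A p *\<^sub>R X (\<phi> p))" if "Ck_on k U A" "Ck_on k V X" for A and X :: "real \<times> real \<Rightarrow> 'a"
    using Ck_bilinear[OF assms(2) bounded_bilinear_scaleR that(1) Suc.IH[OF that(2) p]] by (simp add: o_def)
  have fs: "Ck_on k U (\<lambda>p. fst (g p))" "Ck_on k U (\<lambda>p. snd (g p))" if "Ck_on k U g" for g :: "real \<times> real \<Rightarrow> real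
      \<times> real"
    using Ck_linear[OF assms(2) bounded_linear_fst that] Ck_linear[OF assms(2) bounded_linear_snd that] by auto
  show ?case
  proof (rule Ck_SucI[OF assms(2)])
    fix q assume "q \<in> U"
    then show "has_pd (F \<circ> \<phi>) (fst (pd_u \<phi> q) *\<^sub>R pd_u F (\<phi> q) + snd (pd_u \<phi> q) *\<^sub>R pd_v F (\<phi> q))
       (fst (pd_v \<phi> q) *\<^sub>R pd_u F (\<phi> q) + snd (pd_v \<phi> q) *\<^sub>R pd_v F (\<phi> q)) q"
      using assms(5) by (intro has_pd_comp f(1) g(1)) auto
  qed (intro Ck_add assms sc fs f g)+
qed

text \<open>The derivative of a reciprocal contains that reciprocal again, so class \<open>k\<close>
  of the reciprocal yields its class \<open>k + 1\<close>.\<close>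

lemma Ck_inverse:
  fixes f :: "real \<times> real \<Rightarrow> real"
  assumes "open D" "Ck_on k D f" "\<And>p. p \<in> D \<Longrightarrow> f p \<noteq> 0" shows "Ck_on k D (\<lambda>p. inverse (f p))"
  using assms(2)
proof (induction k)
  case 0 then show ?case using assms by (auto intro!: continuous_intros)
next
  case (Suc k)
  note f = Ck_SucD[OF assms(1) Suc.prems(1)] and p = Ck_pred[OF Suc.prems(1)]
  have "has_pd (\<lambda>p. inverse (f p)) (- (inverse (f p) * inverse (f p)) * pd_u f p) (- (inverse (f p) * inverse (f
      p)) * pd_v f p) p"
    if "p \<in> D" for p
    by (intro has_pd_real_comp f(1) that) (use assms(3)[OF that] in \<open>auto intro!: derivative_eq_intros\<close>)
  then show ?case
    by (rule Ck_SucI[OF assms(1)])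
       (intro Ck_mult Ck_linear[OF assms(1) bounded_linear_minus] assms Suc.IH f p bounded_linear_ident | simp)+
qed

lemma Ck_exp:
  fixes f :: "real \<times> real \<Rightarrow> real"
  assumes "open D" "Ck_on k D f" shows "Ck_on k D (\<lambda>p. exp (f p))"
  using assms(2)
proof (induction k)
  case 0 then show ?case using assms by (auto intro!: continuous_intros)
next
  case (Suc k)
  note f = Ck_SucD[OF assms(1) Suc.prems(1)] and p = Ck_pred[OF Suc.prems(1)]
  have "has_pd (\<lambda>p. exp (f p)) (exp (f p) * pd_u f p) (exp (f p) * pd_v f p) p" if "p \<in> D" for p
    by (intro has_pd_real_comp f(1) that) (auto intro!: derivative_eq_intros)
  then show ?case
    by (rule Ck_SucI[OF assms(1)]) (assumption | intro Ck_mult assms Suc.IH f p)+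
qed

lemma Ck_sqrt:
  fixes f :: "real \<times> real \<Rightarrow> real"
  assumes "open D" "Ck_on k D f" "\<And>p. p \<in> D \<Longrightarrow> f p > 0" shows "Ck_on k D (\<lambda>p. sqrt (f p))"
  using assms(2)
proof (induction k)
  case 0 then show ?case using assms by (auto intro!: continuous_intros)
next
  case (Suc k)
  note f = Ck_SucD[OF assms(1) Suc.prems(1)] and p = Ck_pred[OF Suc.prems(1)]
  have "has_pd (\<lambda>p. sqrt (f p)) ((inverse (sqrt (f p)) * (1/2)) * pd_u f p) ((inverse (sqrt (f p)) * (1/2)) *
      pd_v f p) p"
    if "p \<in> D" for p
    by (intro has_pd_real_comp f(1) that) (use assms(3)[OF that] in \<open>auto intro!: derivative_eq_intros simp:
        field_simps\<close>)
  moreover have "sqrt (f p) \<noteq> 0" if "p \<in> D" for p using assms(3)[OF that] by simp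
  ultimately show ?case
    by (intro Ck_SucI[OF assms(1)]) (assumption | intro Ck_mult Ck_inverse assms Suc.IH f p Ck_const)+
qed

text \<open>Differentiation removes the logarithm and leaves a reciprocal, already treated, so a
  case distinction on \<open>k\<close> replaces the induction.\<close>

lemma Ck_ln:
  fixes f :: "real \<times> real \<Rightarrow> real"
  assumes "open D" "Ck_on k D f" "\<And>p. p \<in> D \<Longrightarrow> f p > 0" shows "Ck_on k D (\<lambda>p. ln (f p))"
proof (cases k)
  case 0 then show ?thesis using assms by (force intro!: continuous_intros)
next
  case (Suc k)
  note f = Ck_SucD[OF assms(1) assms(2)[unfolded Suc]] and p = Ck_pred[OF assms(2)[unfolded Suc]]
  have "has_pd (\<lambda>p. ln (f p)) (inverse (f p) * pd_u f p) (inverse (f p) * pd_v f p) p"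
    if "p \<in> D" for p
    by (intro has_pd_real_comp f(1) that) (use assms(3)[OF that] in \<open>auto intro!: derivative_eq_intros simp:
        field_simps\<close>)
  moreover have "f p \<noteq> 0" if "p \<in> D" for p using assms(3)[OF that] by simp
  ultimately show ?thesis unfolding Suc
    by (intro Ck_SucI[OF assms(1)]) (assumption | intro Ck_mult Ck_inverse assms f p Ck_const)+
qed

lemma Ck_arctan:
  fixes f :: "real \<times> real \<Rightarrow> real"
  assumes "open D" "Ck_on k D f" shows "Ck_on k D (\<lambda>p. arctan (f p))"
proof (cases k)
  case 0 then show ?thesis using assms by (auto intro!: continuous_intros)
next
  case (Suc k)
  note f = Ck_SucD[OF assms(1) assms(2)[unfolded Suc]] and p = Ck_pred[OF assms(2)[unfolded Suc]]
  have n: "1 + x * x \<noteq> 0" for x :: real by (smt (verit) zero_le_square)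
  have "has_pd (\<lambda>p. arctan (f p)) (inverse (1 + f p * f p) * pd_u f p) (inverse (1 + f p * f p) * pd_v f p) p"
    if "p \<in> D" for p
    by (intro has_pd_real_comp f(1) that) (auto intro!: derivative_eq_intros simp: power2_eq_square)
  then show ?thesis unfolding Suc
    by (rule Ck_SucI[OF assms(1)]) (assumption | intro Ck_mult Ck_inverse Ck_add assms f p Ck_const n)+
qed

subsection \<open>Smooth functions\<close>

lemma smooth_on_cong: "open D \<Longrightarrow> (\<And>p. p \<in> D \<Longrightarrow> f p = g p) \<Longrightarrow> smooth_on D f \<Longrightarrow> smooth_on D g"
  unfolding smooth_on_def by (blast intro: Ck_on_cong)

lemma smooth_on_subset: "smooth_on D f \<Longrightarrow> S \<subseteq> D \<Longrightarrow> smooth_on S f"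
  unfolding smooth_on_def by (blast intro: Ck_subset)

lemma smooth_pd: "smooth_on D f \<Longrightarrow> smooth_on D (pd_u f)" "smooth_on D f \<Longrightarrow> smooth_on D (pd_v f)"
  unfolding smooth_on_def by (metis Ck_on.simps(2))+

lemma smooth_has_pd: "smooth_on D f \<Longrightarrow> open D \<Longrightarrow> p \<in> D \<Longrightarrow> has_pd f (pd_u f p) (pd_v f p) p"
  unfolding smooth_on_def using Ck_SucD(1) by blast

lemma smooth_continuous_on: "smooth_on D f \<Longrightarrow> continuous_on D f"
  unfolding smooth_on_def using Ck_continuous by blast

lemma smooth_const: "smooth_on D (\<lambda>p. c)" unfolding smooth_on_def by (simp add: Ck_const)
lemma smooth_fst: "open D \<Longrightarrow> smooth_on D fst" unfolding smooth_on_def by (simp add: Ck_fst)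
lemma smooth_snd: "open D \<Longrightarrow> smooth_on D snd" unfolding smooth_on_def by (simp add: Ck_snd)
lemma smooth_add: "open D \<Longrightarrow> smooth_on D f \<Longrightarrow> smooth_on D g \<Longrightarrow> smooth_on D (\<lambda>p. f p + g p)"
  unfolding smooth_on_def by (simp add: Ck_add)
lemma smooth_linear: "open D \<Longrightarrow> bounded_linear T \<Longrightarrow> smooth_on D f \<Longrightarrow> smooth_on D (\<lambda>p. T (f p))"
  unfolding smooth_on_def by (simp add: Ck_linear)
lemma smooth_Pair: "open D \<Longrightarrow> smooth_on D f \<Longrightarrow> smooth_on D g \<Longrightarrow> smooth_on D (\<lambda>p. (f p, g p))"
  unfolding smooth_on_def by (simp add: Ck_Pair)
lemma smooth_bilinear: "open D \<Longrightarrow> bounded_bilinear B \<Longrightarrow> smooth_on D f \<Longrightarrow> smooth_on D g \<Longrightarrow> smooth_on D (\<lambda>p. B (f p) (g p))"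
  unfolding smooth_on_def by (simp add: Ck_bilinear)
lemmas smooth_mult = smooth_bilinear[OF _ bounded_bilinear_mult]
lemmas smooth_inner = smooth_bilinear[OF _ bounded_bilinear_inner]
lemmas smooth_scaleR = smooth_bilinear[OF _ bounded_bilinear_scaleR]
lemmas smooth_cross = smooth_bilinear[OF _ bounded_bilinear_cross3]
lemma smooth_minus: "open D \<Longrightarrow> smooth_on D f \<Longrightarrow> smooth_on D (\<lambda>p. - f p)"
  by (rule smooth_linear) (auto intro: bounded_linear_minus bounded_linear_ident)
lemma smooth_diff: "open D \<Longrightarrow> smooth_on D f \<Longrightarrow> smooth_on D g \<Longrightarrow> smooth_on D (\<lambda>p. f p - g p)"
  using smooth_add[OF _ _ smooth_minus] by auto
lemma smooth_comp: "open V \<Longrightarrow> open U \<Longrightarrow> smooth_on V F \<Longrightarrow> smooth_on U \<phi> \<Longrightarrow> \<phi> ` U \<subseteq> V \<Longrightarrow> smooth_on U (F \<circ> \<phi>)"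
  unfolding smooth_on_def by (simp add: Ck_comp)

lemma smooth_inverse:
  "open D \<Longrightarrow> smooth_on D f \<Longrightarrow> (\<And>p. p \<in> D \<Longrightarrow> f p \<noteq> 0) \<Longrightarrow> smooth_on D (\<lambda>p. inverse (f p :: real))"
  unfolding smooth_on_def by (simp add: Ck_inverse)
lemma smooth_divide:
  "open D \<Longrightarrow> smooth_on D f \<Longrightarrow> smooth_on D g \<Longrightarrow> (\<And>p. p \<in> D \<Longrightarrow> g p \<noteq> 0) \<Longrightarrow> smooth_on D (\<lambda>p. f p / g p :: real)"
  unfolding divide_inverse by (intro smooth_mult smooth_inverse)
lemma smooth_exp: "open D \<Longrightarrow> smooth_on D f \<Longrightarrow> smooth_on D (\<lambda>p. exp (f p :: real))"
  unfolding smooth_on_def by (simp add: Ck_exp)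
lemma smooth_sqrt:
  "open D \<Longrightarrow> smooth_on D f \<Longrightarrow> (\<And>p. p \<in> D \<Longrightarrow> f p > 0) \<Longrightarrow> smooth_on D (\<lambda>p. sqrt (f p))"
  unfolding smooth_on_def by (simp add: Ck_sqrt)
lemma smooth_ln:
  "open D \<Longrightarrow> smooth_on D f \<Longrightarrow> (\<And>p. p \<in> D \<Longrightarrow> f p > 0) \<Longrightarrow> smooth_on D (\<lambda>p. ln (f p :: real))"
  unfolding smooth_on_def by (simp add: Ck_ln)
lemma smooth_arctan: "open D \<Longrightarrow> smooth_on D f \<Longrightarrow> smooth_on D (\<lambda>p. arctan (f p))"
  unfolding smooth_on_def by (simp add: Ck_arctan)
lemma smooth_powr:
  fixes f :: "real \<times> real \<Rightarrow> real"
  assumes "open D" "smooth_on D f" "\<And>p. p \<in> D \<Longrightarrow> f p > 0" shows "smooth_on D (\<lambda>p. f p powr c)"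
proof (rule smooth_on_cong[OF assms(1), of "\<lambda>p. exp (c * ln (f p))"])
  show "smooth_on D (\<lambda>p. exp (c * ln (f p)))"
    by (intro smooth_exp smooth_mult smooth_const smooth_ln assms)
qed (use assms(3) in \<open>force simp: powr_def\<close>)

lemma smooth_sgn:
  fixes f :: "real \<times> real \<Rightarrow> 'a::real_inner"
  assumes "open D" "smooth_on D f" "\<And>p. p \<in> D \<Longrightarrow> f p \<noteq> 0" shows "smooth_on D (\<lambda>p. sgn (f p))"
  unfolding sgn_div_norm norm_eq_sqrt_inner
  by (intro smooth_scaleR smooth_inverse smooth_sqrt smooth_inner assms) (use assms(3) in auto)

subsection \<open>Symmetry of the second partial derivatives\<close>

text \<open>The second difference of f over a small square is, by two applications of the mean value theorem,
  a value of either mixed derivative.\<close>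

lemma mixed_difference:
  fixes f :: "real \<times> real \<Rightarrow> real"
  assumes h: "h > 0" and sub: "{u..u+h} \<times> {v..v+h} \<subseteq> D"
    and f: "\<And>p. p \<in> D \<Longrightarrow> has_pd f (fu p) (fv p) p" and fu: "\<And>p. p \<in> D \<Longrightarrow> has_pd fu (fuu p) (fuv p) p"
  shows "\<exists>p \<in> {u..u+h} \<times> {v..v+h}. f (u+h,v+h) - f (u+h,v) - f (u,v+h) + f (u,v) = h * h * fuv p"
proof -
  let ?g = "\<lambda>t. f (t, v+h) - f (t, v)"
  have "(?g has_real_derivative fu (t, v+h) - fu (t, v)) (at t)" if "u \<le> t" "t \<le> u + h" for t
  proof -
    have "(t, v+h) \<in> D" "(t,v) \<in> D" using that h sub by auto
    from has_pd_u[OF f[OF this(1)]] has_pd_u[OF f[OF this(2)]]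
    show ?thesis by (auto simp: has_real_derivative_iff_has_vector_derivative intro!: has_vector_derivative_diff)
  qed
  from MVT2[of u "u+h" ?g "\<lambda>t. fu (t, v+h) - fu (t, v)", OF _ this] h
  obtain s where s: "u < s" "s < u + h" and 1: "?g (u+h) - ?g u = h * (fu (s, v+h) - fu (s, v))" by auto
  have "((\<lambda>t. fu (s, t)) has_real_derivative fuv (s, t)) (at t)" if "v \<le> t" "t \<le> v + h" for t
  proof -
    have "(s, t) \<in> D" using that s h sub by auto
    from has_pd_v[OF fu[OF this]]
    show ?thesis by (auto simp: has_real_derivative_iff_has_vector_derivative)
  qed
  from MVT2[of v "v+h" "\<lambda>t. fu (s,t)" "\<lambda>t. fuv (s, t)", OF _ this] h
  obtain t where t: "v < t" "t < v + h" and 2: "fu (s,v+h) - fu (s,v) = h * fuv (s,t)" by auto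
  show ?thesis using 1 2 s t by (intro bexI[of _ "(s,t)"]) auto
qed

text \<open>The second difference is unchanged when the two variables trade places, so the same
  argument for \<open>f \<circ> prod.swap\<close> exposes the other mixed derivative.\<close>

lemma mixed_difference':
  fixes f :: "real \<times> real \<Rightarrow> real"
  assumes h: "h > 0" and sub: "{u..u+h} \<times> {v..v+h} \<subseteq> D"
    and f: "\<And>p. p \<in> D \<Longrightarrow> has_pd f (fu p) (fv p) p" and fv: "\<And>p. p \<in> D \<Longrightarrow> has_pd fv (fvu p) (fvv p) p"
  shows "\<exists>p \<in> {u..u+h} \<times> {v..v+h}. f (u+h,v+h) - f (u+h,v) - f (u,v+h) + f (u,v) = h * h * fvu p"
proof -
  have "\<exists>p \<in> {v..v+h} \<times> {u..u+h}. (f \<circ> prod.swap) (v+h,u+h) - (f \<circ> prod.swap) (v+h,u)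
      - (f \<circ> prod.swap) (v,u+h) + (f \<circ> prod.swap) (v,u) = h * h * (fvu \<circ> prod.swap) p"
  proof (rule mixed_difference[OF h, of v u "prod.swap -` D" _ "fv \<circ> prod.swap" "fu \<circ> prod.swap" "fvv \<circ> prod.swap"])
    show "{v..v+h} \<times> {u..u+h} \<subseteq> prod.swap -` D" using sub by auto
    fix p assume "p \<in> prod.swap -` D"
    then have "prod.swap p \<in> D" by simp
    from has_pd_swap[OF f[OF this]] has_pd_swap[OF fv[OF this]]
    show "has_pd (f \<circ> prod.swap) ((fv \<circ> prod.swap) p) ((fu \<circ> prod.swap) p) p"
      "has_pd (fv \<circ> prod.swap) ((fvv \<circ> prod.swap) p) ((fvu \<circ> prod.swap) p) p" by simp_all
  qed
  then show ?thesis by (force simp: algebra_simps)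
qed

text \<open>Every small square at \<open>p\<close> contains a point for either mixed derivative such
  that the two values agree, both being the second difference over \<open>h * h\<close>. Continuity
  of both then forbids a gap at \<open>p\<close>.\<close>

lemma pd_commute_real:
  fixes f :: "real \<times> real \<Rightarrow> real"
  assumes D: "open D" and sm: "smooth_on D f" and p: "p \<in> D"
  shows "pd_u (pd_v f) p = pd_v (pd_u f) p"
proof (rule ccontr)
  assume ne: "pd_u (pd_v f) p \<noteq> pd_v (pd_u f) p"
  define e where "e = dist (pd_u (pd_v f) p) (pd_v (pd_u f) p) / 2"
  have e: "e > 0" using ne by (simp add: e_def)
  have cont: "isCont (pd_u (pd_v f)) p" "isCont (pd_v (pd_u f)) p"
    using smooth_has_pd[OF _ D p] sm by (blast intro: has_pd_continuous smooth_pd)+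
  obtain d1 where d1: "d1 > 0" "\<And>q. dist q p < d1 \<Longrightarrow> dist (pd_u (pd_v f) q) (pd_u (pd_v f) p) < e"
    using cont(1) e unfolding continuous_at_eps_delta by blast
  obtain d2 where d2: "d2 > 0" "\<And>q. dist q p < d2 \<Longrightarrow> dist (pd_v (pd_u f) q) (pd_v (pd_u f) p) < e"
    using cont(2) e unfolding continuous_at_eps_delta by blast
  obtain d3 where d3: "d3 > 0" "ball p d3 \<subseteq> D" using D p open_contains_ball by blast
  \<comment> \<open>Points of the square of side \<open>h\<close> are at distance at most
    \<open>2 * h\<close> from \<open>p\<close>; a quarter of the smallest radius keeps this strictly
    below all three.\<close>
  define h where "h = min d1 (min d2 d3) / 4"
  have h: "h > 0" using d1 d2 d3 by (auto simp: h_def)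
  obtain u v where uv: "p = (u,v)" by (cases p)
  have near: "dist q p < min d1 (min d2 d3)" if "q \<in> {u..u+h} \<times> {v..v+h}" for q
  proof -
    have "dist q p \<le> \<bar>fst q - u\<bar> + \<bar>snd q - v\<bar>"
      unfolding uv dist_prod_def dist_real_def using sqrt_sum_squares_le_sum_abs by simp
    also have "\<dots> \<le> 2 * h" using that by (cases q) auto
    also have "\<dots> < min d1 (min d2 d3)" using h unfolding h_def by linarith
    finally show ?thesis .
  qed
  have sub: "{u..u+h} \<times> {v..v+h} \<subseteq> D" using near d3 by (auto simp: subset_iff dist_commute)
  have f: "\<And>p. p \<in> D \<Longrightarrow> has_pd f (pd_u f p) (pd_v f p) p"
    "\<And>p. p \<in> D \<Longrightarrow> has_pd (pd_u f) (pd_u (pd_u f) p) (pd_v (pd_u f) p) p"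
    "\<And>p. p \<in> D \<Longrightarrow> has_pd (pd_v f) (pd_u (pd_v f) p) (pd_v (pd_v f) p) p"
    by (intro smooth_has_pd[OF _ D] smooth_pd sm; assumption)+
  obtain q1 q2 where q: "q1 \<in> {u..u+h} \<times> {v..v+h}" "q2 \<in> {u..u+h} \<times> {v..v+h}"
    "h * h * pd_v (pd_u f) q1 = h * h * pd_u (pd_v f) q2"
    using mixed_difference[OF h sub f(1,2)] mixed_difference'[OF h sub f(1,3)] by metis
  then have eq: "pd_v (pd_u f) q1 = pd_u (pd_v f) q2" using h by auto
  have "dist (pd_u (pd_v f) p) (pd_v (pd_u f) p) < e + e"
    using d1(2)[of q2] d2(2)[of q1] near[OF q(1)] near[OF q(2)] eq
    by (smt (verit) dist_commute dist_triangle)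
  then show False by (simp add: e_def)
qed

text \<open>Testing against an arbitrary fixed vector \<open>w\<close> reduces the claim to
  real-valued functions.\<close>

lemma pd_commute:
  fixes f :: "real \<times> real \<Rightarrow> 'a::real_inner"
  assumes D: "open D" and sm: "smooth_on D f" and p: "p \<in> D"
  shows "pd_u (pd_v f) p = pd_v (pd_u f) p"
proof -
  have "pd_u (pd_v f) p \<bullet> w = pd_v (pd_u f) p \<bullet> w" for w
  proof -
    let ?g = "\<lambda>p. f p \<bullet> w"
    have lin: "has_pd (\<lambda>q. X q \<bullet> w) (pd_u X q \<bullet> w) (pd_v X q \<bullet> w) q" if "smooth_on D X" "q \<in> D" for X :: "real \<times>
        real \<Rightarrow> 'a" and q
      by (rule has_pd_linear[OF bounded_linear_inner_left smooth_has_pd[OF that(1) D that(2)]])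
    have sg: "smooth_on D ?g" by (intro smooth_linear[OF D bounded_linear_inner_left] sm)
    have 1: "pd_u ?g q = pd_u f q \<bullet> w" "pd_v ?g q = pd_v f q \<bullet> w" if "q \<in> D" for q
      using has_pd_imp[OF lin[OF sm that]] by auto
    have "pd_u (pd_v ?g) p = pd_u (pd_v f) p \<bullet> w"
      by (rule has_pd_imp(1)[OF has_pd_cong[OF lin[OF smooth_pd(2)[OF sm] p] D p]]) (simp add: 1)
    moreover have "pd_v (pd_u ?g) p = pd_v (pd_u f) p \<bullet> w"
      by (rule has_pd_imp(2)[OF has_pd_cong[OF lin[OF smooth_pd(1)[OF sm] p] D p]]) (simp add: 1)
    ultimately show ?thesis using pd_commute_real[OF D sg p] by simp
  qed
  then show ?thesis by (metis vector_eq_rdot)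
qed

section \<open>Surfaces in principal parameters\<close>

text \<open>Constraints such as F = 0, M = 0, the unit length of the normal or a Codazzi equation
  are identities on all of \<open>D\<close>; differentiating them with this lemma yields relations
  one order higher.\<close>

lemma has_pd_eq_const:
  assumes "open D" "p \<in> D" "\<And>q. q \<in> D \<Longrightarrow> f q = c" "has_pd f a b p" shows "a = 0" "b = 0"
  using has_pd_imp[OF has_pd_cong[OF has_pd_const[of c] assms(1,2)], of f] has_pd_imp[OF assms(4)] assms(3) by
      simp_all

text \<open>Here \<open>d\<close> is \<nu>1 - \<nu>2, while \<open>x\<close>, \<open>r\<close>,
  \<open>X\<close> are the v-, u- and vv-derivatives of \<nu>1 and \<open>s\<close>,
  \<open>y\<close>, \<open>Y\<close> the v-, u- and uu-derivatives of \<nu>2, all divided by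
  \<open>d\<close>. The assumption is the Gauss equation with the derivatives of E and G eliminated;
  in it all terms with \<open>r\<close> and \<open>s\<close> cancel.\<close>

lemma natural_gauss_algebra:
  fixes E G d :: real
  assumes g: "n1 * E * (n2 * G) = - ((- (- 2 * E * (x * d) / d) * (x * d - s * d) - 2 * (E * (X * d) + - 2 * E *
      (x * d) / d * (x * d))) / d
      + (- (2 * G * (y * d) / d) * (r * d - y * d) + 2 * (G * (Y * d) + 2 * G * (y * d) / d * (y * d))) / d) / 2
    + (- 2 * E * (r * d) / d * (2 * G * (y * d) / d) + (- 2 * E * (x * d) / d)\<^sup>2) / (4 * E)
    + (- 2 * E * (x * d) / d * (2 * G * (s * d) / d) + (2 * G * (y * d) / d)\<^sup>2) / (4 * G)"
   and pos: "E > 0" "G > 0" "d > 0"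
  shows "(X * d - 2 * (x * d)\<^sup>2 / d) / G - (Y * d + 2 * (y * d)\<^sup>2 / d) / E = n1 * n2 * d"
proof -
  have "n1 * E * (n2 * G) = E * (X - 2 * x * x) - G * (Y + 2 * y * y)"
    using pos unfolding g by (simp add: field_simps power2_eq_square)
  then have "n1 * n2 = (E * (X - 2 * x * x) - G * (Y + 2 * y * y)) / (E * G)"
    using pos by (simp add: field_simps)
  then show ?thesis using pos by (simp only:) (simp add: field_simps power2_eq_square)
qed

section \<open>The moving frame, Codazzi and Gauss equations\<close>

locale principal =
  fixes z :: surf and D
  assumes S: "principal_surface z D"
begin

lemma D: "open D" "connected D" and sm: "smooth_on D z"
  using S by (auto simp: principal_surface_def)

lemmas has_pdI = smooth_has_pd[OF _ D(1)]

lemma cross_nz: "p \<in> D \<Longrightarrow> cross3 (pd_u z p) (pd_v z p) \<noteq> 0"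
  and F0: "p \<in> D \<Longrightarrow> pd_u z p \<bullet> pd_v z p = 0" and M0: "p \<in> D \<Longrightarrow> pd_v (pd_u z) p \<bullet> normal z p = 0"
  and nu_less: "p \<in> D \<Longrightarrow> nu2 z p < nu1 z p"
  using S by (auto simp: principal_surface_def coeffF_def coeffM_def)

lemma E_pos: assumes "p \<in> D" shows "coeffE z p > 0"
  using cross_nz[OF assms] by (auto simp: coeffE_def)

lemma G_pos: assumes "p \<in> D" shows "coeffG z p > 0"
  using cross_nz[OF assms] by (auto simp: coeffG_def)

lemma normal_orth [simp]: "normal z p \<bullet> pd_u z p = 0" "normal z p \<bullet> pd_v z p = 0"
   "pd_u z p \<bullet> normal z p = 0" "pd_v z p \<bullet> normal z p = 0"
  by (auto simp: normal_def sgn_div_norm dot_cross_self)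

lemma normal_unit: "p \<in> D \<Longrightarrow> normal z p \<bullet> normal z p = 1"
  using cross_nz[of p] by (simp add: normal_def norm_sgn power2_norm_eq_inner[symmetric])

text \<open>A vector orthogonal to both tangents is parallel to their cross product, by the
  expansion of the triple product; being orthogonal to it as well, it vanishes. Vector identities
  are checked componentwise this way.\<close>

lemma frame_zero:
  assumes "p \<in> D" "w \<bullet> pd_u z p = 0" "w \<bullet> pd_v z p = 0" "w \<bullet> normal z p = 0" shows "w = 0"
proof -
  let ?c = "cross3 (pd_u z p) (pd_v z p)"
  have "w \<bullet> ?c = 0" using assms(4) cross_nz[OF assms(1)] by (simp add: normal_def sgn_div_norm)
  moreover have "cross3 w ?c = 0" using assms(2,3) by (simp add: Lagrange)
  ultimately show ?thesis using norm_and_cross_eq_0[of w ?c] cross_nz[OF assms(1)] by simp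
qed

lemma normal_smooth: "smooth_on D (normal z)"
  unfolding normal_def[abs_def] by (intro smooth_sgn smooth_cross smooth_pd D sm cross_nz)

lemma coeffs_smooth: "smooth_on D (coeffE z)" "smooth_on D (coeffG z)" "smooth_on D (nu1 z)" "smooth_on D (nu2 z)"
proof -
  show E: "smooth_on D (coeffE z)" unfolding coeffE_def[abs_def] by (intro smooth_inner smooth_pd D sm)
  show G: "smooth_on D (coeffG z)" unfolding coeffG_def[abs_def] by (intro smooth_inner smooth_pd D sm)
  show "smooth_on D (nu1 z)" unfolding nu1_def[abs_def] coeffL_def
    by (intro smooth_divide smooth_inner smooth_pd D sm normal_smooth E) (use E_pos in force)
  show "smooth_on D (nu2 z)" unfolding nu2_def[abs_def] coeffN_def
    by (intro smooth_divide smooth_inner smooth_pd D sm normal_smooth G) (use G_pos in force)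
qed

lemma L_eq: "p \<in> D \<Longrightarrow> pd_u (pd_u z) p \<bullet> normal z p = nu1 z p * coeffE z p"
  using E_pos[of p] by (simp add: nu1_def coeffL_def)

lemma N_eq: "p \<in> D \<Longrightarrow> pd_v (pd_v z) p \<bullet> normal z p = nu2 z p * coeffG z p"
  using G_pos[of p] by (simp add: nu2_def coeffN_def)

lemma has_pd_zu: "p \<in> D \<Longrightarrow> has_pd (pd_u z) (pd_u (pd_u z) p) (pd_v (pd_u z) p) p"
  by (intro has_pdI smooth_pd sm)

text \<open>Normal form for mixed derivatives: differentiation in u is written innermost, here and
  in the third derivatives below, so that equal vectors are also syntactically equal.\<close>

lemma has_pd_zv: "p \<in> D \<Longrightarrow> has_pd (pd_v z) (pd_v (pd_u z) p) (pd_v (pd_v z) p) p"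
  using smooth_has_pd[OF smooth_pd(2)[OF sm] D(1)] pd_commute[OF D(1) sm] by metis

lemma has_pd_zuu: "p \<in> D \<Longrightarrow> has_pd (pd_u (pd_u z)) (pd_u (pd_u (pd_u z)) p) (pd_v (pd_u (pd_u z)) p) p"
  by (intro has_pdI smooth_pd sm)

lemma has_pd_zuv: "p \<in> D \<Longrightarrow> has_pd (pd_v (pd_u z)) (pd_v (pd_u (pd_u z)) p) (pd_v (pd_v (pd_u z)) p) p"
  using smooth_has_pd[OF smooth_pd(2)[OF smooth_pd(1)[OF sm]] D(1)] pd_commute[OF D(1) smooth_pd(1)[OF sm]] by metis

lemma has_pd_zvv: "p \<in> D \<Longrightarrow> has_pd (pd_v (pd_v z)) (pd_v (pd_v (pd_u z)) p) (pd_v (pd_v (pd_v z)) p) p"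
proof -
  assume p: "p \<in> D"
  have "pd_u (pd_v (pd_v z)) p = pd_v (pd_u (pd_v z)) p" by (intro pd_commute[OF D(1)] smooth_pd sm p)
  also have "\<dots> = pd_v (pd_v (pd_u z)) p"
    by (rule has_pd_imp(2)[OF has_pd_cong[OF has_pd_zuv[OF p] D(1) p]]) (simp add: pd_commute[OF D(1) sm])
  finally show ?thesis using smooth_has_pd[OF smooth_pd(2)[OF smooth_pd(2)[OF sm]] D(1) p] by simp
qed

lemma dE: assumes "p \<in> D" shows
  "has_pd (coeffE z) (2 * (pd_u (pd_u z) p \<bullet> pd_u z p)) (2 * (pd_v (pd_u z) p \<bullet> pd_u z p)) p"
  unfolding coeffE_def[abs_def] using has_pd_inner[OF has_pd_zu has_pd_zu, OF assms assms] by (simp add: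
      inner_commute)

lemma dG: assumes "p \<in> D" shows
  "has_pd (coeffG z) (2 * (pd_v (pd_u z) p \<bullet> pd_v z p)) (2 * (pd_v (pd_v z) p \<bullet> pd_v z p)) p"
  unfolding coeffG_def[abs_def] using has_pd_inner[OF has_pd_zv has_pd_zv, OF assms assms] by (simp add:
      inner_commute)

text \<open>These are the two derivatives of the constraint F = 0; they reduce the tangential
  products of second derivatives to those occurring in the derivatives of E and G.\<close>

lemma dF: assumes "p \<in> D"
  shows "pd_u (pd_u z) p \<bullet> pd_v z p = - (pd_v (pd_u z) p \<bullet> pd_u z p)"
    "pd_v (pd_v z) p \<bullet> pd_u z p = - (pd_v (pd_u z) p \<bullet> pd_v z p)"
  using has_pd_eq_const[OF D(1) assms _ has_pd_inner[OF has_pd_zu has_pd_zv, OF assms assms], of 0] F0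
  by (auto simp: inner_commute)

text \<open>Rodrigues' formulas. Differentiating the orthogonality of the normal to both tangents
  and its unit length determines every component of its derivatives, and F = M = 0 leaves only the
  diagonal ones.\<close>

lemma has_pd_normal: assumes p: "p \<in> D"
  shows "has_pd (normal z) (- nu1 z p *\<^sub>R pd_u z p) (- nu2 z p *\<^sub>R pd_v z p) p"
proof -
  note l = smooth_has_pd[OF normal_smooth D(1) p]
  have 1: "normal z p \<bullet> pd_u (pd_u z) p + pd_u (normal z) p \<bullet> pd_u z p = 0"
    "normal z p \<bullet> pd_v (pd_u z) p + pd_v (normal z) p \<bullet> pd_u z p = 0"
    using has_pd_eq_const[OF D(1) p _ has_pd_inner[OF l has_pd_zu[OF p]], of 0] by auto
  have 2: "normal z p \<bullet> pd_v (pd_u z) p + pd_u (normal z) p \<bullet> pd_v z p = 0"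
    "normal z p \<bullet> pd_v (pd_v z) p + pd_v (normal z) p \<bullet> pd_v z p = 0"
    using has_pd_eq_const[OF D(1) p _ has_pd_inner[OF l has_pd_zv[OF p]], of 0] by auto
  have 3: "normal z p \<bullet> pd_u (normal z) p + pd_u (normal z) p \<bullet> normal z p = 0"
    "normal z p \<bullet> pd_v (normal z) p + pd_v (normal z) p \<bullet> normal z p = 0"
    using has_pd_eq_const[OF D(1) p _ has_pd_inner[OF l l], of 1] normal_unit by auto
  note L = L_eq[OF p] N_eq[OF p] M0[OF p] F0[OF p]
  have "pd_u (normal z) p + nu1 z p *\<^sub>R pd_u z p = 0"
    by (rule frame_zero[OF p]) (use 1 2 3 L in \<open>simp_all add: inner_add_left inner_add_right inner_commute
        coeffE_def\<close>)
  moreover have "pd_v (normal z) p + nu2 z p *\<^sub>R pd_v z p = 0"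
    by (rule frame_zero[OF p]) (use 1 2 3 L in \<open>simp_all add: inner_add_left inner_add_right inner_commute
        coeffG_def\<close>)
  ultimately show ?thesis using l by (simp add: add_eq_0_iff2)
qed

lemma has_pd_nu: "p \<in> D \<Longrightarrow> has_pd (nu1 z) (pd_u (nu1 z) p) (pd_v (nu1 z) p) p"
   "p \<in> D \<Longrightarrow> has_pd (nu2 z) (pd_u (nu2 z) p) (pd_v (nu2 z) p) p"
  by (simp_all add: has_pdI coeffs_smooth)

lemma has_pd_E: "p \<in> D \<Longrightarrow> has_pd (coeffE z) (pd_u (coeffE z) p) (pd_v (coeffE z) p) p"
  and has_pd_G: "p \<in> D \<Longrightarrow> has_pd (coeffG z) (pd_u (coeffG z) p) (pd_v (coeffG z) p) p"
  by (simp_all add: has_pdI coeffs_smooth)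

text \<open>Differentiating M = 0 gives the normal components of z_uuv and z_uvv. Inserted into the
  v-derivative of z_uu . n = \<nu>1 E and the u-derivative of z_vv . n = \<nu>2 G, they yield the
  two equations.\<close>

lemma codazzi: assumes p: "p \<in> D"
  shows "pd_v (coeffE z) p * (nu1 z p - nu2 z p) = - 2 * coeffE z p * pd_v (nu1 z) p"
    and "pd_u (coeffG z) p * (nu1 z p - nu2 z p) = 2 * coeffG z p * pd_u (nu2 z) p"
proof -
  note E = has_pd_imp[OF dE[OF p]] and G = has_pd_imp[OF dG[OF p]]
  note l = has_pd_normal[OF p]
  have M: "pd_v (pd_u (pd_u z)) p \<bullet> normal z p = nu1 z p * (pd_v (pd_u z) p \<bullet> pd_u z p)"
     "pd_v (pd_v (pd_u z)) p \<bullet> normal z p = nu2 z p * (pd_v (pd_u z) p \<bullet> pd_v z p)"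
    using has_pd_eq_const[OF D(1) p _ has_pd_inner[OF has_pd_zuv[OF p] l], of 0] M0 by auto
  note X = has_pd_diff[OF has_pd_inner[OF has_pd_zuu[OF p] l] has_pd_mult[OF has_pd_nu(1)[OF p] dE[OF p]]]
  from has_pd_eq_const(2)[OF D(1) p _ X, of 0] L_eq M dF[OF p]
  show "pd_v (coeffE z) p * (nu1 z p - nu2 z p) = - 2 * coeffE z p * pd_v (nu1 z) p"
    unfolding E by (simp add: algebra_simps)
  note X = has_pd_diff[OF has_pd_inner[OF has_pd_zvv[OF p] l] has_pd_mult[OF has_pd_nu(2)[OF p] dG[OF p]]]
  from has_pd_eq_const(1)[OF D(1) p _ X, of 0] N_eq M dF[OF p]
  show "pd_u (coeffG z) p * (nu1 z p - nu2 z p) = 2 * coeffG z p * pd_u (nu2 z) p"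
    unfolding G by (simp add: algebra_simps)
qed

text \<open>The quantity z_uu . z_vv - z_uv . z_uv is computed twice: from the second derivatives of
  E and G, and by expanding the second derivatives of z in the orthogonal frame z_u, z_v, n, where
  z_uv has no normal component.\<close>

lemma gauss: assumes p: "p \<in> D"
  shows "nu1 z p * coeffE z p * (nu2 z p * coeffG z p) =
    - (pd_v (pd_v (coeffE z)) p + pd_u (pd_u (coeffG z)) p) / 2
    + (pd_u (coeffE z) p * pd_u (coeffG z) p + (pd_v (coeffE z) p)\<^sup>2) / (4 * coeffE z p)
    + (pd_v (coeffE z) p * pd_v (coeffG z) p + (pd_u (coeffG z) p)\<^sup>2) / (4 * coeffG z p)"
proof -
  note E = has_pd_imp[OF dE[OF p]] and G = has_pd_imp[OF dG[OF p]]
  let ?uu = "pd_u (pd_u z) p" and ?uv = "pd_v (pd_u z) p" and ?vv = "pd_v (pd_v z) p" and ?u = "pd_u z p" and ?v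
      = "pd_v z p"
  let ?uuv = "pd_v (pd_u (pd_u z)) p" and ?uvv = "pd_v (pd_v (pd_u z)) p" and ?l = "normal z p"
  have "pd_v (pd_v (coeffE z)) p = 2 * (?uvv \<bullet> ?u + ?uv \<bullet> ?uv)"
    by (rule has_pd_imp(2)[OF has_pd_cong[OF has_pd_mult[OF has_pd_const[of 2] has_pd_inner[OF has_pd_zuv[OF p]
        has_pd_zu[OF p]]] D(1) p, THEN has_pd_eq[OF _ refl]]])
       (simp_all add: has_pd_imp(2)[OF dE])
  moreover have "pd_u (pd_u (coeffG z)) p = 2 * (?uuv \<bullet> ?v + ?uv \<bullet> ?uv)"
    by (rule has_pd_imp(1)[OF has_pd_cong[OF has_pd_mult[OF has_pd_const[of 2] has_pd_inner[OF has_pd_zuv[OF p]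
        has_pd_zv[OF p]]] D(1) p, THEN has_pd_eq[OF _ _ refl]]])
       (simp_all add: has_pd_imp(1)[OF dG])
  \<comment> \<open>The third derivatives in E_vv + G_uu are eliminated by differentiating the
    already derived identity z_uu . z_v + z_uv . z_u = 0 in v.\<close>
  moreover note X = has_pd_add[OF has_pd_inner[OF has_pd_zuu[OF p] has_pd_zv[OF p]] has_pd_inner[OF
      has_pd_zuv[OF p] has_pd_zu[OF p]]]
  from has_pd_eq_const(2)[OF D(1) p _ X, of 0] dF
  have "?uuv \<bullet> ?v + ?uu \<bullet> ?vv + ?uv \<bullet> ?uv + ?uvv \<bullet> ?u = 0" by (simp add: algebra_simps)
  ultimately have 1: "- (pd_v (pd_v (coeffE z)) p + pd_u (pd_u (coeffG z)) p) / 2 = ?uu \<bullet> ?vv - ?uv \<bullet> ?uv" by simp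
  note pos = E_pos[OF p] G_pos[OF p]
  have expand: "w = ((w \<bullet> ?u) / coeffE z p) *\<^sub>R ?u + ((w \<bullet> ?v) / coeffG z p) *\<^sub>R ?v + (w \<bullet> ?l) *\<^sub>R ?l" (is "w =
      ?r") for w
  proof -
    have "w - ?r = 0" by (rule frame_zero[OF p]) (use pos in \<open>simp_all add: inner_diff_left inner_add_left
        normal_unit p F0[OF p] inner_commute[of ?v ?u] coeffE_def coeffG_def\<close>)
    then show ?thesis by simp
  qed
  have "?uu \<bullet> ?vv = (?uu \<bullet> ?u) * (?vv \<bullet> ?u) / coeffE z p + (?uu \<bullet> ?v) * (?vv \<bullet> ?v) / coeffG z p + (?uu \<bullet> ?l) *
      (?vv \<bullet> ?l)"
    by (subst expand[of ?uu]) (simp add: inner_add_left inner_add_right inner_commute)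
  moreover have "?uv \<bullet> ?uv = (?uv \<bullet> ?u) * (?uv \<bullet> ?u) / coeffE z p + (?uv \<bullet> ?v) * (?uv \<bullet> ?v) / coeffG z p"
    by (subst expand[of ?uv]) (simp add: inner_add_left inner_add_right inner_commute M0[OF p, simplified
        inner_commute])
  ultimately show ?thesis unfolding 1 unfolding E G L_eq[OF p] N_eq[OF p] dF[OF p] using pos
    by (simp add: field_simps power2_eq_square)
qed

text \<open>With respect to natural principal parameters the Codazzi equations are supplemented by
  the analogous formulas for the other two first derivatives of E and G; then the Gauss equation
  takes the form of the natural PDE.\<close>

lemma natural_gauss: assumes p: "p \<in> D"
  and Eu: "pd_u (coeffE z) p * (nu1 z p - nu2 z p) = - 2 * coeffE z p * pd_u (nu1 z) p"
  and Gv: "pd_v (coeffG z) p * (nu1 z p - nu2 z p) = 2 * coeffG z p * pd_v (nu2 z) p"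
  shows "(pd_v (pd_v (nu1 z)) p - 2 * (pd_v (nu1 z) p)\<^sup>2 / (nu1 z p - nu2 z p)) / coeffG z p
    - (pd_u (pd_u (nu2 z)) p + 2 * (pd_u (nu2 z) p)\<^sup>2 / (nu1 z p - nu2 z p)) / coeffE z p
    = nu1 z p * nu2 z p * (nu1 z p - nu2 z p)"
proof -
  note pos = E_pos[OF p] G_pos[OF p]
  let ?d = "\<lambda>q. nu1 z q - nu2 z q"
  have d: "?d p > 0" using nu_less[OF p] by simp
  have Ev: "pd_v (coeffE z) p = - 2 * coeffE z p * pd_v (nu1 z) p / ?d p"
    using codazzi(1)[OF p] d by (simp add: field_simps)
  have Gu: "pd_u (coeffG z) p = 2 * coeffG z p * pd_u (nu2 z) p / ?d p"
    using codazzi(2)[OF p] d by (simp add: field_simps)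
  have Eu': "pd_u (coeffE z) p = - 2 * coeffE z p * pd_u (nu1 z) p / ?d p"
    using Eu d by (simp add: field_simps)
  have Gv': "pd_v (coeffG z) p = 2 * coeffG z p * pd_v (nu2 z) p / ?d p"
    using Gv d by (simp add: field_simps)
  note h = has_pd_E[OF p] has_pd_G[OF p] has_pd_nu[OF p]
  have h2: "has_pd (pd_v (coeffE z)) (pd_u (pd_v (coeffE z)) p) (pd_v (pd_v (coeffE z)) p) p"
    "has_pd (pd_v (nu1 z)) (pd_u (pd_v (nu1 z)) p) (pd_v (pd_v (nu1 z)) p) p"
    "has_pd (pd_u (coeffG z)) (pd_u (pd_u (coeffG z)) p) (pd_v (pd_u (coeffG z)) p) p"
    "has_pd (pd_u (nu2 z)) (pd_u (pd_u (nu2 z)) p) (pd_v (pd_u (nu2 z)) p) p"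
    by (simp_all add: has_pdI smooth_pd coeffs_smooth p)
  \<comment> \<open>The Codazzi equation is differentiated in its product form, which gives the
    second derivative of E without differentiating a quotient.\<close>
  note X = has_pd_add[OF has_pd_mult[OF h2(1) has_pd_diff[OF h(3,4)]] has_pd_mult[OF has_pd_const[of 2]
      has_pd_mult[OF h(1) h2(2)]]]
  from has_pd_eq_const(2)[OF D(1) p _ X, of 0] codazzi
  have "pd_v (pd_v (coeffE z)) p * ?d p + pd_v (coeffE z) p * (pd_v (nu1 z) p - pd_v (nu2 z) p)
    + 2 * (coeffE z p * pd_v (pd_v (nu1 z)) p + pd_v (coeffE z) p * pd_v (nu1 z) p) = 0" by simp
  then have Evv: "pd_v (pd_v (coeffE z)) p = (- pd_v (coeffE z) p * (pd_v (nu1 z) p - pd_v (nu2 z) p)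
    - 2 * (coeffE z p * pd_v (pd_v (nu1 z)) p + pd_v (coeffE z) p * pd_v (nu1 z) p)) / ?d p"
    using d by (simp add: field_simps)
  note X = has_pd_diff[OF has_pd_mult[OF h2(3) has_pd_diff[OF h(3,4)]] has_pd_mult[OF has_pd_const[of 2]
      has_pd_mult[OF h(2) h2(4)]]]
  from has_pd_eq_const(1)[OF D(1) p _ X, of 0] codazzi
  have "pd_u (pd_u (coeffG z)) p * ?d p + pd_u (coeffG z) p * (pd_u (nu1 z) p - pd_u (nu2 z) p)
    - 2 * (coeffG z p * pd_u (pd_u (nu2 z)) p + pd_u (coeffG z) p * pd_u (nu2 z) p) = 0" by simp
  then have Guu: "pd_u (pd_u (coeffG z)) p = (- pd_u (coeffG z) p * (pd_u (nu1 z) p - pd_u (nu2 z) p)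
    + 2 * (coeffG z p * pd_u (pd_u (nu2 z)) p + pd_u (coeffG z) p * pd_u (nu2 z) p)) / ?d p"
    using d by (simp add: field_simps)
  define x r X where "x = pd_v (nu1 z) p / ?d p" and "r = pd_u (nu1 z) p / ?d p" and "X = pd_v (pd_v (nu1 z)) p
      / ?d p"
  define s y Y where "s = pd_v (nu2 z) p / ?d p" and "y = pd_u (nu2 z) p / ?d p" and "Y = pd_u (pd_u (nu2 z)) p
      / ?d p"
  have sub: "pd_v (nu1 z) p = x * ?d p" "pd_u (nu1 z) p = r * ?d p" "pd_v (pd_v (nu1 z)) p = X * ?d p"
    "pd_v (nu2 z) p = s * ?d p" "pd_u (nu2 z) p = y * ?d p" "pd_u (pd_u (nu2 z)) p = Y * ?d p"
    using d by (auto simp: x_def r_def X_def s_def y_def Y_def)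
  show ?thesis using gauss[OF p] pos d unfolding Evv Guu unfolding Ev Gu Eu' Gv' unfolding sub
    by (rule natural_gauss_algebra)
qed

end

section \<open>Transformations of surfaces\<close>

text \<open>The alternatives for \<open>gam1\<close> and \<open>gam2\<close> in
  \<open>oriented_surface\<close>, translated by the Codazzi equations into derivatives of the
  principal curvatures, which follow the chain rule under all transformations used here.\<close>

definition codazzi_type :: "surf \<Rightarrow> (real \<times> real) set \<Rightarrow> bool" where
  "codazzi_type z D \<longleftrightarrow>
    (\<forall>p\<in>D. pd_v (nu1 z) p \<noteq> 0 \<and> pd_u (nu2 z) p \<noteq> 0) \<or> (\<forall>p\<in>D. pd_v (nu1 z) p = 0 \<and> pd_u (nu2 z) p \<noteq> 0) \<or>
    (\<forall>p\<in>D. pd_v (nu1 z) p \<noteq> 0 \<and> pd_u (nu2 z) p = 0)"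

context principal
begin

lemma gam1_iff: assumes p: "p \<in> D" shows "gam1 z p = 0 \<longleftrightarrow> pd_v (nu1 z) p = 0"
proof -
  have "gam1 z p = 0 \<longleftrightarrow> pd_v (coeffE z) p = 0"
    using E_pos[OF p] G_pos[OF p] by (simp add: gam1_def)
  also have "\<dots> \<longleftrightarrow> pd_v (coeffE z) p * (nu1 z p - nu2 z p) = 0" using nu_less[OF p] by simp
  finally show ?thesis using codazzi(1)[OF p] E_pos[OF p] by simp
qed

lemma gam2_iff: assumes p: "p \<in> D" shows "gam2 z p = 0 \<longleftrightarrow> pd_u (nu2 z) p = 0"
proof -
  have "gam2 z p = 0 \<longleftrightarrow> pd_u (coeffG z) p = 0"
    using E_pos[OF p] G_pos[OF p] by (simp add: gam2_def)
  also have "\<dots> \<longleftrightarrow> pd_u (coeffG z) p * (nu1 z p - nu2 z p) = 0" using nu_less[OF p] by simp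
  finally show ?thesis using codazzi(2)[OF p] G_pos[OF p] by simp
qed

end

lemma oriented_surface_iff: "oriented_surface z D \<longleftrightarrow> principal_surface z D \<and> codazzi_type z D"
proof (cases "principal_surface z D")
  case True
  then interpret principal by unfold_locales
  show ?thesis using True by (simp add: oriented_surface_def surface_def codazzi_type_def gam1_iff gam2_iff)
qed (auto simp: oriented_surface_def surface_def)

text \<open>Both alternatives in \<open>surface\<close> make \<open>gam2\<close> nonzero. This later
  prevents \<nu>2 from staying at a forbidden value along a u-line.\<close>

lemma surface_nu2: assumes "surface z D" "p \<in> D" shows "pd_u (nu2 z) p \<noteq> 0"
proof -
  interpret principal using assms(1) by unfold_locales (simp add: surface_def)
  show ?thesis using assms by (auto simp: surface_def gam2_iff)
qed

lemma codazzi_type_transfer: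
  assumes "codazzi_type z D" "\<And>p. p \<in> U \<Longrightarrow> \<psi> p \<in> D"
    "\<And>p. p \<in> U \<Longrightarrow> pd_v (nu1 y) p = 0 \<longleftrightarrow> pd_v (nu1 z) (\<psi> p) = 0"
    "\<And>p. p \<in> U \<Longrightarrow> pd_u (nu2 y) p = 0 \<longleftrightarrow> pd_u (nu2 z) (\<psi> p) = 0"
  shows "codazzi_type y U"
  using assms unfolding codazzi_type_def by metis

subsection \<open>Reversal of the normal\<close>

text \<open>Exchanging the parameters reverses the cross product and hence the normal. The
  curvatures change sign and trade places, so that the larger one again comes first.\<close>

lemma swap_surf:
  "normal (z \<circ> prod.swap) p = - normal z (prod.swap p)"
  "nu1 (z \<circ> prod.swap) p = - nu2 z (prod.swap p)" "nu2 (z \<circ> prod.swap) p = - nu1 z (prod.swap p)"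
proof -
  show 1: "normal (z \<circ> prod.swap) p = - normal z (prod.swap p)" for p
    unfolding normal_def swap_geometry by (subst cross_skew) (simp add: sgn_minus)
  show "nu1 (z \<circ> prod.swap) p = - nu2 z (prod.swap p)" "nu2 (z \<circ> prod.swap) p = - nu1 z (prod.swap p)"
    by (simp_all add: nu1_def nu2_def coeffL_def coeffN_def coeffE_def coeffG_def swap_geometry 1)
qed

lemma parallel_swap: "parallel a z \<circ> prod.swap = parallel (- a) (z \<circ> prod.swap)"
  by (simp add: parallel_def swap_surf fun_eq_iff)

lemma smooth_swap: "open D \<Longrightarrow> smooth_on D prod.swap"
  unfolding prod.swap_def[abs_def] by (intro smooth_Pair smooth_fst smooth_snd)

lemma open_swap: "open D \<Longrightarrow> open (prod.swap -` D)"
  by (intro open_vimage continuous_intros)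

lemma connected_swap: assumes "connected D" shows "connected (prod.swap -` D)"
proof -
  have "prod.swap -` D = prod.swap ` D" by force
  then show ?thesis using assms by (auto intro!: connected_continuous_image continuous_intros)
qed

lemma swap_oriented:
  assumes "oriented_surface z D" shows "oriented_surface (z \<circ> prod.swap) (prod.swap -` D)"
proof -
  have z: "principal_surface z D" "codazzi_type z D" using assms by (auto simp: oriented_surface_iff)
  interpret principal using z by unfold_locales
  have "principal_surface (z \<circ> prod.swap) (prod.swap -` D)"
    unfolding principal_surface_def
  proof (intro conjI ballI)
    show "open (prod.swap -` D)" "connected (prod.swap -` D)" using D by (auto intro: open_swap connected_swap)
    then show "smooth_on (prod.swap -` D) (z \<circ> prod.swap)"
      by (intro smooth_comp[OF D(1)] smooth_swap sm) auto
    fix p assume "p \<in> prod.swap -` D"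
    then have p: "prod.swap p \<in> D" by simp
    show "cross3 (pd_u (z \<circ> prod.swap) p) (pd_v (z \<circ> prod.swap) p) \<noteq> 0"
      using cross_nz[OF p] unfolding swap_geometry by (subst cross_skew) simp
    show "coeffF (z \<circ> prod.swap) p = 0" using F0[OF p] by (simp add: coeffF_def swap_geometry inner_commute)
    show "coeffM (z \<circ> prod.swap) p = 0" using M0[OF p] by (simp add: coeffM_def swap_geometry swap_surf
        pd_commute[OF D(1) sm p])
    show "nu1 (z \<circ> prod.swap) p > nu2 (z \<circ> prod.swap) p" using nu_less[OF p] by (simp add: swap_surf)
  qed
  moreover have nu: "nu1 (z \<circ> prod.swap) = (\<lambda>p. - (nu2 z \<circ> prod.swap) p)" "nu2 (z \<circ> prod.swap) = (\<lambda>p. - (nu1 z \<circ>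
      prod.swap) p)"
    by (simp_all add: swap_surf fun_eq_iff)
  have "codazzi_type (z \<circ> prod.swap) (prod.swap -` D)"
  proof -
    have "pd_v (nu1 (z \<circ> prod.swap)) p = - pd_u (nu2 z) (prod.swap p)"
      "pd_u (nu2 (z \<circ> prod.swap)) p = - pd_v (nu1 z) (prod.swap p)" if "p \<in> prod.swap -` D" for p
      unfolding nu using that
      by (intro has_pd_imp[OF has_pd_minus[OF has_pd_swap[OF has_pd_nu(1)]]] has_pd_imp[OF has_pd_minus[OF
          has_pd_swap[OF has_pd_nu(2)]]]; simp)+
    then show ?thesis using z(2) unfolding codazzi_type_def by force
  qed
  ultimately show ?thesis by (simp add: oriented_surface_iff)
qed

subsection \<open>Parallel surfaces and changes of parameters\<close>

context principal
begin

text \<open>Covers parallel surfaces (with the identity for the change of parameters) as well as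
  changes of parameters that preserve the parameter lines.\<close>

lemma frame_change:
  assumes U: "open U" and \<phi>: "\<And>p. p \<in> U \<Longrightarrow> \<phi> p \<in> D" "\<And>p. p \<in> U \<Longrightarrow> has_pd \<phi> (\<alpha> p, 0) (0, \<beta> p) p"
    and w: "\<And>p. p \<in> U \<Longrightarrow> has_pd w (A p *\<^sub>R pd_u z (\<phi> p)) (B p *\<^sub>R pd_v z (\<phi> p)) p"
    and AB: "smooth_on U A" "smooth_on U B" and nz: "\<And>p. p \<in> U \<Longrightarrow> A p * B p \<noteq> 0"
    and p: "p \<in> U"
  shows "cross3 (pd_u w p) (pd_v w p) \<noteq> 0" "coeffF w p = 0" "coeffM w p = 0"
     "normal w p = sgn (A p * B p) *\<^sub>R normal z (\<phi> p)"
     "coeffE w p = (A p)\<^sup>2 * coeffE z (\<phi> p)" "coeffG w p = (B p)\<^sup>2 * coeffG z (\<phi> p)"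
     "nu1 w p = sgn (A p * B p) * \<alpha> p * nu1 z (\<phi> p) / A p" "nu2 w p = sgn (A p * B p) * \<beta> p * nu2 z (\<phi> p) / B p"
proof -
  note q = \<phi>(1)[OF p]
  note pd = has_pd_imp[OF w]
  have c: "cross3 (pd_u w p) (pd_v w p) = (A p * B p) *\<^sub>R cross3 (pd_u z (\<phi> p)) (pd_v z (\<phi> p))"
    by (simp add: pd[OF p] cross_mult_left cross_mult_right)
  show "cross3 (pd_u w p) (pd_v w p) \<noteq> 0" unfolding c using cross_nz[OF q] nz[OF p] by simp
  show "coeffF w p = 0" by (simp add: coeffF_def pd[OF p] F0[OF q])
  show n: "normal w p = sgn (A p * B p) *\<^sub>R normal z (\<phi> p)" unfolding normal_def c by (rule sgn_scaleR)
  show E: "coeffE w p = (A p)\<^sup>2 * coeffE z (\<phi> p)" by (simp add: coeffE_def pd[OF p] power2_eq_square)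
  show G: "coeffG w p = (B p)\<^sup>2 * coeffG z (\<phi> p)" by (simp add: coeffG_def pd[OF p] power2_eq_square)
  have u: "has_pd (pd_u z \<circ> \<phi>) (\<alpha> p *\<^sub>R pd_u (pd_u z) (\<phi> p)) (\<beta> p *\<^sub>R pd_v (pd_u z) (\<phi> p)) p"
    using has_pd_comp[OF has_pd_zu[OF q] \<phi>(2)[OF p]] by simp
  have v: "has_pd (pd_v z \<circ> \<phi>) (\<alpha> p *\<^sub>R pd_v (pd_u z) (\<phi> p)) (\<beta> p *\<^sub>R pd_v (pd_v z) (\<phi> p)) p"
    using has_pd_comp[OF has_pd_zv[OF q] \<phi>(2)[OF p]] by simp
  note pu = has_pd_cong[OF has_pd_scaleR[OF smooth_has_pd[OF AB(1) U p] u] U p, of "pd_u w", THEN has_pd_imp(1)]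
    has_pd_cong[OF has_pd_scaleR[OF smooth_has_pd[OF AB(1) U p] u] U p, of "pd_u w", THEN has_pd_imp(2)]
    has_pd_cong[OF has_pd_scaleR[OF smooth_has_pd[OF AB(2) U p] v] U p, of "pd_v w", THEN has_pd_imp(2)]
  show "coeffM w p = 0" unfolding coeffM_def n by (subst pu(2)) (simp_all add: pd inner_add_left M0[OF q])
  have "coeffL w p = sgn (A p * B p) * A p * \<alpha> p * (nu1 z (\<phi> p) * coeffE z (\<phi> p))"
    unfolding coeffL_def n by (subst pu(1)) (simp_all add: pd inner_add_left L_eq[OF q])
  then show "nu1 w p = sgn (A p * B p) * \<alpha> p * nu1 z (\<phi> p) / A p"
    using nz[OF p] E_pos[OF q] unfolding nu1_def[of w] E by (simp add: power2_eq_square)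
  have "coeffN w p = sgn (A p * B p) * B p * \<beta> p * (nu2 z (\<phi> p) * coeffG z (\<phi> p))"
    unfolding coeffN_def n by (subst pu(3)) (simp_all add: pd inner_add_left N_eq[OF q])
  then show "nu2 w p = sgn (A p * B p) * \<beta> p * nu2 z (\<phi> p) / B p"
    using nz[OF p] G_pos[OF q] unfolding nu2_def[of w] G by (simp add: power2_eq_square)
qed

lemma diag_surf:
  assumes U: "open U" "connected U" and \<phi>: "\<And>p. p \<in> U \<Longrightarrow> \<phi> p \<in> D" "smooth_on U \<phi>"
    "\<And>p. p \<in> U \<Longrightarrow> has_pd \<phi> (\<alpha> p, 0) (0, \<beta> p) p" and pos: "\<And>p. p \<in> U \<Longrightarrow> \<alpha> p > 0 \<and> \<beta> p > 0"
  shows "principal_surface (z \<circ> \<phi>) U"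
    "\<And>p. p \<in> U \<Longrightarrow> coeffE (z \<circ> \<phi>) p = (\<alpha> p)\<^sup>2 * coeffE z (\<phi> p)"
    "\<And>p. p \<in> U \<Longrightarrow> coeffG (z \<circ> \<phi>) p = (\<beta> p)\<^sup>2 * coeffG z (\<phi> p)"
    "\<And>p. p \<in> U \<Longrightarrow> nu1 (z \<circ> \<phi>) p = nu1 z (\<phi> p)" "\<And>p. p \<in> U \<Longrightarrow> nu2 (z \<circ> \<phi>) p = nu2 z (\<phi> p)"
    "codazzi_type z D \<Longrightarrow> codazzi_type (z \<circ> \<phi>) U"
proof -
  have w: "has_pd (z \<circ> \<phi>) (\<alpha> p *\<^sub>R pd_u z (\<phi> p)) (\<beta> p *\<^sub>R pd_v z (\<phi> p)) p" if "p \<in> U" for p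
    using has_pd_comp[OF has_pdI[OF sm \<phi>(1)] \<phi>(3), OF that that] by simp
  have "smooth_on U (\<lambda>p. fst (pd_u \<phi> p))" "smooth_on U (\<lambda>p. snd (pd_v \<phi> p))"
    by (intro smooth_linear[OF U(1) bounded_linear_fst] smooth_linear[OF U(1) bounded_linear_snd] smooth_pd \<phi>)+
  then have sm': "smooth_on U \<alpha>" "smooth_on U \<beta>"
    using smooth_on_cong[OF U(1), of "\<lambda>p. fst (pd_u \<phi> p)" \<alpha>] smooth_on_cong[OF U(1), of "\<lambda>p. snd (pd_v \<phi> p)" \<beta>]
    by (simp_all add: has_pd_imp[OF \<phi>(3)])
  have nz: "\<alpha> p * \<beta> p \<noteq> 0" and sg: "sgn (\<alpha> p * \<beta> p) = 1" if "p \<in> U" for p using pos[OF that] by (auto simp: sgn_mult)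
  note fc = frame_change[OF U(1) \<phi>(1,3) w sm' nz]
  show "\<And>p. p \<in> U \<Longrightarrow> coeffE (z \<circ> \<phi>) p = (\<alpha> p)\<^sup>2 * coeffE z (\<phi> p)"
    "\<And>p. p \<in> U \<Longrightarrow> coeffG (z \<circ> \<phi>) p = (\<beta> p)\<^sup>2 * coeffG z (\<phi> p)" using fc(5,6) by auto
  show nu: "\<And>p. p \<in> U \<Longrightarrow> nu1 (z \<circ> \<phi>) p = nu1 z (\<phi> p)" "\<And>p. p \<in> U \<Longrightarrow> nu2 (z \<circ> \<phi>) p = nu2 z (\<phi> p)"
    using fc(7,8) sg pos by (simp_all, (metis less_irrefl)+)
  show "principal_surface (z \<circ> \<phi>) U" unfolding principal_surface_def
    using U fc(1,2,3) \<phi>(1,2) nu_less[OF \<phi>(1)] by (auto simp: nu intro!: smooth_comp[OF D(1) _ sm])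
  have "has_pd (nu1 (z \<circ> \<phi>)) (\<alpha> p * pd_u (nu1 z) (\<phi> p)) (\<beta> p * pd_v (nu1 z) (\<phi> p)) p"
    "has_pd (nu2 (z \<circ> \<phi>)) (\<alpha> p * pd_u (nu2 z) (\<phi> p)) (\<beta> p * pd_v (nu2 z) (\<phi> p)) p" if p: "p \<in> U" for p
    using has_pd_cong[OF has_pd_comp[OF has_pd_nu(1)[OF \<phi>(1)[OF p]] \<phi>(3)[OF p]] U(1) p, of "nu1 (z \<circ> \<phi>)"]
       has_pd_cong[OF has_pd_comp[OF has_pd_nu(2)[OF \<phi>(1)[OF p]] \<phi>(3)[OF p]] U(1) p, of "nu2 (z \<circ> \<phi>)"]
    by (simp_all add: nu)
  note pdnu = has_pd_imp[OF this(1)] has_pd_imp[OF this(2)]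
  show "codazzi_type (z \<circ> \<phi>) U" if "codazzi_type z D"
    by (rule codazzi_type_transfer[OF that \<phi>(1)]) (use pos in \<open>force simp: pdnu\<close>)+
qed

text \<open>By Rodrigues' formulas the tangents are multiplied by c (1 - a \<nu>1) and c (1 - a
  \<nu>2); if these factors have opposite signs, the normal is reversed, which is the origin of
  \<epsilon>. The order of the curvatures survives because their difference is multiplied by
  \<epsilon> over a product of sign \<epsilon>, and by 1 / c.\<close>

lemma parallel_surf:
  assumes V: "open V" "V \<subseteq> D" and c: "c > 0" and \<epsilon>: "\<bar>\<epsilon>\<bar> = 1"
    and s: "\<And>p. p \<in> V \<Longrightarrow> sgn ((1 - a * nu1 z p) * (1 - a * nu2 z p)) = \<epsilon>"
  defines "y \<equiv> (\<lambda>x. c *\<^sub>R x) \<circ> parallel a z"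
  shows "connected V \<Longrightarrow> principal_surface y V"
    "\<And>p. p \<in> V \<Longrightarrow> nu1 y p = \<epsilon> * nu1 z p / (c * (1 - a * nu1 z p))"
    "\<And>p. p \<in> V \<Longrightarrow> nu2 y p = \<epsilon> * nu2 z p / (c * (1 - a * nu2 z p))"
    "codazzi_type z D \<Longrightarrow> codazzi_type y V" "\<And>p. p \<in> V \<Longrightarrow> nu2 y p < nu1 y p"
proof -
  let ?A = "\<lambda>p. c * (1 - a * nu1 z p)" and ?B = "\<lambda>p. c * (1 - a * nu2 z p)"
  have VD: "p \<in> D" if "p \<in> V" for p using that V by auto
  have ynz: "1 - a * nu1 z p \<noteq> 0" "1 - a * nu2 z p \<noteq> 0" if "p \<in> V" for p
    using s[OF that] \<epsilon> by (auto simp: sgn_if split: if_splits)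
  have w: "has_pd y (?A p *\<^sub>R pd_u z p) (?B p *\<^sub>R pd_v z p) p" if "p \<in> V" for p
  proof -
    note p = VD[OF that]
    have "has_pd (\<lambda>q. c *\<^sub>R (z q + a *\<^sub>R normal z q)) (c *\<^sub>R (pd_u z p + a *\<^sub>R (- nu1 z p *\<^sub>R pd_u z p)))
       (c *\<^sub>R (pd_v z p + a *\<^sub>R (- nu2 z p *\<^sub>R pd_v z p))) p"
      by (intro has_pd_linear[OF bounded_linear_scaleR_right] has_pd_add has_pdI[OF sm p] has_pd_normal[OF p])
    then show ?thesis unfolding y_def o_def parallel_def by (rule has_pd_eq) (simp_all add: algebra_simps)
  qed
  have AB: "smooth_on V ?A" "smooth_on V ?B"
    by (intro smooth_mult[OF V(1)] smooth_const smooth_diff[OF V(1)] smooth_on_subset[OF coeffs_smooth(3) V(2)]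
      smooth_on_subset[OF coeffs_smooth(4) V(2)])+
  have nz: "?A p * ?B p \<noteq> 0" if "p \<in> V" for p using ynz[OF that] c by simp
  have sg: "sgn (?A p * ?B p) = \<epsilon>" if "p \<in> V" for p using s[OF that] c by (simp add: sgn_mult)
  have idp: "has_pd (\<lambda>p. p) (1,0) (0,1) p" for p :: "real \<times> real"
    using has_pd_Pair[OF has_pd_fst has_pd_snd, of p] by simp
  note fc = frame_change[OF V(1), of "\<lambda>p. p" "\<lambda>p. 1" "\<lambda>p. 1" y ?A ?B, OF VD idp w AB nz]
  show nu: "nu1 y p = \<epsilon> * nu1 z p / (c * (1 - a * nu1 z p))" "nu2 y p = \<epsilon> * nu2 z p / (c * (1 - a * nu2 z p))"
    if "p \<in> V" for p using fc(7,8)[OF _ _ _ that] sg[OF that] by simp_all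
  show less: "nu2 y p < nu1 y p" if "p \<in> V" for p
  proof -
    let ?\<alpha> = "1 - a * nu1 z p" and ?\<beta> = "1 - a * nu2 z p"
    have "nu1 y p - nu2 y p = \<epsilon> / (?\<alpha> * ?\<beta>) * (nu1 z p - nu2 z p) / c"
      unfolding nu[OF that] using ynz[OF that] c by (simp add: divide_simps) (simp add: algebra_simps)
    also have "\<dots> > 0"
    proof -
      have "0 < sgn x / x" if "x \<noteq> 0" for x :: real using that by (auto simp: sgn_if zero_less_divide_iff)
      from this[of "?\<alpha> * ?\<beta>"] have "0 < \<epsilon> / (?\<alpha> * ?\<beta>)" using s[OF that] ynz[OF that] by simp
      then show ?thesis by (rule divide_pos_pos[OF mult_pos_pos c]) (use nu_less[OF VD[OF that]] in simp)
    qed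
    finally show ?thesis by simp
  qed
  have "smooth_on D (\<lambda>q. c *\<^sub>R (z q + a *\<^sub>R normal z q))"
    by (intro smooth_scaleR smooth_add smooth_const D sm normal_smooth)
  then have "smooth_on V y" using V(2) by (simp add: y_def o_def parallel_def smooth_on_subset)
  then show "principal_surface y V" if "connected V" unfolding principal_surface_def using that V fc(1,2,3) less
      by auto
  \<comment> \<open>The Moebius map has a nowhere vanishing derivative, so the derivatives of the
    new curvatures vanish exactly where the old ones do.\<close>
  have h: "((\<lambda>t. \<epsilon> * t / (c * (1 - a * t))) has_real_derivative \<epsilon> / (c * (1 - a * t)\<^sup>2)) (at t)" if "1 - a * t \<noteq>
      0" for t
    using that c by (auto intro!: derivative_eq_intros simp: divide_simps) (simp add: power2_eq_square algebra_simps)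
  have "has_pd (nu1 y) (\<epsilon> / (c * (1 - a * nu1 z p)\<^sup>2) * pd_u (nu1 z) p) (\<epsilon> / (c * (1 - a * nu1 z p)\<^sup>2) * pd_v
      (nu1 z) p) p"
    "has_pd (nu2 y) (\<epsilon> / (c * (1 - a * nu2 z p)\<^sup>2) * pd_u (nu2 z) p) (\<epsilon> / (c * (1 - a * nu2 z p)\<^sup>2) * pd_v (nu2
        z) p) p" if p: "p \<in> V" for p
    using has_pd_cong[OF has_pd_real_comp[OF h[OF ynz(1)[OF p]] has_pd_nu(1)[OF VD[OF p]]] V(1) p, of "nu1 y"]
      has_pd_cong[OF has_pd_real_comp[OF h[OF ynz(2)[OF p]] has_pd_nu(2)[OF VD[OF p]]] V(1) p, of "nu2 y"] nu by
          simp_all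
  note pdnu = has_pd_imp[OF this(1)] has_pd_imp[OF this(2)]
  show "codazzi_type y V" if "codazzi_type z D"
    by (rule codazzi_type_transfer[OF that VD]) (use ynz c \<epsilon> in \<open>force simp: pdnu\<close>)+
qed

end

section \<open>The natural PDE for a pair of curvature functions\<close>

lemma deriv_has_derivative:
  assumes "open I" "t \<in> I" "\<And>t. t \<in> I \<Longrightarrow> (f has_real_derivative f1 t) (at t)" "(f1 has_real_derivative f2) (at t)"
  shows "(deriv f has_real_derivative f2) (at t)"
  by (rule has_field_derivative_transform_within_open[OF assms(4,1,2)]) (use assms(3) DERIV_imp_deriv in metis)

text \<open>Only class C2 is assumed, since the unknown functions in \<open>pde_becomes\<close> are
  no smoother; the second derivative of \<open>h\<close> is needed at the single value
  \<open>l q\<close>.\<close>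

lemma second_pd_comp:
  fixes l :: "real \<times> real \<Rightarrow> real"
  assumes \<Omega>: "open \<Omega>" "q \<in> \<Omega>" and l: "Ck_on 2 \<Omega> l"
    and h: "\<forall>r\<in>\<Omega>. (h has_real_derivative h1 (l r)) (at (l r))" "(h1 has_real_derivative h2) (at (l q))"
  shows "pd_u (\<lambda>r. h (l r)) q = h1 (l q) * pd_u l q" "pd_v (\<lambda>r. h (l r)) q = h1 (l q) * pd_v l q"
    "pd_u (pd_u (\<lambda>r. h (l r))) q = h1 (l q) * pd_u (pd_u l) q + h2 * (pd_u l q)\<^sup>2"
    "pd_v (pd_v (\<lambda>r. h (l r))) q = h1 (l q) * pd_v (pd_v l) q + h2 * (pd_v l q)\<^sup>2"
proof -
  have ll: "Ck_on (Suc (Suc 0)) \<Omega> l" using l by (simp only: numeral_2_eq_2)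
  note d1 = Ck_SucD[OF \<Omega>(1) ll]
  note du = Ck_SucD(1)[OF \<Omega>(1) d1(2) \<Omega>(2)] and dv = Ck_SucD(1)[OF \<Omega>(1) d1(3) \<Omega>(2)]
  have 1: "has_pd (\<lambda>r. h (l r)) (h1 (l r) * pd_u l r) (h1 (l r) * pd_v l r) r" if "r \<in> \<Omega>" for r
    by (rule has_pd_real_comp[OF h(1)[rule_format, OF that] d1(1)[OF that]])
  note pd = has_pd_imp[OF 1]
  show "pd_u (\<lambda>r. h (l r)) q = h1 (l q) * pd_u l q" "pd_v (\<lambda>r. h (l r)) q = h1 (l q) * pd_v l q"
    using pd[OF \<Omega>(2)] by auto
  note h1 = has_pd_real_comp[OF h(2) d1(1)[OF \<Omega>(2)]]
  from has_pd_cong[OF has_pd_mult[OF h1 du] \<Omega>, of "pd_u (\<lambda>r. h (l r))", THEN has_pd_imp(1)]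
  show "pd_u (pd_u (\<lambda>r. h (l r))) q = h1 (l q) * pd_u (pd_u l) q + h2 * (pd_u l q)\<^sup>2"
    by (simp add: pd power2_eq_square)
  from has_pd_cong[OF has_pd_mult[OF h1 dv] \<Omega>, of "pd_v (\<lambda>r. h (l r))", THEN has_pd_imp(2)]
  show "pd_v (pd_v (\<lambda>r. h (l r))) q = h1 (l q) * pd_v (pd_v l) q + h2 * (pd_v l q)\<^sup>2"
    by (simp add: pd power2_eq_square)
qed

text \<open>In the application \<open>s\<close> is the substitution, and \<open>a\<close>,
  \<open>b\<close> are the second and first derivatives of \<lambda>. Differentiating f1(s) s1 =
  \<mu> m1 \<Phi>(s) produces, through the derivative of \<Phi>, exactly the quadratic correction 2
  f1^2 / w of the natural PDE; what remains is the second derivative of m(\<lambda>) times \<mu>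
  \<Phi>.\<close>

lemma second_order_form:
  fixes f1 \<Phi> s s1 m1 :: "real \<Rightarrow> real"
  assumes I: "open I" "s x \<in> I"
    and f1: "(f1 has_real_derivative f2) (at (s x))"
    and s: "(s has_real_derivative s1 x) (at x)" "(s1 has_real_derivative s2) (at x)"
    and \<Phi>: "\<And>t. t \<in> I \<Longrightarrow> \<Phi> t > 0" "(\<Phi> has_real_derivative 2 * f1 (s x) / w * \<Phi> (s x)) (at (s x))"
    and m: "\<mu> \<noteq> 0" "\<And>x. s x \<in> I \<Longrightarrow> f1 (s x) * s1 x = \<mu> * m1 x * \<Phi> (s x)"
  shows "\<exists>m2. (m1 has_real_derivative m2) (at x) \<and>
    (\<forall>a b. f1 (s x) * (s1 x * a + s2 * b\<^sup>2) + (f2 - 2 * (f1 (s x))\<^sup>2 / w) * (s1 x * b)\<^sup>2 =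
      \<mu> * \<Phi> (s x) * (m1 x * a + m2 * b\<^sup>2))"
proof -
  have J: "eventually (\<lambda>x. s x \<in> I) (nhds x)"
    using topological_tendstoD[OF DERIV_isCont[OF s(1), unfolded isCont_def] I] I(2)
    by (simp add: eventually_nhds_conv_at)
  have lhs: "((\<lambda>x. f1 (s x) * s1 x) has_real_derivative f1 (s x) * s2 + f2 * s1 x * s1 x) (at x)"
    using DERIV_mult[OF DERIV_chain2[OF f1 s(1)] s(2)] by (simp add: algebra_simps)
  note dP = DERIV_chain2[OF \<Phi>(2) s(1)]
  have "f1 (s x) * s1 x / (\<mu> * \<Phi> (s x)) = m1 x" if "s x \<in> I" for x
    using m(2)[OF that] m(1) \<Phi>(1)[OF that] by (simp add: field_simps)
  then have ev: "eventually (\<lambda>x. f1 (s x) * s1 x / (\<mu> * \<Phi> (s x)) = m1 x) (nhds x)"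
    using J by (auto elim: eventually_mono)
  have nz: "\<mu> * \<Phi> (s x) \<noteq> 0" using m(1) \<Phi>(1)[OF I(2)] by simp
  \<comment> \<open>Differentiability of \<open>m1\<close> is not assumed: near \<open>x\<close> it
    is a quotient of differentiable functions.\<close>
  obtain m2 where m2: "(m1 has_real_derivative m2) (at x)"
    using DERIV_cong_ev[OF refl ev refl] DERIV_divide[OF lhs DERIV_cmult[OF dP] nz] by blast
  have ev2: "eventually (\<lambda>x. f1 (s x) * s1 x = \<mu> * m1 x * \<Phi> (s x)) (nhds x)"
    using J by (auto elim!: eventually_mono simp: m(2))
  have "((\<lambda>x. f1 (s x) * s1 x) has_real_derivative
      \<mu> * m2 * \<Phi> (s x) + 2 * f1 (s x) / w * \<Phi> (s x) * s1 x * (\<mu> * m1 x)) (at x)"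
    unfolding DERIV_cong_ev[OF refl ev2 refl] by (rule DERIV_mult[OF DERIV_cmult[OF m2] dP])
  from DERIV_unique[OF lhs this]
  have "f1 (s x) * s2 + f2 * s1 x * s1 x = \<mu> * m2 * \<Phi> (s x) + 2 * (f1 (s x) * s1 x) * (\<mu> * m1 x * \<Phi> (s x)) / w"
    by (simp add: mult_ac)
  then have eq: "f1 (s x) * s2 + f2 * s1 x * s1 x = \<mu> * m2 * \<Phi> (s x) + 2 * (f1 (s x) * s1 x)\<^sup>2 / w"
    unfolding m(2)[OF I(2), symmetric] by (simp add: power2_eq_square)
  have "f1 (s x) * (s1 x * a + s2 * b\<^sup>2) + (f2 - 2 * (f1 (s x))\<^sup>2 / w) * (s1 x * b)\<^sup>2 =
      \<mu> * \<Phi> (s x) * (m1 x * a + m2 * b\<^sup>2)" for a b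
  proof -
    have "f1 (s x) * (s1 x * a + s2 * b\<^sup>2) + (f2 - 2 * (f1 (s x))\<^sup>2 / w) * (s1 x * b)\<^sup>2 =
      (f1 (s x) * s1 x) * a + (f1 (s x) * s2 + f2 * s1 x * s1 x - 2 * (f1 (s x) * s1 x)\<^sup>2 / w) * b\<^sup>2"
      by (simp add: algebra_simps power2_eq_square)
    also have "\<dots> = \<mu> * \<Phi> (s x) * (m1 x * a + m2 * b\<^sup>2)" unfolding eq m(2)[OF I(2)] by (simp add: algebra_simps)
    finally show ?thesis .
  qed
  with m2 show ?thesis by blast
qed

text \<open>\<open>\<Phi>\<close> is the exponential of twice an antiderivative of \<open>f' / (f - g)\<close>, and \<open>\<Psi>\<close> belongs in the
  same way to \<open>g' / (g - f)\<close>; indeed the sum of the two integrands is the logarithmic derivative of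
  \<open>f - g\<close>.\<close>

locale curv_pair =
  fixes I :: "real set" and f f1 g g1 \<Phi> :: "real \<Rightarrow> real"
  assumes I: "open I" "is_interval I"
    and f: "\<And>t. t \<in> I \<Longrightarrow> (f has_real_derivative f1 t) (at t)" "\<And>t. t \<in> I \<Longrightarrow> f1 differentiable (at t)"
    and g: "\<And>t. t \<in> I \<Longrightarrow> (g has_real_derivative g1 t) (at t)" "\<And>t. t \<in> I \<Longrightarrow> g1 differentiable (at t)"
    and nz: "\<And>t. t \<in> I \<Longrightarrow> f t \<noteq> g t" "\<And>t. t \<in> I \<Longrightarrow> f1 t \<noteq> 0" "\<And>t. t \<in> I \<Longrightarrow> g1 t \<noteq> 0"
    and \<Phi>: "\<And>t. t \<in> I \<Longrightarrow> \<Phi> t > 0" "\<And>t. t \<in> I \<Longrightarrow> (\<Phi> has_real_derivative 2 * f1 t / (f t - g t) * \<Phi> t) (at t)"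
begin

definition \<Psi> where "\<Psi> t = (f t - g t)\<^sup>2 / \<Phi> t"

lemma Psi_pos: "t \<in> I \<Longrightarrow> \<Psi> t > 0" using \<Phi>(1) nz(1) by (simp add: \<Psi>_def)

lemma Psi_deriv: assumes "t \<in> I" shows "(\<Psi> has_real_derivative 2 * g1 t / (g t - f t) * \<Psi> t) (at t)"
proof -
  let ?d = "f t - g t"
  have "(\<Psi> has_real_derivative ((2 * ?d * (f1 t - g1 t)) * \<Phi> t - ?d\<^sup>2 * (2 * f1 t / ?d * \<Phi> t)) / (\<Phi> t * \<Phi> t)) (at t)"
    unfolding \<Psi>_def[abs_def]
    by (rule DERIV_cong[OF DERIV_divide[OF DERIV_power[OF DERIV_diff[OF f(1)[OF assms] g(1)[OF assms]], of 2]
        \<Phi>(2)[OF assms]]])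
       (use \<Phi>(1)[OF assms] in \<open>simp_all add: mult.commute mult.left_commute\<close>)
  moreover have "((2 * ?d * (f1 t - g1 t)) * \<Phi> t - ?d\<^sup>2 * (2 * f1 t / ?d * \<Phi> t)) / (\<Phi> t * \<Phi> t) = 2 * g1 t / (g t
      - f t) * \<Psi> t"
  proof -
    have "?d \<noteq> 0" "g t - f t = - ?d" using nz(1)[OF assms] by auto
    then show ?thesis unfolding \<Psi>_def using \<Phi>(1)[OF assms] by (simp add: field_simps power2_eq_square)
  qed
  ultimately show ?thesis by simp
qed

lemma deriv_f: "t \<in> I \<Longrightarrow> deriv f t = f1 t" and deriv_g: "t \<in> I \<Longrightarrow> deriv g t = g1 t"
  using f(1) g(1) by (auto intro: DERIV_imp_deriv)

lemma f1_deriv: "t \<in> I \<Longrightarrow> (f1 has_real_derivative deriv f1 t) (at t)"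
  and g1_deriv: "t \<in> I \<Longrightarrow> (g1 has_real_derivative deriv g1 t) (at t)"
  using f(2) g(2) by (auto simp: DERIV_deriv_iff_real_differentiable)

lemma deriv_deriv: "t \<in> I \<Longrightarrow> (deriv f has_real_derivative deriv f1 t) (at t)"
  "t \<in> I \<Longrightarrow> (deriv g has_real_derivative deriv g1 t) (at t)"
  using deriv_has_derivative[OF I(1) _ f(1) f1_deriv] deriv_has_derivative[OF I(1) _ g(1) g1_deriv] by auto

text \<open>Half of ln h is an antiderivative of \<open>w\<close>; since \<open>I\<close> is an
  interval, the segment between \<open>t0\<close> and \<open>t\<close> stays inside it.\<close>

lemma exp_integral:
  assumes t: "t0 \<in> I" "t \<in> I" and h: "\<And>t. t \<in> I \<Longrightarrow> (h has_real_derivative 2 * w t * h t) (at t)" "\<And>t. t \<in> I \<Longrightarrow> h t > 0"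
    and w: "continuous_on I w"
  shows "exp (LBINT t=ereal t0..ereal t. w t) = sqrt (h t / h t0)"
proof -
  have sub: "{min t0 t..max t0 t} \<subseteq> I"
  proof
    fix x assume "x \<in> {min t0 t..max t0 t}"
    then have "min t0 t \<le> x" "x \<le> max t0 t" by simp_all
    moreover have "min t0 t \<in> I" "max t0 t \<in> I" using t by (simp_all add: min_def max_def)
    ultimately show "x \<in> I" using I(2) unfolding is_interval_1 by blast
  qed
  have "(LBINT t=ereal t0..ereal t. w t) = ln (h t) / 2 - ln (h t0) / 2"
  proof (rule interval_integral_FTC_finite)
    show "continuous_on {min t0 t..max t0 t} w" using w sub continuous_on_subset by blast
    fix x assume "min t0 t \<le> x" "x \<le> max t0 t"
    then have x: "x \<in> I" using sub by auto
    have "((\<lambda>t. ln (h t) / 2) has_real_derivative w x) (at x)"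
      using h(2)[OF x] by (auto intro!: derivative_eq_intros h(1)[OF x])
    then show "((\<lambda>t. ln (h t) / 2) has_vector_derivative w x) (at x within {min t0 t..max t0 t})"
      unfolding has_real_derivative_iff_has_vector_derivative[symmetric] by (rule has_field_derivative_at_within)
  qed
  also have "\<dots> = ln (sqrt (h t / h t0))"
    using h(2)[OF t(1)] h(2)[OF t(2)] by (simp add: ln_sqrt ln_div diff_divide_distrib)
  finally show ?thesis using h(2)[OF t(1)] h(2)[OF t(2)] by simp
qed

lemma cont: "continuous_on I f" "continuous_on I g" "continuous_on I (deriv f)" "continuous_on I (deriv g)"
  using DERIV_isCont[OF f(1)] DERIV_isCont[OF g(1)] DERIV_isCont[OF deriv_deriv(1)] DERIV_isCont[OF deriv_deriv(2)]
  by (simp_all add: continuous_at_imp_continuous_on)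

lemma exp_int_f: assumes "t0 \<in> I" "t \<in> I" shows "exp (int_f f g t0 t) = sqrt (\<Phi> t / \<Phi> t0)"
  unfolding int_f_def
proof (rule exp_integral[OF assms])
  show "continuous_on I (\<lambda>t. deriv f t / (f t - g t))" using nz(1) by (intro continuous_intros cont) auto
qed (use \<Phi> in \<open>auto simp: deriv_f\<close>)

lemma exp_int_g: assumes "t0 \<in> I" "t \<in> I" shows "exp (int_g f g t0 t) = sqrt (\<Psi> t / \<Psi> t0)"
  unfolding int_g_def
proof (rule exp_integral[OF assms])
  show "continuous_on I (\<lambda>t. deriv g t / (g t - f t))" using nz(1) by (intro continuous_intros cont) force
qed (use Psi_pos Psi_deriv in \<open>auto simp: deriv_g\<close>)

lemma exp_2int: assumes "t0 \<in> I" "t \<in> I"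
  shows "exp (2 * int_f f g t0 t) = \<Phi> t / \<Phi> t0" "exp (2 * int_g f g t0 t) = \<Psi> t / \<Psi> t0"
proof -
  have "exp (2 * x) = (exp x)\<^sup>2" for x :: real by (simp add: exp_double power2_eq_square)
  then show "exp (2 * int_f f g t0 t) = \<Phi> t / \<Phi> t0" "exp (2 * int_g f g t0 t) = \<Psi> t / \<Psi> t0"
    using \<Phi>(1) Psi_pos assms by (simp_all add: exp_int_f exp_int_g less_imp_le)
qed

text \<open>With \<open>\<Phi> m' = f'\<close> and \<open>\<Psi> n' = g'\<close>, up to constants, the second order terms of the natural PDE are
  the second derivatives of \<open>m(\<nu>)\<close> and \<open>n(\<nu>)\<close>.\<close>

lemma natural_pde_iff:
  fixes l :: "real \<times> real \<Rightarrow> real"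
  assumes \<Omega>: "open \<Omega>" "q \<in> \<Omega>" and l: "Ck_on 2 \<Omega> l" and sI: "\<And>r. r \<in> \<Omega> \<Longrightarrow> s (l r) \<in> I"
    and s: "\<And>x. s x \<in> I \<Longrightarrow> (s has_real_derivative s1 x) (at x)" "\<And>x. s x \<in> I \<Longrightarrow> s1 differentiable (at x)"
    and m: "\<And>x. s x \<in> I \<Longrightarrow> (m has_real_derivative m1 x) (at x)" "\<mu> \<noteq> 0"
      "\<And>x. s x \<in> I \<Longrightarrow> f1 (s x) * s1 x = \<mu> * m1 x * \<Phi> (s x)"
    and n: "\<And>x. s x \<in> I \<Longrightarrow> (n has_real_derivative n1 x) (at x)" "\<eta> \<noteq> 0"
      "\<And>x. s x \<in> I \<Longrightarrow> g1 (s x) * s1 x = \<eta> * n1 x * \<Psi> (s x)"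
    and t0: "t0 \<in> I"
  shows "natural_pde f g a b t0 (\<lambda>r. s (l r)) q \<longleftrightarrow>
    b\<^sup>2 / \<Psi> t0 * \<mu> * pd_v (pd_v (\<lambda>r. m (l r))) q - a\<^sup>2 / \<Phi> t0 * \<eta> * pd_u (pd_u (\<lambda>r. n (l r))) q
    = f (s (l q)) * g (s (l q)) / (f (s (l q)) - g (s (l q)))"
proof -
  let ?x = "l q" and ?t = "s (l q)"
  note t = sI[OF \<Omega>(2)]
  obtain s2 where s2: "(s1 has_real_derivative s2) (at ?x)" using s(2)[OF t] by (auto simp: real_differentiable_def)
  let ?f2 = "deriv f1 ?t" and ?g2 = "deriv g1 ?t"
  obtain m2 where m2: "(m1 has_real_derivative m2) (at ?x)" "\<And>a b. f1 ?t * (s1 ?x * a + s2 * b\<^sup>2) +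
      (?f2 - 2 * (f1 ?t)\<^sup>2 / (f ?t - g ?t)) * (s1 ?x * b)\<^sup>2 = \<mu> * \<Phi> ?t * (m1 ?x * a + m2 * b\<^sup>2)"
    using second_order_form[OF I(1) t f1_deriv[OF t] s(1)[OF t] s2 \<Phi>(1) \<Phi>(2)[OF t] m(2,3)] by auto
  obtain n2 where n2: "(n1 has_real_derivative n2) (at ?x)" "\<And>a b. g1 ?t * (s1 ?x * a + s2 * b\<^sup>2) +
      (?g2 - 2 * (g1 ?t)\<^sup>2 / (g ?t - f ?t)) * (s1 ?x * b)\<^sup>2 = \<eta> * \<Psi> ?t * (n1 ?x * a + n2 * b\<^sup>2)"
    using second_order_form[OF I(1) t g1_deriv[OF t] s(1)[OF t] s2 Psi_pos Psi_deriv[OF t] n(2,3)] by auto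
  have "\<forall>r\<in>\<Omega>. (s has_real_derivative s1 (l r)) (at (l r))"
    "\<forall>r\<in>\<Omega>. (m has_real_derivative m1 (l r)) (at (l r))" "\<forall>r\<in>\<Omega>. (n has_real_derivative n1 (l r)) (at (l r))"
    using s(1) m(1) n(1) sI by auto
  note S = second_pd_comp[OF \<Omega> l this(1) s2] and Mm = second_pd_comp[OF \<Omega> l this(2) m2(1)]
    and Nn = second_pd_comp[OF \<Omega> l this(3) n2(1)]
  have 1: "f1 ?t * pd_v (pd_v (\<lambda>r. s (l r))) q + (?f2 - 2 * (f1 ?t)\<^sup>2 / (f ?t - g ?t)) * (pd_v (\<lambda>r. s (l r)) q)\<^sup>2
     = \<mu> * \<Phi> ?t * pd_v (pd_v (\<lambda>r. m (l r))) q"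
    unfolding S Mm by (rule m2(2))
  have 2: "g1 ?t * pd_u (pd_u (\<lambda>r. s (l r))) q + (?g2 - 2 * (g1 ?t)\<^sup>2 / (g ?t - f ?t)) * (pd_u (\<lambda>r. s (l r)) q)\<^sup>2
     = \<eta> * \<Psi> ?t * pd_u (pd_u (\<lambda>r. n (l r))) q"
    unfolding S Nn by (rule n2(2))
  have d2: "deriv (deriv f) ?t = ?f2" "deriv (deriv g) ?t = ?g2" using deriv_deriv[OF t] by (auto intro:
      DERIV_imp_deriv)
  let ?M = "pd_v (pd_v (\<lambda>r. m (l r))) q" and ?N = "pd_u (pd_u (\<lambda>r. n (l r))) q"
  \<comment> \<open>The weights of the two second order terms multiply to this square. Hence it can
    be divided out of the equation, leaving pure second derivatives with constant
    coefficients.\<close>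
  have PP: "\<Psi> ?t * \<Phi> ?t = (f ?t - g ?t)\<^sup>2" using \<Phi>(1)[OF t] by (simp add: \<Psi>_def)
  have "natural_pde f g a b t0 (\<lambda>r. s (l r)) q \<longleftrightarrow>
     b\<^sup>2 * (\<Psi> ?t / \<Psi> t0) * (\<mu> * \<Phi> ?t * ?M) - a\<^sup>2 * (\<Phi> ?t / \<Phi> t0) * (\<eta> * \<Psi> ?t * ?N) - f ?t * g ?t * (f ?t - g ?t) = 0"
    unfolding natural_pde_def Let_def deriv_f[OF t] deriv_g[OF t] d2 exp_2int[OF t0 t] 1 2 ..
  also have "b\<^sup>2 * (\<Psi> ?t / \<Psi> t0) * (\<mu> * \<Phi> ?t * ?M) - a\<^sup>2 * (\<Phi> ?t / \<Phi> t0) * (\<eta> * \<Psi> ?t * ?N) - f ?t * g ?t * (f ?t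
      - g ?t)
     = (\<Psi> ?t * \<Phi> ?t) * (b\<^sup>2 / \<Psi> t0 * \<mu> * ?M - a\<^sup>2 / \<Phi> t0 * \<eta> * ?N) - f ?t * g ?t * (f ?t - g ?t)"
    by (simp add: algebra_simps)
  also have "\<dots> = (f ?t - g ?t)\<^sup>2 * ((b\<^sup>2 / \<Psi> t0 * \<mu> * ?M - a\<^sup>2 / \<Phi> t0 * \<eta> * ?N) - f ?t * g ?t / (f ?t - g ?t))"
  proof -
    have "d\<^sup>2 * X - c * d = d\<^sup>2 * (X - c / d)" if "d \<noteq> 0" for d X c :: real
      using that by (simp add: field_simps power2_eq_square)
    then show ?thesis unfolding PP using nz(1)[OF t] by simp
  qed
  finally show ?thesis using nz(1)[OF t] by simp
qed

end

subsection \<open>Weingarten surfaces\<close>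

locale weingarten_pair = principal z D + curv_pair I f f1 g g1 \<Phi> for z D I f f1 g g1 \<Phi> +
  fixes \<nu> :: "real \<times> real \<Rightarrow> real"
  assumes nu: "smooth_on D \<nu>" "\<And>p. p \<in> D \<Longrightarrow> \<nu> p \<in> I" "\<And>p. p \<in> D \<Longrightarrow> nu1 z p = f (\<nu> p)" "\<And>p. p \<in> D \<Longrightarrow> nu2 z p = g (\<nu> p)"
begin

lemma has_pd_nu': "p \<in> D \<Longrightarrow> has_pd \<nu> (pd_u \<nu> p) (pd_v \<nu> p) p"
  by (rule has_pdI[OF nu(1)])

lemma pd_nu:
  assumes p: "p \<in> D" shows "pd_u (nu1 z) p = f1 (\<nu> p) * pd_u \<nu> p" "pd_v (nu1 z) p = f1 (\<nu> p) * pd_v \<nu> p"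
   "pd_u (nu2 z) p = g1 (\<nu> p) * pd_u \<nu> p" "pd_v (nu2 z) p = g1 (\<nu> p) * pd_v \<nu> p"
  using has_pd_imp[OF has_pd_cong[OF has_pd_real_comp[OF f(1)[OF nu(2)[OF p]] has_pd_nu'[OF p]] D(1) p, of "nu1 z"]]
    has_pd_imp[OF has_pd_cong[OF has_pd_real_comp[OF g(1)[OF nu(2)[OF p]] has_pd_nu'[OF p]] D(1) p, of "nu2 z"]]
  by (auto simp: nu)

text \<open>The logarithmic v-derivatives of E and of \<Phi>(\<nu>) are opposite to each other,
  which is the first Codazzi equation in other words. The u-derivative \<open>d\<close> remains
  arbitrary.\<close>

lemma EPhi_v: assumes p: "p \<in> D"
  shows "\<exists>d. has_pd (\<lambda>q. coeffE z q * \<Phi> (\<nu> q)) d 0 p"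
proof -
  have t: "\<nu> p \<in> I" using nu p by auto
  note h = has_pd_mult[OF has_pd_E[OF p] has_pd_real_comp[OF \<Phi>(2)[OF t] has_pd_nu'[OF p]]]
  have "coeffE z p * (2 * f1 (\<nu> p) / (f (\<nu> p) - g (\<nu> p)) * \<Phi> (\<nu> p) * pd_v \<nu> p) + pd_v (coeffE z) p * \<Phi> (\<nu> p) = 0"
  proof -
    have ne: "f (\<nu> p) - g (\<nu> p) \<noteq> 0" using nz(1)[OF t] by simp
    have "pd_v (coeffE z) p = - (2 * coeffE z p * (f1 (\<nu> p) * pd_v \<nu> p)) / (f (\<nu> p) - g (\<nu> p))"
      using codazzi(1)[OF p] ne unfolding pd_nu[OF p] nu(3,4)[OF p] by (simp add: field_simps)
    then show ?thesis by (simp only:) (simp add: field_simps)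
  qed
  then show ?thesis using h by auto
qed

lemma GPsi_u: assumes p: "p \<in> D"
  shows "\<exists>d. has_pd (\<lambda>q. coeffG z q * \<Psi> (\<nu> q)) 0 d p"
proof -
  have t: "\<nu> p \<in> I" using nu p by auto
  note h = has_pd_mult[OF has_pd_G[OF p] has_pd_real_comp[OF Psi_deriv[OF t] has_pd_nu'[OF p]]]
  have "coeffG z p * (2 * g1 (\<nu> p) / (g (\<nu> p) - f (\<nu> p)) * \<Psi> (\<nu> p) * pd_u \<nu> p) + pd_u (coeffG z) p * \<Psi> (\<nu> p) = 0"
  proof -
    have ne: "g (\<nu> p) - f (\<nu> p) \<noteq> 0" using nz(1)[OF t] by simp
    have "pd_u (coeffG z) p = - (2 * coeffG z p * (g1 (\<nu> p) * pd_u \<nu> p)) / (g (\<nu> p) - f (\<nu> p))"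
      using codazzi(2)[OF p] ne unfolding pd_nu[OF p] nu(3,4)[OF p] by (simp add: field_simps)
    then show ?thesis by (simp only:) (simp add: field_simps)
  qed
  then show ?thesis using h by auto
qed

lemma natural_params:
  assumes "\<And>p. p \<in> D \<Longrightarrow> coeffE z p * \<Phi> (\<nu> p) = C1" "\<And>p. p \<in> D \<Longrightarrow> coeffG z p * \<Psi> (\<nu> p) = C2"
  shows "natural_params z D f g \<nu>"
  unfolding natural_params_def constant_on_def
proof (intro ballI conjI)
  fix t0 assume "t0 \<in> \<nu> ` D"
  then have t0: "t0 \<in> I" using nu by auto
  have "sqrt (coeffE z p) * exp (int_f f g t0 (\<nu> p)) = sqrt (C1 / \<Phi> t0)" if "p \<in> D" for p
    unfolding exp_int_f[OF t0 nu(2)[OF that]] real_sqrt_mult[symmetric] using assms(1)[OF that] by simp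
  then show "\<exists>y. \<forall>p\<in>D. sqrt (coeffE z p) * exp (int_f f g t0 (\<nu> p)) = y" by blast
  have "sqrt (coeffG z p) * exp (int_g f g t0 (\<nu> p)) = sqrt (C2 / \<Psi> t0)" if "p \<in> D" for p
    unfolding exp_int_g[OF t0 nu(2)[OF that]] real_sqrt_mult[symmetric] using assms(2)[OF that] by simp
  then show "\<exists>y. \<forall>p\<in>D. sqrt (coeffG z p) * exp (int_g f g t0 (\<nu> p)) = y" by blast
qed

text \<open>Constancy of E \<Phi> and G \<Psi> supplies the formulas for E_u and G_v that
  \<open>natural_gauss\<close> asks for in addition to the Codazzi equations.\<close>

lemma natural_pde:
  assumes EG: "\<And>p. p \<in> D \<Longrightarrow> coeffE z p * \<Phi> (\<nu> p) = C1" "\<And>p. p \<in> D \<Longrightarrow> coeffG z p * \<Psi> (\<nu> p) = C2"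
    and p0: "p0 \<in> D" "a\<^sup>2 * coeffE z p0 = 1" "b\<^sup>2 * coeffG z p0 = 1" and p: "p \<in> D"
  shows "natural_pde f g a b (\<nu> p0) \<nu> p"
proof -
  have t: "\<nu> p \<in> I" and t0: "\<nu> p0 \<in> I" using nu p p0 by auto
  note pos = E_pos[OF p] G_pos[OF p] E_pos[OF p0(1)] G_pos[OF p0(1)] \<Phi>(1)[OF t] Psi_pos[OF t] \<Phi>(1)[OF t0]
      Psi_pos[OF t0]
  have d: "f (\<nu> p) \<noteq> g (\<nu> p)" using nz(1)[OF t] .
  have 1: "pd_u (coeffE z) p * (nu1 z p - nu2 z p) = - 2 * coeffE z p * pd_u (nu1 z) p"
  proof -
    have "\<Phi> (\<nu> p) * (coeffE z p * (2 * f1 (\<nu> p) / (f (\<nu> p) - g (\<nu> p)) * pd_u \<nu> p) + pd_u (coeffE z) p) = 0"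
      using has_pd_eq_const(1)[OF D(1) p EG(1) has_pd_mult[OF has_pd_E[OF p] has_pd_real_comp[OF \<Phi>(2)[OF t]
          has_pd_nu'[OF p]]]]
      by (simp add: algebra_simps)
    then have "pd_u (coeffE z) p = - (coeffE z p * (2 * f1 (\<nu> p) / (f (\<nu> p) - g (\<nu> p)) * pd_u \<nu> p))"
      using pos by simp
    then show ?thesis using d unfolding pd_nu[OF p] nu(3,4)[OF p] by (simp only:) simp
  qed
  have 2: "pd_v (coeffG z) p * (nu1 z p - nu2 z p) = 2 * coeffG z p * pd_v (nu2 z) p"
  proof -
    have "\<Psi> (\<nu> p) * (coeffG z p * (2 * g1 (\<nu> p) / (g (\<nu> p) - f (\<nu> p)) * pd_v \<nu> p) + pd_v (coeffG z) p) = 0"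
      using has_pd_eq_const(2)[OF D(1) p EG(2) has_pd_mult[OF has_pd_G[OF p] has_pd_real_comp[OF Psi_deriv[OF t]
          has_pd_nu'[OF p]]]]
      by (simp add: algebra_simps)
    then have "pd_v (coeffG z) p = - (coeffG z p * (2 * g1 (\<nu> p) / (g (\<nu> p) - f (\<nu> p)) * pd_v \<nu> p))"
      using pos by simp
    also have "\<dots> = coeffG z p * (2 * g1 (\<nu> p) / (f (\<nu> p) - g (\<nu> p)) * pd_v \<nu> p)"
      by (metis (no_types, lifting) minus_diff_eq minus_divide_right mult_minus_left mult_minus_right minus_minus)
    finally show ?thesis using d unfolding pd_nu[OF p] nu(3,4)[OF p] by (simp only:) simp
  qed
  have C2: "Ck_on 2 D \<nu>" using nu(1) by (simp add: smooth_on_def)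
  have fg: "\<forall>q\<in>D. (f has_real_derivative f1 (\<nu> q)) (at (\<nu> q))" "\<forall>q\<in>D. (g has_real_derivative g1 (\<nu> q)) (at (\<nu> q))"
    using f(1) g(1) nu(2) by auto
  have cong: "pd_v (pd_v (nu1 z)) p = pd_v (pd_v (\<lambda>q. f (\<nu> q))) p" "pd_u (pd_u (nu2 z)) p = pd_u (pd_u (\<lambda>q. g (\<nu>
      q))) p"
  proof -
    have "pd_v (nu1 z) q = pd_v (\<lambda>q. f (\<nu> q)) q" "pd_u (nu2 z) q = pd_u (\<lambda>q. g (\<nu> q)) q" if "q \<in> D" for q
      using second_pd_comp(1,2)[OF D(1) that C2 fg(1) f1_deriv[OF nu(2)[OF that]]]
       second_pd_comp(1,2)[OF D(1) that C2 fg(2) g1_deriv[OF nu(2)[OF that]]] pd_nu[OF that] by auto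
    then show "pd_v (pd_v (nu1 z)) p = pd_v (pd_v (\<lambda>q. f (\<nu> q))) p" "pd_u (pd_u (nu2 z)) p = pd_u (pd_u (\<lambda>q. g
        (\<nu> q))) p"
      using has_pd_imp[OF has_pd_cong[OF has_pdI[OF smooth_pd(2)[OF coeffs_smooth(3)] p] D(1) p]]
        has_pd_imp[OF has_pd_cong[OF has_pdI[OF smooth_pd(1)[OF coeffs_smooth(4)] p] D(1) p]] by metis+
  qed
  note sf = second_pd_comp[OF D(1) p C2 fg(1) f1_deriv[OF t]]
  note sg = second_pd_comp[OF D(1) p C2 fg(2) g1_deriv[OF t]]
  have d2: "deriv (deriv f) (\<nu> p) = deriv f1 (\<nu> p)" "deriv (deriv g) (\<nu> p) = deriv g1 (\<nu> p)"
    using deriv_deriv[OF t] by (auto intro: DERIV_imp_deriv)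
  \<comment> \<open>Normalised at \<open>p0\<close>, the coefficients of the natural PDE are just 1
    / E and 1 / G at the current point; this is the meaning of the constants \<open>a\<close> and
    \<open>b\<close>.\<close>
  have a: "a\<^sup>2 * (\<Phi> (\<nu> p) / \<Phi> (\<nu> p0)) = 1 / coeffE z p" "b\<^sup>2 * (\<Psi> (\<nu> p) / \<Psi> (\<nu> p0)) = 1 / coeffG z p"
  proof -
    have ab: "a\<^sup>2 = 1 / coeffE z p0" "b\<^sup>2 = 1 / coeffG z p0" using p0 pos by (auto simp: field_simps)
    moreover have "coeffE z p * \<Phi> (\<nu> p) = coeffE z p0 * \<Phi> (\<nu> p0)" "coeffG z p * \<Psi> (\<nu> p) = coeffG z p0 * \<Psi> (\<nu> p0)"
      using EG p p0 by auto
    ultimately show "a\<^sup>2 * (\<Phi> (\<nu> p) / \<Phi> (\<nu> p0)) = 1 / coeffE z p" "b\<^sup>2 * (\<Psi> (\<nu> p) / \<Psi> (\<nu> p0)) = 1 / coeffG z p"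
      using pos unfolding ab by (simp_all add: divide_simps mult.commute)
  qed
  have gf: "x / (g (\<nu> p) - f (\<nu> p)) = - (x / (f (\<nu> p) - g (\<nu> p)))" for x
    by (simp add: minus_divide_right)
  have "natural_pde f g a b (\<nu> p0) \<nu> p \<longleftrightarrow>
    (pd_v (pd_v (nu1 z)) p - 2 * (pd_v (nu1 z) p)\<^sup>2 / (nu1 z p - nu2 z p)) / coeffG z p
    - (pd_u (pd_u (nu2 z)) p + 2 * (pd_u (nu2 z) p)\<^sup>2 / (nu1 z p - nu2 z p)) / coeffE z p
    - nu1 z p * nu2 z p * (nu1 z p - nu2 z p) = 0"
    unfolding natural_pde_def Let_def deriv_f[OF t] deriv_g[OF t] d2 exp_2int[OF t0 t] a cong sf sg pd_nu[OF p]
        nu(3,4)[OF p]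
    unfolding gf by (simp add: power_mult_distrib algebra_simps diff_divide_distrib add_divide_distrib)
  then show ?thesis using natural_gauss[OF p 1 2] by simp
qed

end

section \<open>The ten basic classes\<close>

lemma DERIV_real_differentiable: "(h has_real_derivative D) (at x) \<Longrightarrow> h differentiable (at x)"
  by (auto simp: real_differentiable_def)

text \<open>For a basic class \<open>c\<close>, the principal curvatures are \<open>F\<close> and \<open>G\<close> of the geometric function, which
  takes its values in \<open>dom\<close>. The constants are chosen so that \<open>E \<Phi> = 1 / A\<close> and \<open>G \<Psi> = 1 / B\<close> lead to the
  listed PDE.\<close>

locale class_data =
  fixes c :: basic_class and dom :: "real set" and geo :: "real \<Rightarrow> real \<Rightarrow> real"
    and F F1 G G1 \<Phi> s1 linv m m1 n n1 :: "real \<Rightarrow> real" and \<mu> \<eta> A B :: real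
  assumes dom: "open dom"
    and geo: "\<And>z p. geometric_function c z p = geo (nu1 z p) (nu2 z p)"
    and geo_smooth: "\<And>D x y. open D \<Longrightarrow> smooth_on D x \<Longrightarrow> smooth_on D y \<Longrightarrow> smooth_on D (\<lambda>p. geo (x p) (y p))"
    and rel: "\<And>x y. y < x \<Longrightarrow> curvature_relation c (x * y) ((x + y) / 2) ((x - y) / 2) \<Longrightarrow>
      geo x y \<in> dom \<and> F (geo x y) = x \<and> G (geo x y) = y"
    and FG: "\<And>t. t \<in> dom \<Longrightarrow> (F has_real_derivative F1 t) (at t) \<and> F1 differentiable (at t) \<and>
      (G has_real_derivative G1 t) (at t) \<and> G1 differentiable (at t) \<and> F1 t \<noteq> 0 \<and> G1 t \<noteq> 0 \<and> G t < F t"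
    and Phi: "\<And>t. t \<in> dom \<Longrightarrow> \<Phi> t > 0 \<and> (\<Phi> has_real_derivative 2 * F1 t / (F t - G t) * \<Phi> t) (at t)"
    and Phi_smooth: "\<And>D x. open D \<Longrightarrow> smooth_on D x \<Longrightarrow> x ` D \<subseteq> dom \<Longrightarrow> smooth_on D (\<lambda>p. \<Phi> (x p))"
    and sub: "\<And>x. substitution c x \<in> dom \<Longrightarrow> (substitution c has_real_derivative s1 x) (at x) \<and> s1 differentiable
        (at x)"
    and mn: "\<And>x. substitution c x \<in> dom \<Longrightarrow> (m has_real_derivative m1 x) (at x) \<and> (n has_real_derivative n1 x) (at x) \<and>
        F1 (substitution c x) * s1 x = \<mu> * m1 x * \<Phi> (substitution c x) \<and>
        G1 (substitution c x) * s1 x * \<Phi> (substitution c x) = \<eta> * n1 x * (F (substitution c x) - G (substitution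
            c x))\<^sup>2"
    and linv: "\<And>t. t \<in> dom \<Longrightarrow> substitution c (linv t) = t"
    and linv_smooth: "\<And>D x. open D \<Longrightarrow> smooth_on D x \<Longrightarrow> x ` D \<subseteq> dom \<Longrightarrow> smooth_on D (\<lambda>p. linv (x p))"
    and pos: "A > 0" "B > 0" "\<mu> \<noteq> 0" "\<eta> \<noteq> 0"
    and pde: "\<And>l q. substitution c (l q) \<in> dom \<Longrightarrow> class_pde c l q \<longleftrightarrow>
       B * \<mu> * pd_v (pd_v (\<lambda>r. m (l r))) q - A * \<eta> * pd_u (pd_u (\<lambda>r. n (l r))) q =
        F (substitution c (l q)) * G (substitution c (l q)) / (F (substitution c (l q)) - G (substitution c (l q)))"

text \<open>The pattern for all classes: the linear equation for \<Phi> fixes it up to a factor; m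
  and n are the arguments of the listed operator, namely \<lambda> itself, or 1 / h and h for the
  starred operators applied to h; \<mu> and \<eta> are then forced, and A, B scale the second order
  terms to the listed coefficients. Here \<Phi>' / \<Phi> = 1 / t, and F G / (F - G) = t /
  2.\<close>

lemma class1_data:
  "class_data Class1 {..<0} (\<lambda>x y. y) uminus (\<lambda>t. -1) (\<lambda>t. t) (\<lambda>t. 1) uminus (\<lambda>x. - exp x) (\<lambda>t. ln (- t))
    (\<lambda>x. x) (\<lambda>x. 1) (\<lambda>x. x) (\<lambda>x. 1) 1 (- 1 / 4) 2 (1 / 2)"
proof
  have "substitution Class1 = (\<lambda>x. - exp x)" by auto
  moreover have "(\<lambda>x :: real. - exp x) differentiable (at x)" for x
    by (rule DERIV_real_differentiable) (rule derivative_eq_intros refl | simp)+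
  ultimately show "(substitution Class1 has_real_derivative - exp x) (at x) \<and> (\<lambda>x. - exp x) differentiable at x" for x
    by (auto intro!: derivative_eq_intros)
  show "class_pde Class1 l q \<longleftrightarrow> 1 / 2 * 1 * pd_v (pd_v (\<lambda>r. l r)) q - 2 * (- 1 / 4) * pd_u (pd_u (\<lambda>r. l r)) q =
    - substitution Class1 (l q) * substitution Class1 (l q) / (- substitution Class1 (l q) - substitution Class1
        (l q))" for l q
    by (auto simp: Lap_def field_simps)
  show "smooth_on D (\<lambda>p. - x p)" if "open D" "smooth_on D x" for D and x :: "real \<times> real \<Rightarrow> real"
    by (intro smooth_minus that)
  show "smooth_on D (\<lambda>p. ln (- x p))" if "open D" "smooth_on D x" "x ` D \<subseteq> {..<0}" for D and x :: "real \<times> real \<Rightarrow> real"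
    by (intro smooth_ln smooth_minus that) (use that in auto)
qed (auto intro!: derivative_eq_intros simp: field_simps power2_eq_square)

lemma class2_data:
  "class_data Class2 {..<1/2} (\<lambda>x y. y) (\<lambda>t. 1 - t) (\<lambda>t. -1) (\<lambda>t. t) (\<lambda>t. 1) (\<lambda>t. 1 - 2 * t) (\<lambda>x. - exp x / 2)
    (\<lambda>t. ln (1 - 2 * t)) (\<lambda>x. x) (\<lambda>x. 1) (\<lambda>x. x) (\<lambda>x. 1) (1 / 2) (- 1 / 2) 1 1"
proof
  have "substitution Class2 = (\<lambda>x. (1 - exp x) / 2)" by auto
  moreover have "(\<lambda>x :: real. - exp x / 2) differentiable (at x)" for x
    by (rule DERIV_real_differentiable) (rule derivative_eq_intros refl | simp)+
  ultimately show "(substitution Class2 has_real_derivative - exp x / 2) (at x) \<and> (\<lambda>x. - exp x / 2)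
      differentiable at x" for x
    by (auto intro!: derivative_eq_intros)
  show "class_pde Class2 l q \<longleftrightarrow> 1 * (1 / 2) * pd_v (pd_v (\<lambda>r. l r)) q - 1 * (- 1 / 2) * pd_u (pd_u (\<lambda>r. l r)) q =
    (1 - substitution Class2 (l q)) * substitution Class2 (l q) / (1 - substitution Class2 (l q) - substitution
        Class2 (l q))" for l q
  proof -
    have "(1 - substitution Class2 x) * substitution Class2 x / (1 - substitution Class2 x - substitution Class2
        x) = - sinh x / 2" for x
      by (simp add: sinh_def exp_minus field_simps)
    then show ?thesis by (auto simp: Lap_def)
  qed
  show "smooth_on D (\<lambda>p. 1 - 2 * x p)" if "open D" "smooth_on D x" for D and x :: "real \<times> real \<Rightarrow> real"
    by (intro smooth_diff smooth_mult smooth_const that)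
  show "smooth_on D (\<lambda>p. ln (1 - 2 * x p))" if "open D" "smooth_on D x" "x ` D \<subseteq> {..<1/2}" for D and x :: "real
      \<times> real \<Rightarrow> real"
    by (intro smooth_ln smooth_diff smooth_mult smooth_const that) (use that in force)
qed (auto intro!: derivative_eq_intros simp: field_simps power2_eq_square)

lemma class3_data:
  "class_data Class3 UNIV (\<lambda>x y. y) (\<lambda>t. t + 2) (\<lambda>t. 1) (\<lambda>t. t) (\<lambda>t. 1) exp (\<lambda>x. 1) (\<lambda>t. t)
    (\<lambda>x. inverse (exp x)) (\<lambda>x. - inverse (exp x)) exp exp (- 1) (1 / 4) 1 (1 / 4)"
proof
  have [simp]: "substitution Class3 = (\<lambda>x. x)" by auto
  show "substitution Class3 (l q) \<in> UNIV \<Longrightarrow> class_pde Class3 l q \<longleftrightarrow>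
    1 / 4 * - 1 * pd_v (pd_v (\<lambda>r. inverse (exp (l r)))) q - 1 * (1 / 4) * pd_u (pd_u (\<lambda>r. exp (l r))) q =
    (substitution Class3 (l q) + 2) * substitution Class3 (l q) / (substitution Class3 (l q) + 2 - substitution
        Class3 (l q))" for l q
    by (auto simp: Lap_star_def field_simps)
  show "smooth_on D (\<lambda>p. exp (x p))" if "open D" "smooth_on D x" for D and x :: "real \<times> real \<Rightarrow> real"
    by (intro smooth_exp that)
  show "(substitution Class3 has_real_derivative 1) (at x) \<and> (\<lambda>x :: real. 1 :: real) differentiable at x" for x
      by simp
qed (auto intro!: derivative_eq_intros simp: field_simps power2_eq_square)

text \<open>Dividing by \<open>t\<close> instead of its absolute value makes the formula uniform in
  the sign of \<open>t\<close>. Both signs occur: in classes 4 and 5, \<nu>2 = (\<beta> - 1) H' has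
  the sign of \<beta> - 1.\<close>

lemma DERIV_abs_powr:
  fixes t :: real assumes "t \<noteq> 0" shows "((\<lambda>t. \<bar>t\<bar> powr e) has_real_derivative e * \<bar>t\<bar> powr e / t) (at t)"
proof (cases "t > 0")
  case True
  have "((\<lambda>t. t powr e) has_real_derivative e * \<bar>t\<bar> powr e / t) (at t)"
    using True by (auto intro!: derivative_eq_intros simp: powr_diff)
  then show ?thesis by (rule has_field_derivative_transform_within_open[of _ _ _ "{0<..}"]) (use True in auto)
next
  case False
  have "((\<lambda>t. (- t) powr e) has_real_derivative e * \<bar>t\<bar> powr e / t) (at t)"
    using False assms by (auto intro!: derivative_eq_intros simp: powr_diff)
  then show ?thesis by (rule has_field_derivative_transform_within_open[of _ _ _ "{..<0}"]) (use False assms in auto)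
qed

text \<open>\<sigma> is the constant ratio \<nu>1 / \<nu>2 and \<open>sg\<close> the sign of \<nu>2.
  Since \<sigma> = (\<beta>^2 - 1) / (\<beta> - 1)^2, the ratio is positive exactly if \<beta>^2 >
  1. Its sign becomes the sign of the v-part of the operator and separates the two classes, which
  otherwise share all computations; B contains the absolute value of \<sigma> because it has to be
  positive.\<close>

lemma class45_data:
  assumes \<beta>: "\<beta> \<noteq> 0" "\<beta>\<^sup>2 \<noteq> 1"
  defines "c \<equiv> if \<beta>\<^sup>2 > 1 then Class4 \<beta> else Class5 \<beta>" and "\<sigma> \<equiv> (\<beta> + 1) / (\<beta> - 1)" and "sg \<equiv> sgn (\<beta> - 1)"
  shows "class_data c {t. sg * t > 0} (\<lambda>x y. y) (\<lambda>t. \<sigma> * t) (\<lambda>t. \<sigma>) (\<lambda>t. t) (\<lambda>t. 1) (\<lambda>t. \<bar>t\<bar> powr \<beta> * \<bar>t\<bar>) (\<lambda>x.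
      1) (\<lambda>t. t)
    (\<lambda>x. inverse (\<bar>x\<bar> powr \<beta>)) (\<lambda>x. - \<beta> / (\<bar>x\<bar> powr \<beta> * x)) (\<lambda>x. \<bar>x\<bar> powr \<beta>) (\<lambda>x. \<beta> * \<bar>x\<bar> powr \<beta> / x)
    (- \<sigma> * sg / \<beta>) (sg * (\<beta> - 1)\<^sup>2 / (4 * \<beta>)) 1 ((\<beta> - 1)\<^sup>2 / (4 * \<bar>\<sigma>\<bar>))"
proof -
  have \<beta>1: "\<beta> \<noteq> 1" "\<beta> \<noteq> - 1" using \<beta> by auto
  then have \<sigma>0: "\<sigma> \<noteq> 0" and sg0: "sg \<noteq> 0" "sg * sg = 1" "\<And>x. sg * (sg * x) = x" by (auto simp: \<sigma>_def sg_def sgn_if)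
  have abs: "\<bar>t\<bar> = sg * t" "t \<noteq> 0" if "sg * t > 0" for t
    using that by (auto simp: sg_def sgn_if split: if_splits)
  have \<sigma>t: "\<sigma> * t - t = 2 * t / (\<beta> - 1)" for t using \<beta>1 by (simp add: \<sigma>_def field_simps)
  have sub: "substitution c = (\<lambda>x. x)" by (auto simp: c_def)
  have e0: "\<bar>t\<bar> powr \<beta> > 0" if "sg * t > 0" for t using abs(2)[OF that] by simp
  have d: "2 * t / (\<beta> - 1) > 0" if "sg * t > 0" for t
    using that \<beta>1 by (auto simp: sg_def sgn_if zero_less_divide_iff split: if_splits)
  show ?thesis unfolding sub class_data_def
  proof (intro conjI allI impI; (elim CollectE)?)
    show "smooth_on D (\<lambda>p. \<bar>x p\<bar> powr \<beta> * \<bar>x p\<bar>)" if "open D" "smooth_on D x" "x ` D \<subseteq> {t. sg * t > 0}" for D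
        and x :: "real \<times> real \<Rightarrow> real"
    proof (rule smooth_on_cong[of D "\<lambda>p. (sg * x p) powr \<beta> * (sg * x p)"])
      show "smooth_on D (\<lambda>p. (sg * x p) powr \<beta> * (sg * x p))"
        by (intro smooth_mult smooth_powr smooth_const that) (use that in auto)
    qed (use that abs in auto)
    show "open {t. sg * t > 0}" by (intro open_Collect_less continuous_intros)
    show "y \<in> {t. sg * t > 0}" "\<sigma> * y = x"
      if "y < x" "curvature_relation c (x * y) ((x + y) / 2) ((x - y) / 2)" for x y
    proof -
      have eq: "(x + y) = \<beta> * (x - y)" using that(2) by (auto simp: c_def split: if_splits)
      then have y: "y = (\<beta> - 1) * ((x - y) / 2)" by (simp add: field_simps)
      then have "\<sigma> * y = (\<beta> + 1) * ((x - y) / 2)" using \<beta>1 unfolding \<sigma>_def by (metis eq_iff_diff_eq_0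
          nonzero_eq_divide_eq times_divide_eq_left mult.assoc mult.commute)
      then show "\<sigma> * y = x" using eq by (simp add: field_simps)
      have "sg * ((\<beta> - 1) * ((x - y) / 2)) > 0" using that(1) \<beta>1 by (auto simp: sg_def sgn_if mult_pos_pos
          mult_neg_pos)
      then have "sg * y > 0" using y by metis
      then show "y \<in> {t. sg * t > 0}" by simp
    qed
    fix t assume t: "sg * t > 0"
    note ds = DERIV_abs_powr[OF abs(2)[OF t]]
    have da: "((\<lambda>t. \<bar>t\<bar>) has_real_derivative sg) (at t)"
      by (rule has_field_derivative_transform_within_open[of "\<lambda>t. sg * t" _ _ "{t. sg * t > 0}"])
         (use t abs in \<open>auto intro!: derivative_eq_intros open_Collect_less continuous_intros\<close>)
    show "((\<lambda>t. \<bar>t\<bar> powr \<beta> * \<bar>t\<bar>) has_real_derivative 2 * \<sigma> / (\<sigma> * t - t) * (\<bar>t\<bar> powr \<beta> * \<bar>t\<bar>)) (at t)"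
      unfolding \<sigma>t by (rule DERIV_cong[OF DERIV_mult[OF ds da]]) (use abs[OF t] \<beta>1 sg0(1) in \<open>simp add: \<sigma>_def
          field_simps\<close>)
    show "t < \<sigma> * t" using d[OF t] \<sigma>t[of t] by simp
    show "((\<lambda>t. \<bar>t\<bar> powr \<beta>) has_real_derivative \<beta> * \<bar>t\<bar> powr \<beta> / t) (at t)" by (rule ds)
    show "((\<lambda>t. inverse (\<bar>t\<bar> powr \<beta>)) has_real_derivative - \<beta> / (\<bar>t\<bar> powr \<beta> * t)) (at t)"
      by (rule DERIV_cong[OF DERIV_inverse'[OF ds]]) (use e0[OF t] abs[OF t] in \<open>simp_all add: field_simps\<close>)
    show "\<sigma> * 1 = - \<sigma> * sg / \<beta> * (- \<beta> / (\<bar>t\<bar> powr \<beta> * t)) * (\<bar>t\<bar> powr \<beta> * \<bar>t\<bar>)"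
      using e0[OF t] abs[OF t] \<beta> sg0 by (simp add: field_simps)
    show "1 * 1 * (\<bar>t\<bar> powr \<beta> * \<bar>t\<bar>) = sg * (\<beta> - 1)\<^sup>2 / (4 * \<beta>) * (\<beta> * \<bar>t\<bar> powr \<beta> / t) * (\<sigma> * t - t)\<^sup>2"
    proof -
      have "1 * 1 * (e * (sg * t)) = sg * b / (4 * \<beta>) * (\<beta> * e / t) * (4 * t\<^sup>2 / b)" if "b \<noteq> 0" for b e
        using that abs(2)[OF t] \<beta> by (simp add: field_simps power2_eq_square)
      from this[of "(\<beta> - 1)\<^sup>2" "\<bar>t\<bar> powr \<beta>"] show ?thesis
        unfolding \<sigma>t power_divide power_mult_distrib using abs(1)[OF t] \<beta>1 by simp
    qed
    show "0 < \<bar>t\<bar> powr \<beta> * \<bar>t\<bar>" using e0[OF t] abs[OF t] by simp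
  next
    fix l :: "real \<times> real \<Rightarrow> real" and q
    assume t: "sg * l q > 0"
    let ?M = "pd_v (pd_v (\<lambda>r. inverse (\<bar>l r\<bar> powr \<beta>))) q" and ?N = "pd_u (pd_u (\<lambda>r. \<bar>l r\<bar> powr \<beta>)) q"
    have s\<sigma>: "\<sigma> / \<bar>\<sigma>\<bar> = (if \<beta>\<^sup>2 > 1 then 1 else - 1)"
    proof -
      have "\<sigma> = (\<beta>\<^sup>2 - 1) / (\<beta> - 1)\<^sup>2" using \<beta>1 by (simp add: \<sigma>_def power2_eq_square divide_simps) (simp add:
          algebra_simps)
      moreover have "(\<beta> - 1)\<^sup>2 > 0" using \<beta>1 by simp
      ultimately have "sgn \<sigma> = sgn (\<beta>\<^sup>2 - 1)" by (simp add: sgn_if zero_less_divide_iff del: zero_less_power2)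
      then show ?thesis using \<beta> by (auto simp: sgn_if divide_real_def abs_if split: if_splits)
    qed
    have a: "(\<beta> - 1)\<^sup>2 / (4 * \<bar>\<sigma>\<bar>) * (- \<sigma> * sg / \<beta>) = - sg * (\<beta> - 1)\<^sup>2 / (4 * \<beta>) * (\<sigma> / \<bar>\<sigma>\<bar>)" by (simp add:
        mult.commute mult.left_commute)
    have b: "\<sigma> * l q * l q / (\<sigma> * l q - l q) = sg * ((\<beta> + 1) * \<bar>l q\<bar> / 2)"
      unfolding \<sigma>t using abs[OF t] \<beta>1 sg0(1) by (simp add: \<sigma>_def field_simps sg0(3))
    have "- sg * b / (4 * \<beta>) * e * X - 1 * (sg * b / (4 * \<beta>)) * Y = sg * (- (b / (4 * \<beta>)) * (Y + e * X))" for b e X Y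
      by (simp add: algebra_simps add_divide_distrib)
    then have "(\<beta> - 1)\<^sup>2 / (4 * \<bar>\<sigma>\<bar>) * (- \<sigma> * sg / \<beta>) * ?M - 1 * (sg * (\<beta> - 1)\<^sup>2 / (4 * \<beta>)) * ?N = \<sigma> * l q * l q
        / (\<sigma> * l q - l q)
      \<longleftrightarrow> sg * (- ((\<beta> - 1)\<^sup>2 / (4 * \<beta>)) * (?N + (if \<beta>\<^sup>2 > 1 then 1 else - 1) * ?M)) = sg * ((\<beta> + 1) * \<bar>l q\<bar> / 2)"
      unfolding a b s\<sigma> by (simp only:)
    also have "\<dots> \<longleftrightarrow> ?N + (if \<beta>\<^sup>2 > 1 then 1 else - 1) * ?M = - 2 * (\<beta> * (\<beta> + 1) / (\<beta> - 1)\<^sup>2) * \<bar>l q\<bar>"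
    proof -
      have "- (b / (4 * \<beta>)) * X = (\<beta> + 1) * y / 2 \<longleftrightarrow> X = - 2 * (\<beta> * (\<beta> + 1) / b) * y" if "b \<noteq> 0" for b X y
        using that \<beta>(1) by (auto simp: field_simps)
      note cancel = this
      have nz: "(\<beta> - 1)\<^sup>2 \<noteq> 0" using \<beta>1 by simp
      show ?thesis unfolding mult_cancel_left cancel[OF nz] using sg0(1) by simp
    qed
    also have "\<dots> \<longleftrightarrow> class_pde c l q" by (simp add: c_def Lap_star_def Lap_bar_star_def)
    finally show "class_pde c l q \<longleftrightarrow> (\<beta> - 1)\<^sup>2 / (4 * \<bar>\<sigma>\<bar>) * (- \<sigma> * sg / \<beta>) * ?M - 1 * (sg * (\<beta> - 1)\<^sup>2 / (4 * \<beta>))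
        * ?N = \<sigma> * l q * l q / (\<sigma> * l q - l q)" ..
  qed (use \<sigma>0 sg0 \<beta> \<beta>1 in \<open>auto simp: c_def\<close>)
qed

text \<open>The relation reads 2 (\<nu>2 - 1) = (\<beta> - 1) (\<nu>1 - \<nu>2), so L(\<nu>2) =
  \<nu>1 - \<nu>2 is at once the gap and the listed \<lambda>, and its positivity describes the
  domain. \<sigma> is now the slope of \<nu>1 as a function of \<nu>2, and its sign again separates
  the two operators.\<close>

lemma class67_data:
  assumes \<beta>: "\<beta> \<noteq> 0" "\<beta>\<^sup>2 \<noteq> 1"
  defines "c \<equiv> if \<beta>\<^sup>2 > 1 then Class6 \<beta> else Class7 \<beta>" and "\<sigma> \<equiv> (\<beta> + 1) / (\<beta> - 1)" and "L \<equiv> \<lambda>t. 2 * (t - 1) / (\<beta> - 1)"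
  shows "class_data c {t. L t > 0} (\<lambda>x y. y) (\<lambda>t. t + L t) (\<lambda>t. \<sigma>) (\<lambda>t. t) (\<lambda>t. 1) (\<lambda>t. L t powr \<beta> * L t) (\<lambda>x.
      (\<beta> - 1) / 2) L
    (\<lambda>x. inverse (x powr \<beta>)) (\<lambda>x. - \<beta> / (x powr \<beta> * x)) (\<lambda>x. x powr \<beta>) (\<lambda>x. \<beta> * x powr \<beta> / x)
    (- (\<beta> + 1) / (2 * \<beta>)) ((\<beta> - 1) / (2 * \<beta>)) 1 (1 / \<bar>\<sigma>\<bar>)"
proof -
  have \<beta>1: "\<beta> \<noteq> 1" "\<beta> \<noteq> - 1" using \<beta> by auto
  then have \<sigma>0: "\<sigma> \<noteq> 0" by (auto simp: \<sigma>_def)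
  have \<beta>1': "\<beta> - 1 \<noteq> 0" "\<beta> + 1 \<noteq> 0" using \<beta>1 by auto
  have sub: "substitution c = (\<lambda>x. ((\<beta> - 1) * x + 2) / 2)" by (auto simp: c_def)
  have Ls: "L (((\<beta> - 1) * x + 2) / 2) = x" for x using \<beta>1 by (simp add: L_def field_simps)
  have sL: "((\<beta> - 1) * L x + 2) / 2 = x" for x using \<beta>1 by (simp add: L_def)
  have dL: "(L has_real_derivative 2 / (\<beta> - 1)) (at t)" for t
  proof -
    have "((\<lambda>t. 2 * (t - 1)) has_real_derivative 2) (at t)" by (auto intro!: derivative_eq_intros)
    from DERIV_cdivide[OF this, of "\<beta> - 1"] show ?thesis by (simp add: L_def)
  qed
  have dp: "((\<lambda>t. t powr \<beta>) has_real_derivative \<beta> * t powr \<beta> / t) (at t)" if "t > 0" for t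
    using that by (auto intro!: derivative_eq_intros simp: powr_diff)
  show ?thesis unfolding sub class_data_def
  proof (intro conjI allI impI; (elim CollectE)?; (unfold Ls)?)
    show "open {t. L t > 0}" unfolding L_def by (intro open_Collect_less continuous_intros) (use \<beta>1' in simp)
    show "y \<in> {t. L t > 0}" "y + L y = x"
      if "y < x" "curvature_relation c (x * y) ((x + y) / 2) ((x - y) / 2)" for x y
    proof -
      have "(x + y) / 2 = \<beta> * ((x - y) / 2) + 1" using that(2) by (auto simp: c_def split: if_splits)
      then have "2 * (y - 1) = (x - y) * (\<beta> - 1)" by (simp add: field_simps)
      then have "L y = x - y" using \<beta>1 by (simp add: L_def)
      then show "y \<in> {t. L t > 0}" "y + L y = x" using that(1) by auto
    qed
    show "smooth_on D (\<lambda>p. L (x p) powr \<beta> * L (x p))" if "open D" "smooth_on D x" "x ` D \<subseteq> {t. L t > 0}" for D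
        and x :: "real \<times> real \<Rightarrow> real"
    proof -
      have "smooth_on D (\<lambda>p. L (x p))"
        unfolding L_def by (intro smooth_divide smooth_mult smooth_diff smooth_const that \<beta>1')
      then show ?thesis by (intro smooth_mult smooth_powr that) (use that in auto)
    qed
    show "smooth_on D (\<lambda>p. L (x p))" if "open D" "smooth_on D x" for D and x :: "real \<times> real \<Rightarrow> real"
      unfolding L_def by (intro smooth_divide smooth_mult smooth_diff smooth_const that \<beta>1')
    show "((\<beta> - 1) * L x + 2) / 2 = x" for x by (rule sL)
  next
    fix t assume t: "L t > 0"
    show "((\<lambda>t. L t powr \<beta> * L t) has_real_derivative 2 * \<sigma> / (t + L t - t) * (L t powr \<beta> * L t)) (at t)"
    proof -
      have "2 * \<sigma> / (t + L t - t) * (L t powr \<beta> * L t) = (\<beta> + 1) * (2 / (\<beta> - 1)) / L t * (L t powr \<beta> * L t)"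
        by (simp add: \<sigma>_def)
      moreover have "\<beta> * e / x * d * x + d * e = (\<beta> + 1) * d / x * (e * x)" if "x \<noteq> 0" for x d e :: real
        using that by (simp add: field_simps)
      note g = this
      have nz: "L t \<noteq> 0" using t by simp
      have "\<beta> * L t powr \<beta> / L t * (2 / (\<beta> - 1)) * L t + 2 / (\<beta> - 1) * L t powr \<beta> =
        (\<beta> + 1) * (2 / (\<beta> - 1)) / L t * (L t powr \<beta> * L t)" by (rule g[OF nz])
      ultimately show ?thesis using DERIV_mult[OF DERIV_chain2[OF dp[OF t] dL] dL] by metis
    qed
    show "t < t + L t" using t by simp
    show "0 < L t powr \<beta> * L t" using t by simp
    show "((\<lambda>t. t + L t) has_real_derivative \<sigma>) (at t)"
      using \<beta>1 by (auto intro!: derivative_eq_intros dL simp: \<sigma>_def field_simps)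
  next
    fix x :: real assume x: "x > 0"
    show "((\<lambda>x. x powr \<beta>) has_real_derivative \<beta> * x powr \<beta> / x) (at x)" by (rule dp[OF x])
    show "((\<lambda>t. inverse (t powr \<beta>)) has_real_derivative - \<beta> / (x powr \<beta> * x)) (at x)"
      by (rule DERIV_cong[OF DERIV_inverse'[OF dp[OF x]]]) (use x in \<open>simp_all add: field_simps\<close>)
    show "\<sigma> * ((\<beta> - 1) / 2) = - (\<beta> + 1) / (2 * \<beta>) * (- \<beta> / (x powr \<beta> * x)) * (x powr \<beta> * x)"
      using x \<beta> \<beta>1 by (simp add: \<sigma>_def field_simps)
    show "1 * ((\<beta> - 1) / 2) * (x powr \<beta> * x) = (\<beta> - 1) / (2 * \<beta>) * (\<beta> * x powr \<beta> / x) * (((\<beta> - 1) * x + 2) / 2 +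
        x - ((\<beta> - 1) * x + 2) / 2)\<^sup>2"
      using x \<beta> by (simp add: power2_eq_square)
  next
    fix l :: "real \<times> real \<Rightarrow> real" and q
    assume t: "l q > 0"
    let ?M = "pd_v (pd_v (\<lambda>r. inverse (l r powr \<beta>))) q" and ?N = "pd_u (pd_u (\<lambda>r. l r powr \<beta>)) q" and ?s = "((\<beta>
        - 1) * l q + 2) / 2"
    have s\<sigma>: "1 / \<bar>\<sigma>\<bar> * (\<beta> + 1) = (\<beta> - 1) * (if \<beta>\<^sup>2 > 1 then 1 else - 1)"
    proof -
      have "\<sigma> = (\<beta>\<^sup>2 - 1) / (\<beta> - 1)\<^sup>2" using \<beta>1 by (simp add: \<sigma>_def power2_eq_square divide_simps) (simp add:
          algebra_simps)
      moreover have "(\<beta> - 1)\<^sup>2 > 0" using \<beta>1 by simp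
      ultimately have "sgn \<sigma> = sgn (\<beta>\<^sup>2 - 1)" by (simp add: sgn_if zero_less_divide_iff del: zero_less_power2)
      then have "\<bar>\<sigma>\<bar> = \<sigma> * (if \<beta>\<^sup>2 > 1 then 1 else - 1)" using \<beta> by (auto simp: sgn_if abs_if split: if_splits)
      then show ?thesis using \<beta>1' by (simp add: \<sigma>_def)
    qed
    have rhs: "(?s + l q) * ?s / (?s + l q - ?s) = ((\<beta> - 1) * l q + 2) * ((\<beta> + 1) * l q + 2) / (4 * l q)"
    proof -
      have "?s + l q = ((\<beta> + 1) * l q + 2) / 2" by (simp add: field_simps)
      moreover have "?s + l q - ?s = l q" by simp
      ultimately show ?thesis by (simp only:) simp
    qed
    have "x * (- p / (2 * \<beta>)) * X - 1 * (r / (2 * \<beta>)) * Y = - (x * p) / (2 * \<beta>) * X - r / (2 * \<beta>) * Y" for x p r X Y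
      by simp
    then have "1 / \<bar>\<sigma>\<bar> * (- (\<beta> + 1) / (2 * \<beta>)) * ?M - 1 * ((\<beta> - 1) / (2 * \<beta>)) * ?N =
      - (1 / \<bar>\<sigma>\<bar> * (\<beta> + 1)) / (2 * \<beta>) * ?M - (\<beta> - 1) / (2 * \<beta>) * ?N" .
    also have "\<dots> = - ((\<beta> - 1) / (2 * \<beta>)) * (?N + (if \<beta>\<^sup>2 > 1 then 1 else - 1) * ?M)"
    proof -
      have "- (r * e) / (2 * \<beta>) * X - r / (2 * \<beta>) * Y = - (r / (2 * \<beta>)) * (Y + e * X)" for r e X Y
        by (simp add: algebra_simps add_divide_distrib)
      then show ?thesis unfolding s\<sigma> .
    qed
    finally have "1 / \<bar>\<sigma>\<bar> * (- (\<beta> + 1) / (2 * \<beta>)) * ?M - 1 * ((\<beta> - 1) / (2 * \<beta>)) * ?N = (?s + l q) * ?s / (?s +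
        l q - ?s)
      \<longleftrightarrow> - ((\<beta> - 1) / (2 * \<beta>)) * (?N + (if \<beta>\<^sup>2 > 1 then 1 else - 1) * ?M) = ((\<beta> - 1) * l q + 2) * ((\<beta> + 1) * l q
          + 2) / (4 * l q)"
      unfolding rhs by simp
    also have "\<dots> \<longleftrightarrow> ?N + (if \<beta>\<^sup>2 > 1 then 1 else - 1) * ?M = - (\<beta> * ((\<beta> - 1) * l q + 2) * ((\<beta> + 1) * l q + 2) /
        (2 * (\<beta> - 1) * l q))"
    proof -
      have "- (r / (2 * \<beta>)) * X = a * b / (4 * y) \<longleftrightarrow> X = - (\<beta> * a * b / (2 * r * y))" if "r \<noteq> 0" "y \<noteq> 0" for r X a b y
        using that \<beta>(1) by (auto simp: field_simps)
      from this[of "\<beta> - 1" "l q"] show ?thesis using t \<beta>1 by simp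
    qed
    also have "\<dots> \<longleftrightarrow> class_pde c l q" by (simp add: c_def Lap_star_def Lap_bar_star_def)
    finally show "class_pde c l q \<longleftrightarrow> 1 / \<bar>\<sigma>\<bar> * (- (\<beta> + 1) / (2 * \<beta>)) * ?M - 1 * ((\<beta> - 1) / (2 * \<beta>)) * ?N = (?s +
        l q) * ?s / (?s + l q - ?s)" ..
  qed (use \<sigma>0 \<beta> \<beta>1 \<beta>1' sL in \<open>auto simp: c_def intro!: derivative_eq_intros\<close>)
qed

text \<open>A product -1 with \<nu>1 > \<nu>2 forces \<nu>1 > 0, and \<open>2 * arctan t\<close>
  selects the branch of \<lambda> between 0 and pi. The right-hand side of the PDE is - t / (1 +
  t^2) = - sin \<lambda> / 2.\<close>

lemma class8_data:
  "class_data Class8 {0<..} (\<lambda>x y. x) (\<lambda>t. t) (\<lambda>t. 1) (\<lambda>t. - 1 / t) (\<lambda>t. 1 / t\<^sup>2) (\<lambda>t. 1 + t\<^sup>2) (\<lambda>x. (1 + (tan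
      (x / 2))\<^sup>2) / 2)
    (\<lambda>t. 2 * arctan t) (\<lambda>x. x) (\<lambda>x. 1) (\<lambda>x. x) (\<lambda>x. 1) (1 / 2) (1 / 2) 1 1"
  unfolding class_data_def
proof (intro conjI allI impI)
  \<comment> \<open>Division by zero being zero, the tangent is 0 at its poles; a positive value
    therefore excludes them.\<close>
  have cs: "cos (x / 2) \<noteq> 0" if "tan (x / 2) > 0" for x :: real using that by (auto simp: tan_def)
  have dt: "((\<lambda>x. tan (x / 2)) has_real_derivative (1 + (tan (x / 2))\<^sup>2) / 2) (at x)" if "tan (x / 2) > 0" for x
      :: real
    using cs[OF that] by (auto intro!: derivative_eq_intros simp: tan_sec power_inverse)
  have [simp]: "substitution Class8 = (\<lambda>x. tan (x / 2))" by auto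
  show "(substitution Class8 has_real_derivative (1 + (tan (x / 2))\<^sup>2) / 2) (at x)" if "substitution Class8 x \<in>
      {0<..}" for x
    using dt that by simp
  show "(\<lambda>x. (1 + (tan (x / 2))\<^sup>2) / 2) differentiable at x" if "substitution Class8 x \<in> {0<..}" for x :: real
    using DERIV_cdivide[OF DERIV_add[OF DERIV_const[of 1] DERIV_power[OF dt[of x], of 2]], of 2] that
    by (auto simp: real_differentiable_def)
  have pos: "1 + t * t > 0" for t :: real by (smt (verit) zero_le_square)
  show "((\<lambda>t. 1 + t\<^sup>2) has_real_derivative 2 * 1 / (t - - 1 / t) * (1 + t\<^sup>2)) (at t)" if "t \<in> {0<..}" for t :: real
  proof -
    have "t - - 1 / t = (1 + t\<^sup>2) / t" using that by (simp add: field_simps power2_eq_square)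
    then show ?thesis using that pos[of t] by (auto intro!: derivative_eq_intros simp: power2_eq_square)
  qed
  show "1 / (substitution Class8 x)\<^sup>2 * ((1 + (tan (x / 2))\<^sup>2) / 2) * (1 + (substitution Class8 x)\<^sup>2) =
     1 / 2 * 1 * (substitution Class8 x - - 1 / substitution Class8 x)\<^sup>2" if "substitution Class8 x \<in> {0<..}" for x
  proof -
    have "1 / t\<^sup>2 * ((1 + t\<^sup>2) / 2) * (1 + t\<^sup>2) = 1 / 2 * 1 * (t - - 1 / t)\<^sup>2" if "t > 0" for t :: real
      using that by (simp add: field_simps power2_eq_square)
    from this[of "tan (x / 2)"] show ?thesis using that by simp
  qed
  show "class_pde Class8 l q \<longleftrightarrow> 1 * (1 / 2) * pd_v (pd_v (\<lambda>r. l r)) q - 1 * (1 / 2) * pd_u (pd_u (\<lambda>r. l r)) q =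
    substitution Class8 (l q) * (- 1 / substitution Class8 (l q)) / (substitution Class8 (l q) - - 1 /
        substitution Class8 (l q))"
    if "substitution Class8 (l q) \<in> {0<..}" for l :: "real \<times> real \<Rightarrow> real" and q
  proof -
    let ?t = "tan (l q / 2)"
    have t: "?t > 0" using that by simp
    have a: "?t - - 1 / ?t = (1 + ?t\<^sup>2) / ?t" using t by (simp add: field_simps power2_eq_square)
    have b: "sin (l q) = 2 * (?t / (1 + ?t\<^sup>2))"
    proof -
      have c: "1 + ?t\<^sup>2 = 1 / (cos (l q / 2) * cos (l q / 2))"
        using tan_sec[OF cs[OF t]] by (metis inverse_eq_divide power_inverse power2_eq_square)
      have "sin (l q) = 2 * sin (l q / 2) * cos (l q / 2)" using sin_double[of "l q / 2"] by simp
      then show ?thesis using cs[OF t] unfolding c by (simp add: tan_def)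
    qed
    have "?t * (- 1 / ?t) / (?t - - 1 / ?t) = - sin (l q) / 2"
    proof -
      have "t * (- 1 / t) / (T / t) = - (2 * (t / T)) / 2" if "t > 0" for t T :: real using that by simp
      from this[OF t] show ?thesis unfolding a b .
    qed
    then show ?thesis by (auto simp: Lap_bar_def)
  qed
  show "smooth_on D (\<lambda>p. 1 + (x p)\<^sup>2)" if "open D" "smooth_on D x" for D and x :: "real \<times> real \<Rightarrow> real"
    unfolding power2_eq_square by (intro smooth_add smooth_mult smooth_const that)
  show "smooth_on D (\<lambda>p. 2 * arctan (x p))" if "open D" "smooth_on D x" for D and x :: "real \<times> real \<Rightarrow> real"
    by (intro smooth_arctan smooth_mult smooth_const that)
  show "1 / t\<^sup>2 \<noteq> 0" if "t \<in> {0<..}" for t :: real using that by simp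
  show "- 1 / t < t" if "t \<in> {0<..}" for t :: real using that pos[of t] by (simp add: field_simps)
  show "(\<lambda>t. 1 / t\<^sup>2) differentiable at t" if "t \<in> {0<..}" for t :: real
    using that by (auto intro!: derivative_intros)
  show "x \<in> {0<..}" "- 1 / x = y" if "y < x" "curvature_relation Class8 (x * y) ((x + y) / 2) ((x - y) / 2)" for
      x y :: real
  proof -
    have 1: "x * y = - 1" using that by simp
    then show "x \<in> {0<..}" using that(1) by (auto simp: mult_le_0_iff dest!: arg_cong[of _ _ "\<lambda>t. t \<ge> 0"]) (smt
        (verit) mult_nonneg_nonneg mult_nonpos_nonpos)
    then show "- 1 / x = y" using 1 by (simp add: field_simps)
  qed
  show "0 < 1 + t\<^sup>2" for t :: real using pos[of t] by (simp add: power2_eq_square)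
qed (auto intro!: derivative_eq_intros simp: power2_eq_square tan_arctan)

text \<open>The relation is (\<nu>1 + 1) \<nu>2 = \<nu>1; in t = \<nu>1 + 1 it becomes \<nu>2 = 1 -
  1 / t with gap (t - 1)^2 / t, and the domain is where the gap is positive. As \<Phi>' / \<Phi> = 2
  / (t - 1) + 2 / (t - 1)^2, an exponential appears in \<Phi>; its exponent, with the constant 2
  added, is the listed \<lambda>.\<close>

lemma class9_data:
  "class_data Class9 ({0<..} - {1}) (\<lambda>x y. x + 1) (\<lambda>t. t - 1) (\<lambda>t. 1) (\<lambda>t. 1 - 1 / t) (\<lambda>t. 1 / t\<^sup>2)
    (\<lambda>t. (t - 1)\<^sup>2 * exp (2 - 2 / (t - 1))) (\<lambda>x. 2 / (x - 2)\<^sup>2) (\<lambda>t. 2 - 2 / (t - 1))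
    (\<lambda>x. inverse (exp x)) (\<lambda>x. - inverse (exp x)) exp exp (- 1 / 2) (1 / 2) 1 1"
  unfolding class_data_def
proof (intro conjI allI impI)
  have s: "x \<noteq> 2" "(x - 4) / (x - 2) - 1 = - 2 / (x - 2)" "(x - 4) / (x - 2) > 0" "x \<noteq> 4"
    if "substitution Class9 x \<in> {0<..} - {1}" for x
    using that by (auto simp: divide_simps split: if_splits)
  show "(substitution Class9 has_real_derivative 2 / (x - 2)\<^sup>2) (at x)" if "substitution Class9 x \<in> {0<..} -
      {1}" for x
  proof -
    have "((\<lambda>x. (x - 4) / (x - 2)) has_real_derivative 2 / (x - 2)\<^sup>2) (at x)"
      using s[OF that] by (auto intro!: derivative_eq_intros simp: power2_eq_square)
    moreover have "substitution Class9 = (\<lambda>x. (x - 4) / (x - 2))" by auto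
    ultimately show ?thesis by simp
  qed
  show "(\<lambda>x. 2 / (x - 2)\<^sup>2) differentiable at x" if "substitution Class9 x \<in> {0<..} - {1}" for x
    using s[OF that] by (auto intro!: derivative_intros)
  have d: "t - 1 - (1 - 1 / t) = (t - 1)\<^sup>2 / t" if "t \<in> {0<..} - {1}" for t :: real
    using that by (auto simp: field_simps power2_eq_square)
  show "((\<lambda>t. (t - 1)\<^sup>2 * exp (2 - 2 / (t - 1))) has_real_derivative
    2 * 1 / (t - 1 - (1 - 1 / t)) * ((t - 1)\<^sup>2 * exp (2 - 2 / (t - 1)))) (at t)" if "t \<in> {0<..} - {1}" for t :: real
  proof -
    have t: "t \<noteq> 0" "(t - 1)\<^sup>2 \<noteq> 0" using that by auto
    have d1: "((\<lambda>t. 2 - 2 / (t - 1)) has_real_derivative 2 / (t - 1)\<^sup>2) (at t)"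
      using that by (auto intro!: derivative_eq_intros simp: power2_eq_square)
    have d2: "((\<lambda>t. (t - 1)\<^sup>2) has_real_derivative 2 * (t - 1)) (at t)" by (auto intro!: derivative_eq_intros)
    have "2 * 1 / (u / t) * (u * e) = 2 * (t - 1) * e + e * (2 / u) * u" if "u \<noteq> 0" for u e :: real
      using that t by (simp add: field_simps)
    from DERIV_mult[OF d2 DERIV_chain2[OF DERIV_exp d1]] this[OF t(2)] show ?thesis
      unfolding d[OF that] by simp
  qed
  show "0 < (t - 1)\<^sup>2 * exp (2 - 2 / (t - 1))" if "t \<in> {0<..} - {1}" for t :: real using that by auto
  show "1 - 1 / t < t - 1" if "t \<in> {0<..} - {1}" for t :: real
  proof -
    have "(t - 1)\<^sup>2 / t > 0" using that by auto
    then show ?thesis unfolding d[OF that, symmetric] by simp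
  qed
  have Ph: "(substitution Class9 x - 1)\<^sup>2 * exp (2 - 2 / (substitution Class9 x - 1)) = 4 / (x - 2)\<^sup>2 * exp x"
    if "substitution Class9 x \<in> {0<..} - {1}" for x
  proof -
    have "2 - 2 / (- 2 / (x - 2)) = x" using s(1)[OF that] by (simp add: field_simps)
    then show ?thesis unfolding substitution.simps s(2)[OF that] by (simp add: power_divide)
  qed
  show "1 * (2 / (x - 2)\<^sup>2) = - 1 / 2 * - inverse (exp x) * ((substitution Class9 x - 1)\<^sup>2 * exp (2 - 2 /
      (substitution Class9 x - 1)))"
    if "substitution Class9 x \<in> {0<..} - {1}" for x
    unfolding Ph[OF that] by simp
  show "1 / (substitution Class9 x)\<^sup>2 * (2 / (x - 2)\<^sup>2) * ((substitution Class9 x - 1)\<^sup>2 * exp (2 - 2 /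
      (substitution Class9 x - 1)))
     = 1 / 2 * exp x * (substitution Class9 x - 1 - (1 - 1 / substitution Class9 x))\<^sup>2"
    if "substitution Class9 x \<in> {0<..} - {1}" for x
  proof -
    have "1 / t\<^sup>2 * (2 / u\<^sup>2) * (4 / u\<^sup>2 * e) = 1 / 2 * e * ((- 2 / u)\<^sup>2 / t)\<^sup>2" for t u e :: real
      by (cases "u = 0"; cases "t = 0"; simp add: field_simps power2_eq_square)
    then show ?thesis unfolding Ph[OF that] unfolding d[OF that] unfolding substitution.simps s(2)[OF that] by blast
  qed
  show "class_pde Class9 l q \<longleftrightarrow> 1 * (- 1 / 2) * pd_v (pd_v (\<lambda>r. inverse (exp (l r)))) q - 1 * (1 / 2) * pd_u
      (pd_u (\<lambda>r. exp (l r))) q =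
    (substitution Class9 (l q) - 1) * (1 - 1 / substitution Class9 (l q)) / (substitution Class9 (l q) - 1 - (1
        - 1 / substitution Class9 (l q)))"
    if "substitution Class9 (l q) \<in> {0<..} - {1}" for l :: "real \<times> real \<Rightarrow> real" and q
  proof -
    have "(t - 1) * (1 - 1 / t) / (t - 1 - (1 - 1 / t)) = 1" if "t \<in> {0<..} - {1}" for t :: real
    proof -
      have "(t - 1) * (1 - 1 / t) = (t - 1)\<^sup>2 / t" using that by (auto simp: field_simps power2_eq_square)
      then show ?thesis unfolding d[OF that] using that by simp
    qed
    from this[OF that] show ?thesis by (auto simp: Lap_star_def)
  qed
  show "smooth_on D (\<lambda>p. (x p - 1)\<^sup>2 * exp (2 - 2 / (x p - 1)))" if "open D" "smooth_on D x" "x ` D \<subseteq> {0<..} -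
      {1}" for D and x :: "real \<times> real \<Rightarrow> real"
    unfolding power2_eq_square by (intro smooth_mult smooth_exp smooth_diff smooth_divide smooth_const that)
        (use that in force)
  show "smooth_on D (\<lambda>p. 2 - 2 / (x p - 1))" if "open D" "smooth_on D x" "x ` D \<subseteq> {0<..} - {1}" for D and x ::
      "real \<times> real \<Rightarrow> real"
    by (intro smooth_diff smooth_divide smooth_const that) (use that in force)
  show "x + 1 \<in> {0<..} - {1}" "1 - 1 / (x + 1) = y" if "y < x" "curvature_relation Class9 (x * y) ((x + y) / 2)
      ((x - y) / 2)" for x y :: real
  proof -
    have 1: "x * y = x - y" using that by (simp add: field_simps)
    then have 2: "(x + 1) * y = x" by (simp add: field_simps)
    have 3: "x + 1 \<noteq> 0" using 2 by auto
    have "x \<noteq> 0" using 1 that(1) by auto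
    moreover have "x * x / (x + 1) = x - y" using 2 3 by (simp add: field_simps)
    then have "x * x / (x + 1) > 0" using that(1) by simp
    ultimately show "x + 1 \<in> {0<..} - {1}" by (auto simp: zero_less_divide_iff mult_less_0_iff)
    show "1 - 1 / (x + 1) = y" using 2 3 by (simp add: field_simps)
  qed
  show "(\<lambda>t. 1 / t\<^sup>2) differentiable at t" if "t \<in> {0<..} - {1}" for t :: real
    using that by (auto intro!: derivative_intros)
  show "smooth_on D (\<lambda>p. x p + 1)" if "open D" "smooth_on D x" for D and x :: "real \<times> real \<Rightarrow> real"
    by (intro smooth_add smooth_const that)
  show "substitution Class9 (2 - 2 / (t - 1)) = t" if "t \<in> {0<..} - {1}" for t
    using that by (auto simp: field_simps)
qed (auto intro!: derivative_eq_intros simp: power2_eq_square)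

text \<open>Solved for \<nu>2, the relation gives \<beta> / 2 - \<kappa> / t with t = \<nu>1 +
  \<beta> / 2, where \<kappa> > 0 because \<gamma> < 0. With x = t - \<beta> / 2 the gap is (x^2 -
  \<gamma>) / t, so t > 0. The function h = exp(\<beta> I) has h' / h = \<beta> / (x^2 - \<gamma>),
  whence \<Phi>' / \<Phi> = (2 x + \<beta>) / (x^2 - \<gamma>) integrates to \<Phi> = (x^2 -
  \<gamma>) h(x).\<close>

lemma class10_data:
  assumes \<beta>: "\<beta> \<noteq> 0" and \<gamma>: "\<gamma> < 0"
  defines "c \<equiv> Class10 \<beta> \<gamma>" and "h \<equiv> \<lambda>x. exp (\<beta> * (1 / sqrt (- \<gamma>) * arctan (x / sqrt (- \<gamma>))))" and "\<kappa> \<equiv> \<beta>\<^sup>2 / 4 - \<gamma>"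
  shows "class_data c {0<..} (\<lambda>x y. x + \<beta> / 2) (\<lambda>t. t - \<beta> / 2) (\<lambda>t. 1) (\<lambda>t. \<beta> / 2 - \<kappa> / t) (\<lambda>t. \<kappa> / t\<^sup>2)
    (\<lambda>t. ((t - \<beta> / 2)\<^sup>2 - \<gamma>) * h (t - \<beta> / 2)) (\<lambda>x. 1) (\<lambda>t. t - \<beta> / 2)
    (\<lambda>x. inverse (h x)) (\<lambda>x. - \<beta> / ((x\<^sup>2 - \<gamma>) * h x)) h (\<lambda>x. \<beta> * h x / (x\<^sup>2 - \<gamma>))
    (- 1 / \<beta>) (\<kappa> / \<beta>) (- 1 / (\<gamma> * \<kappa>)) (- 1 / \<gamma>)"
  unfolding class_data_def
proof (intro conjI allI impI)
  have \<kappa>: "\<kappa> > 0" using \<gamma> zero_le_power2[of \<beta>] unfolding \<kappa>_def by linarith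
  have w: "x\<^sup>2 - \<gamma> > 0" for x using \<gamma> by (smt (verit) zero_le_power2)
  have h0: "h x > 0" for x by (simp add: h_def)
  have s2: "sqrt (- \<gamma>) * sqrt (- \<gamma>) = - \<gamma>" "sqrt (- \<gamma>) \<noteq> 0" using \<gamma> by auto
  have sub [simp]: "substitution c = (\<lambda>x. x + \<beta> / 2)" by (auto simp: c_def)
  have dh: "(h has_real_derivative \<beta> * h x / (x\<^sup>2 - \<gamma>)) (at x)" for x
  proof -
    have "(h has_real_derivative h x * (\<beta> * (1 / sqrt (- \<gamma>) * (inverse (1 + (x / sqrt (- \<gamma>))\<^sup>2) * (1 / sqrt (-
        \<gamma>)))))) (at x)"
    proof -
      have "((\<lambda>x. x / sqrt (- \<gamma>)) has_real_derivative 1 / sqrt (- \<gamma>)) (at x)" by (rule DERIV_cdivide[OF DERIV_ident])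
      from DERIV_chain2[OF DERIV_exp DERIV_cmult[OF DERIV_cmult[OF DERIV_chain2[OF DERIV_arctan this]]]]
      show ?thesis unfolding h_def .
    qed
    moreover have i: "1 / sqrt (- \<gamma>) * (inverse (1 + (x / sqrt (- \<gamma>))\<^sup>2) * (1 / sqrt (- \<gamma>))) = 1 / (x\<^sup>2 - \<gamma>)"
    proof -
      have e: "1 + (x / sqrt (- \<gamma>))\<^sup>2 = (x\<^sup>2 - \<gamma>) / - \<gamma>" using \<gamma> by (simp add: power_divide field_simps)
      have v: "1 / v * (a * (1 / v)) = a / (v * v)" for a v :: real by simp
      show ?thesis unfolding v e s2(1) using w[of x] \<gamma> by simp
    qed
    ultimately show ?thesis unfolding i by (simp add: mult.commute)
  qed
  have d: "t - \<beta> / 2 - (\<beta> / 2 - \<kappa> / t) = ((t - \<beta> / 2)\<^sup>2 - \<gamma>) / t" if "t \<in> {0<..}" for t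
    using that by (auto simp: \<kappa>_def field_simps power2_eq_square)
  show "((\<lambda>t. ((t - \<beta> / 2)\<^sup>2 - \<gamma>) * h (t - \<beta> / 2)) has_real_derivative
    2 * 1 / (t - \<beta> / 2 - (\<beta> / 2 - \<kappa> / t)) * (((t - \<beta> / 2)\<^sup>2 - \<gamma>) * h (t - \<beta> / 2))) (at t)" if t: "t \<in> {0<..}" for t
  proof -
    have "((\<lambda>t. t - \<beta> / 2) has_real_derivative 1) (at t)" by (auto intro!: derivative_eq_intros)
    note dh' = DERIV_chain2[OF dh this]
    have "((\<lambda>t. (t - \<beta> / 2)\<^sup>2 - \<gamma>) has_real_derivative 2 * (t - \<beta> / 2)) (at t)" by (auto intro!: derivative_eq_intros)
    from DERIV_mult[OF this dh'] show ?thesis unfolding d[OF t]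
      by (rule DERIV_cong) (use w[of "t - \<beta> / 2"] t in \<open>simp add: field_simps\<close>)
  qed
  show "\<beta> / 2 - \<kappa> / t < t - \<beta> / 2" if "t \<in> {0<..}" for t
  proof -
    have "((t - \<beta> / 2)\<^sup>2 - \<gamma>) / t > 0" using that w by auto
    then show ?thesis unfolding d[OF that, symmetric] by simp
  qed
  show "(h has_real_derivative \<beta> * h x / (x\<^sup>2 - \<gamma>)) (at x)" for x by (rule dh)
  show "((\<lambda>x. inverse (h x)) has_real_derivative - \<beta> / ((x\<^sup>2 - \<gamma>) * h x)) (at x)" for x
    by (rule DERIV_cong[OF DERIV_inverse'[OF dh]]) (use h0[of x] w[of x] in \<open>simp_all add: field_simps\<close>)
  show "1 * 1 = - 1 / \<beta> * (- \<beta> / ((x\<^sup>2 - \<gamma>) * h x)) * (((substitution c x - \<beta> / 2)\<^sup>2 - \<gamma>) * h (substitution c x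
      - \<beta> / 2))" for x
    using \<beta> w[of x] h0[of x] by simp
  show "\<kappa> / (substitution c x)\<^sup>2 * 1 * (((substitution c x - \<beta> / 2)\<^sup>2 - \<gamma>) * h (substitution c x - \<beta> / 2)) =
    \<kappa> / \<beta> * (\<beta> * h x / (x\<^sup>2 - \<gamma>)) * (substitution c x - \<beta> / 2 - (\<beta> / 2 - \<kappa> / substitution c x))\<^sup>2"
    if "substitution c x \<in> {0<..}" for x
    unfolding d[OF that] using \<beta> w[of x] h0[of x] by (simp add: power_divide) (simp add: power2_eq_square)
  show "class_pde c l q \<longleftrightarrow> - 1 / \<gamma> * (- 1 / \<beta>) * pd_v (pd_v (\<lambda>r. inverse (h (l r)))) q - - 1 / (\<gamma> * \<kappa>) * (\<kappa> / \<beta>)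
      * pd_u (pd_u (\<lambda>r. h (l r))) q =
    (substitution c (l q) - \<beta> / 2) * (\<beta> / 2 - \<kappa> / substitution c (l q)) / (substitution c (l q) - \<beta> / 2 - (\<beta> / 2
        - \<kappa> / substitution c (l q)))"
    if t: "substitution c (l q) \<in> {0<..}" for l :: "real \<times> real \<Rightarrow> real" and q
  proof -
    let ?M = "pd_v (pd_v (\<lambda>r. inverse (h (l r)))) q" and ?N = "pd_u (pd_u (\<lambda>r. h (l r))) q" and ?x = "l q"
    have x: "?x + \<beta> / 2 > 0" using t by simp
    have "\<beta> / 2 - \<kappa> / (?x + \<beta> / 2) = (\<beta> * ?x / 2 + \<gamma>) / (?x + \<beta> / 2)" using x by (simp add: \<kappa>_def field_simps
        power2_eq_square)
    then have rhs: "(substitution c (l q) - \<beta> / 2) * (\<beta> / 2 - \<kappa> / substitution c (l q)) / (substitution c (l q)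
        - \<beta> / 2 - (\<beta> / 2 - \<kappa> / substitution c (l q)))
      = ?x * (\<beta> * ?x / 2 + \<gamma>) / (?x\<^sup>2 - \<gamma>)"
      unfolding d[OF t] using x by simp
    have "- 1 / \<gamma> * (- 1 / \<beta>) * ?M - - 1 / (\<gamma> * \<kappa>) * (\<kappa> / \<beta>) * ?N = (?N + ?M) / (\<beta> * \<gamma>)"
      using \<kappa> \<gamma> \<beta> by (simp add: field_simps)
    moreover have "X / k = R \<longleftrightarrow> X = k * R" if "k \<noteq> 0" for k X R :: real using that by (auto simp: field_simps)
    from this[of "\<beta> * \<gamma>"] have "(?N + ?M) / (\<beta> * \<gamma>) = ?x * (\<beta> * ?x / 2 + \<gamma>) / (?x\<^sup>2 - \<gamma>) \<longleftrightarrow>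
      ?N + ?M = \<beta> * \<gamma> * (?x * (\<beta> * ?x / 2 + \<gamma>) / (?x\<^sup>2 - \<gamma>))"
      using \<beta> \<gamma> by auto
    ultimately have "- 1 / \<gamma> * (- 1 / \<beta>) * ?M - - 1 / (\<gamma> * \<kappa>) * (\<kappa> / \<beta>) * ?N = ?x * (\<beta> * ?x / 2 + \<gamma>) / (?x\<^sup>2 - \<gamma>) \<longleftrightarrow>
      ?N + ?M = \<beta> * \<gamma> * (?x * (\<beta> * ?x / 2 + \<gamma>) / (?x\<^sup>2 - \<gamma>))" by (simp only:)
    also have "\<beta> * \<gamma> * (?x * (\<beta> * ?x / 2 + \<gamma>) / (?x\<^sup>2 - \<gamma>)) = \<beta> * \<gamma> / 2 * (?x * (\<beta> * ?x + 2 * \<gamma>) / (?x\<^sup>2 - \<gamma>))"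
      by (simp add: field_simps)
    also have "?N + ?M = \<beta> * \<gamma> / 2 * (?x * (\<beta> * ?x + 2 * \<gamma>) / (?x\<^sup>2 - \<gamma>)) \<longleftrightarrow> class_pde c l q"
      by (simp add: c_def Lap_star_def h_def)
    finally show ?thesis unfolding rhs ..
  qed
  show "x + \<beta> / 2 \<in> {0<..}" "\<beta> / 2 - \<kappa> / (x + \<beta> / 2) = y" if "y < x" "curvature_relation c (x * y) ((x + y) / 2)
      ((x - y) / 2)" for x y :: real
  proof -
    have "x * y = \<beta> * ((x - y) / 2) + \<gamma>" using that by (simp add: c_def)
    then have 2: "(x + \<beta> / 2) * y = \<beta> * x / 2 + \<gamma>" by (simp add: field_simps)
    have 3: "x + \<beta> / 2 \<noteq> 0"
    proof
      assume "x + \<beta> / 2 = 0"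
      then have "x = - \<beta> / 2" "\<beta> * x / 2 + \<gamma> = 0" using 2 by auto
      then show False using \<kappa> by (simp add: \<kappa>_def power2_eq_square)
    qed
    then have y: "y = (\<beta> * x / 2 + \<gamma>) / (x + \<beta> / 2)" using 2 by (simp add: field_simps)
    then have "(x\<^sup>2 - \<gamma>) / (x + \<beta> / 2) = x - y" using 3 by (simp add: field_simps power2_eq_square)
    then have "(x\<^sup>2 - \<gamma>) / (x + \<beta> / 2) > 0" using that by simp
    then show "x + \<beta> / 2 \<in> {0<..}" using w[of x] by (auto simp: zero_less_divide_iff)
    show "\<beta> / 2 - \<kappa> / (x + \<beta> / 2) = y" unfolding y using 3 by (simp add: \<kappa>_def field_simps power2_eq_square)
  qed
  show "(substitution c has_real_derivative 1) (at x)" for x unfolding sub by (auto intro!: derivative_eq_intros)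
  show "\<kappa> / t\<^sup>2 \<noteq> 0" if "t \<in> {0<..}" for t using that \<kappa> by auto
  show "(\<lambda>t. \<kappa> / t\<^sup>2) differentiable at t" if "t \<in> {0<..}" for t
    using that by (auto intro!: derivative_intros)
  show "0 < ((t - \<beta> / 2)\<^sup>2 - \<gamma>) * h (t - \<beta> / 2)" for t using w h0 by simp
  show "0 < - 1 / (\<gamma> * \<kappa>)" "0 < - 1 / \<gamma>" "\<kappa> / \<beta> \<noteq> 0" using \<kappa> \<gamma> \<beta> by (auto simp: zero_less_divide_iff mult_less_0_iff)
  show "smooth_on D (\<lambda>p. ((x p - \<beta> / 2)\<^sup>2 - \<gamma>) * h (x p - \<beta> / 2))" if "open D" "smooth_on D x" for D and x ::
      "real \<times> real \<Rightarrow> real"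
    unfolding power2_eq_square h_def
    by (intro smooth_mult smooth_exp smooth_arctan smooth_diff smooth_divide smooth_const that) (use s2 in simp)
  show "smooth_on D (\<lambda>p. x p + \<beta> / 2)" "smooth_on D (\<lambda>p. x p - \<beta> / 2)" if "open D" "smooth_on D x" for D and x
      :: "real \<times> real \<Rightarrow> real"
    by (intro smooth_add smooth_diff smooth_const that)+
qed (use \<beta> in \<open>auto intro!: derivative_eq_intros simp: c_def power2_eq_square\<close>)

lemma class_data_exists:
  assumes "valid_class c"
  shows "\<exists>dom geo F F1 G G1 \<Phi> s1 linv m m1 n n1 \<mu> \<eta> A B. class_data c dom geo F F1 G G1 \<Phi> s1 linv m m1 n n1 \<mu> \<eta> A B"
proof (cases c)
  case (Class4 \<beta>)
  then have "\<beta> \<noteq> 0" "\<beta>\<^sup>2 \<noteq> 1" "\<beta>\<^sup>2 > 1" using assms by auto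
  note X = class45_data[OF this(1,2)]
  have "(if \<beta>\<^sup>2 > 1 then Class4 \<beta> else Class5 \<beta>) = c" using Class4 \<open>\<beta>\<^sup>2 > 1\<close> by simp
  from X[unfolded this] show ?thesis by (intro exI)
next
  case (Class5 \<beta>)
  then have "\<beta> \<noteq> 0" "\<beta>\<^sup>2 \<noteq> 1" "\<not> \<beta>\<^sup>2 > 1" using assms by auto
  note X = class45_data[OF this(1,2)]
  have "(if \<beta>\<^sup>2 > 1 then Class4 \<beta> else Class5 \<beta>) = c" using Class5 \<open>\<not> \<beta>\<^sup>2 > 1\<close> by simp
  from X[unfolded this] show ?thesis by (intro exI)
next
  case (Class6 \<beta>)
  then have "\<beta> \<noteq> 0" "\<beta>\<^sup>2 \<noteq> 1" "\<beta>\<^sup>2 > 1" using assms by auto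
  note X = class67_data[OF this(1,2)]
  have "(if \<beta>\<^sup>2 > 1 then Class6 \<beta> else Class7 \<beta>) = c" using Class6 \<open>\<beta>\<^sup>2 > 1\<close> by simp
  from X[unfolded this] show ?thesis by (intro exI)
next
  case (Class7 \<beta>)
  then have "\<beta> \<noteq> 0" "\<beta>\<^sup>2 \<noteq> 1" "\<not> \<beta>\<^sup>2 > 1" using assms by auto
  note X = class67_data[OF this(1,2)]
  have "(if \<beta>\<^sup>2 > 1 then Class6 \<beta> else Class7 \<beta>) = c" using Class7 \<open>\<not> \<beta>\<^sup>2 > 1\<close> by simp
  from X[unfolded this] show ?thesis by (intro exI)
next
  case (Class10 \<beta> \<gamma>)
  then have "\<beta> \<noteq> 0" "\<gamma> < 0" using assms by auto
  from class10_data[OF this] show ?thesis unfolding Class10 by (intro exI)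
next
  case Class1 from class1_data show ?thesis unfolding Class1 by (intro exI)
next
  case Class2 from class2_data show ?thesis unfolding Class2 by (intro exI)
next
  case Class3 from class3_data show ?thesis unfolding Class3 by (intro exI)
next
  case Class8 from class8_data show ?thesis unfolding Class8 by (intro exI)
next
  case Class9 from class9_data show ?thesis unfolding Class9 by (intro exI)
qed

section \<open>Natural principal parameters\<close>

text \<open>Excludes extrema, with witnesses as close to \<open>x\<close> as desired so that they
  remain in a given open domain.\<close>

lemma DERIV_nonzero_values_both_sides:
  fixes h :: "real \<Rightarrow> real"
  assumes "(h has_real_derivative D) (at x)" "D \<noteq> 0" "e > 0"
  shows "\<exists>s t. \<bar>s - x\<bar> < e \<and> \<bar>t - x\<bar> < e \<and> h s < h x \<and> h x < h t"
proof -
  have pick: "\<exists>t. \<bar>t - x\<bar> < e \<and> P t" if "\<exists>d>0. \<forall>y>0. y < d \<longrightarrow> P (x + y)" for P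
  proof -
    from that obtain d where "d > 0 \<and> (\<forall>y>0. y < d \<longrightarrow> P (x + y))" ..
    then have d: "d > 0" "\<And>y. y > 0 \<Longrightarrow> y < d \<Longrightarrow> P (x + y)" by simp_all
    define y where "y = min d e / 2"
    have "y > 0" "y < d" "y < e" using d(1) assms(3) unfolding y_def by linarith+
    then show ?thesis using d(2)[of y] by (intro exI[of _ "x + y"]) simp
  qed
  have pick': "\<exists>t. \<bar>t - x\<bar> < e \<and> P t" if "\<exists>d>0. \<forall>y>0. y < d \<longrightarrow> P (x - y)" for P
  proof -
    from that obtain d where "d > 0 \<and> (\<forall>y>0. y < d \<longrightarrow> P (x - y))" ..
    then have d: "d > 0" "\<And>y. y > 0 \<Longrightarrow> y < d \<Longrightarrow> P (x - y)" by simp_all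
    define y where "y = min d e / 2"
    have "y > 0" "y < d" "y < e" using d(1) assms(3) unfolding y_def by linarith+
    then show ?thesis using d(2)[of y] by (intro exI[of _ "x - y"]) simp
  qed
  show ?thesis
  proof (cases "D > 0")
    case True
    show ?thesis using pick[OF DERIV_pos_inc_right[OF assms(1) True]] pick'[OF DERIV_pos_inc_left[OF assms(1)
        True]] by blast
  next
    case False
    then have "D < 0" using assms(2) by simp
    show ?thesis using pick[OF DERIV_neg_dec_right[OF assms(1) \<open>D < 0\<close>]] pick'[OF DERIV_neg_dec_left[OF assms(1)
        \<open>D < 0\<close>]] by blast
  qed
qed

text \<open>A connected image is an interval, and an interval without greatest or least element is
  open. This makes the range of \<nu> an admissible domain for the curvature functions.\<close>

lemma open_interval_image:
  fixes h :: "'a::topological_space \<Rightarrow> real"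
  assumes "connected S" "continuous_on S h" "\<And>p. p \<in> S \<Longrightarrow> \<exists>q\<in>S. \<exists>r\<in>S. h q < h p \<and> h p < h r"
  shows "open (h ` S)" "is_interval (h ` S)"
proof -
  show iv: "is_interval (h ` S)"
    using connected_continuous_image[OF assms(2,1)] by (simp add: is_interval_connected_1)
  show "open (h ` S)" unfolding open_subopen[of "h ` S"]
  proof
    fix x assume "x \<in> h ` S"
    then obtain p q r where p: "x = h p" "q \<in> S" "r \<in> S" "h q < h p" "h p < h r" using assms(3) by blast
    then have "{h q<..<h r} \<subseteq> h ` S" using mem_is_interval_1_I[OF iv, of "h q" "h r"] by fastforce
    then show "\<exists>T. open T \<and> x \<in> T \<and> T \<subseteq> h ` S" using p by (intro exI[of _ "{h q<..<h r}"]) auto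
  qed
qed

lemma gradient_nonzero_values_both_sides:
  fixes h :: "real \<times> real \<Rightarrow> real"
  assumes "open D" "p \<in> D" "has_pd h a b p" "a \<noteq> 0 \<or> b \<noteq> 0"
  shows "\<exists>q\<in>D. \<exists>r\<in>D. h q < h p \<and> h p < h r"
proof -
  obtain e where e: "e > 0" "ball p e \<subseteq> D" using assms(1,2) open_contains_ball by blast
  show ?thesis
  proof (cases "a = 0")
    case False
    have D: "((\<lambda>t. h (t, snd p)) has_real_derivative a) (at (fst p))"
      using has_pd_u[OF assms(3)] by (simp add: has_real_derivative_iff_has_vector_derivative)
    obtain s t where st: "\<bar>s - fst p\<bar> < e" "\<bar>t - fst p\<bar> < e" "h (s, snd p) < h p" "h p < h (t, snd p)"
      using DERIV_nonzero_values_both_sides[OF D False e(1)] by auto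
    have "(x, snd p) \<in> D" if "\<bar>x - fst p\<bar> < e" for x
      using e(2) that by (auto simp: subset_iff dist_prod_def dist_real_def abs_minus_commute)
    then show ?thesis using st by blast
  next
    case True
    then have b: "b \<noteq> 0" using assms(4) by simp
    have D: "((\<lambda>t. h (fst p, t)) has_real_derivative b) (at (snd p))"
      using has_pd_v[OF assms(3)] by (simp add: has_real_derivative_iff_has_vector_derivative)
    obtain s t where st: "\<bar>s - snd p\<bar> < e" "\<bar>t - snd p\<bar> < e" "h (fst p, s) < h p" "h p < h (fst p, t)"
      using DERIV_nonzero_values_both_sides[OF D b e(1)] by auto
    have "(fst p, x) \<in> D" if "\<bar>x - snd p\<bar> < e" for x
      using e(2) that by (auto simp: subset_iff dist_prod_def dist_real_def abs_minus_commute)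
    then show ?thesis using st by blast
  qed
qed

text \<open>Strict growth gives injectivity on the whole interval and, as there is no extremum,
  openness of the image, so the inverse function theorem holds globally here.\<close>

lemma inverse_of_increasing:
  fixes X d :: "real \<Rightarrow> real"
  assumes ab: "a < b" and "\<forall>t\<in>{a<..<b}. (X has_real_derivative d t) (at t) \<and> d t > 0"
  shows "\<exists>J x. open J \<and> connected J \<and> J = X ` {a<..<b} \<and> (\<forall>t\<in>{a<..<b}. x (X t) = t) \<and>
    (\<forall>s\<in>J. x s \<in> {a<..<b} \<and> X (x s) = s) \<and> (\<forall>s\<in>J. (x has_real_derivative inverse (d (x s))) (at s))"
proof -
  have X: "(X has_real_derivative d t) (at t)" "d t > 0" if "a < t" "t < b" for t using assms(2) that by auto
  let ?I = "{a<..<b}"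
  have cont: "continuous_on ?I X"
    by (intro continuous_at_imp_continuous_on ballI DERIV_isCont[OF X(1)]) auto
  have mono: "X s < X t" if "a < s" "s < t" "t < b" for s t
    by (rule DERIV_pos_imp_increasing[OF that(2)]) (use that X in \<open>meson order_le_less_trans order_less_le_trans\<close>)
  have inj: "inj_on X ?I" by (rule linorder_inj_onI') (use mono in force)
  have "\<exists>q\<in>?I. \<exists>r\<in>?I. X q < X t \<and> X t < X r" if "t \<in> ?I" for t
    using that by (intro bexI[of _ "(a + t) / 2"] bexI[of _ "(t + b) / 2"] conjI mono) auto
  note op = open_interval_image[OF _ cont this]
  define x where "x = the_inv_into ?I X"
  have x: "x (X t) = t" if "t \<in> ?I" for t unfolding x_def by (rule the_inv_into_f_f[OF inj that])
  have "(x has_real_derivative inverse (d t)) (at (X t))" if t: "t \<in> ?I" for t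
    unfolding has_field_derivative_def
    by (rule has_derivative_inverse_strong[OF _ t cont x X(1)[unfolded has_field_derivative_def]])
       (use t X(2)[of t] in \<open>auto simp: fun_eq_iff\<close>)
  then have "(x has_real_derivative inverse (d (x s))) (at s)" if "s \<in> X ` ?I" for s
    using that x by force
  then show ?thesis using op(1) connected_continuous_image[OF cont] x by (intro exI[of _ "X ` ?I"] exI[of _ x]) auto
qed

text \<open>On a square around \<open>p0\<close> the function \<open>e\<close> depends on u alone
  and \<open>h\<close> on v alone. With X' = sqrt e and Y' = sqrt h the new parameters are (X(u),
  Y(v)), and \<phi> is the inverse of this map; its derivatives 1 / sqrt e and 1 / sqrt h, taken at
  \<phi>(p), are the factors \<alpha> and \<beta>.\<close>

lemma local_rescaling:
  fixes e h :: "real \<times> real \<Rightarrow> real"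
  assumes W: "open W" "p0 \<in> W" and sm: "smooth_on W e" "smooth_on W h"
    and pos: "\<And>p. p \<in> W \<Longrightarrow> e p > 0" "\<And>p. p \<in> W \<Longrightarrow> h p > 0"
    and e: "\<And>p. p \<in> W \<Longrightarrow> pd_v e p = 0" and h: "\<And>p. p \<in> W \<Longrightarrow> pd_u h p = 0"
  shows "\<exists>\<phi> U V \<alpha> \<beta>. reparam \<phi> U V \<and> p0 \<in> V \<and> V \<subseteq> W \<and>
     (\<forall>p\<in>U. \<phi> p \<in> V \<and> has_pd \<phi> (\<alpha> p, 0) (0, \<beta> p) p \<and> \<alpha> p > 0 \<and> \<beta> p > 0 \<and> (\<alpha> p)\<^sup>2 * e (\<phi> p) = 1 \<and> (\<beta> p)\<^sup>2 * h (\<phi>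
         p) = 1)"
proof -
  obtain u0 v0 where p0: "p0 = (u0, v0)" by (cases p0)
  obtain d where d: "d > 0" "ball p0 d \<subseteq> W" using W open_contains_ball by blast
  define r where "r = d / 2"
  have r: "r > 0" using d by (simp add: r_def)
  let ?Iu = "{u0 - r<..<u0 + r}" and ?Iv = "{v0 - r<..<v0 + r}"
  let ?V = "?Iu \<times> ?Iv"
  have VW: "?V \<subseteq> W"
  proof
    fix p assume "p \<in> ?V"
    then have "\<bar>fst p - u0\<bar> + \<bar>snd p - v0\<bar> < d" by (cases p) (auto simp: r_def abs_if)
    moreover have "dist p0 p \<le> \<bar>fst p - u0\<bar> + \<bar>snd p - v0\<bar>"
      unfolding p0 dist_prod_def dist_real_def using sqrt_sum_squares_le_sum_abs by (simp add: abs_minus_commute)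
    ultimately show "p \<in> W" using d(2) by auto
  qed
  have V: "open ?V" by (intro open_Times) auto
  have u0: "u0 \<in> ?Iu" "v0 \<in> ?Iv" using r by auto
  have pde: "has_pd e (pd_u e p) (pd_v e p) p" "has_pd h (pd_u h p) (pd_v h p) p" if "p \<in> W" for p
    using smooth_has_pd[OF _ W(1) that] sm by auto
  \<comment> \<open>The reason for working on a square: its vertical segments are connected, so a
    vanishing v-derivative makes \<open>e\<close> constant along them, which could fail in
    \<open>W\<close>.\<close>
  have econst: "e (u, v) = e (u, v0)" if "u \<in> ?Iu" "v \<in> ?Iv" for u v
  proof -
    have "((\<lambda>t. e (u, t)) has_vector_derivative 0) (at t within ?Iv)" if t: "t \<in> ?Iv" for t
    proof -
      have "(u, t) \<in> W" using VW t \<open>u \<in> ?Iu\<close> by auto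
      then show ?thesis using has_pd_v[OF pde(1)[of "(u,t)"]] e by (auto intro: has_vector_derivative_at_within)
    qed
    from has_vector_derivative_zero_constant[OF _ this] obtain c where "\<And>t. t \<in> ?Iv \<Longrightarrow> e (u, t) = c" by auto
    then show ?thesis using that u0 by metis
  qed
  have hconst: "h (u, v) = h (u0, v)" if "u \<in> ?Iu" "v \<in> ?Iv" for u v
  proof -
    have "((\<lambda>t. h (t, v)) has_vector_derivative 0) (at t within ?Iu)" if t: "t \<in> ?Iu" for t
    proof -
      have "(t, v) \<in> W" using VW t \<open>v \<in> ?Iv\<close> by auto
      then show ?thesis using has_pd_u[OF pde(2)[of "(t,v)"]] h by (auto intro: has_vector_derivative_at_within)
    qed
    from has_vector_derivative_zero_constant[OF _ this] obtain c where "\<And>t. t \<in> ?Iu \<Longrightarrow> h (t, v) = c" by auto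
    then show ?thesis using that u0 by metis
  qed
  have "isCont (\<lambda>t. sqrt (e (t, v0))) t" if "t \<in> ?Iu" for t
  proof -
    have "(t, v0) \<in> W" using VW that u0 by auto
    then have "isCont (\<lambda>t. e (t, v0)) t" using has_vector_derivative_continuous[OF has_pd_u[OF pde(1)[of
        "(t,v0)"]]] by simp
    then show ?thesis by (intro continuous_intros)
  qed
  then obtain X where X: "\<And>t. u0 - r < t \<Longrightarrow> t < u0 + r \<Longrightarrow> (X has_real_derivative sqrt (e (t, v0))) (at t)"
    using einterval_antiderivative[of "ereal (u0 - r)" "ereal (u0 + r)" "\<lambda>t. sqrt (e (t, v0))"] r
    by (auto simp: has_real_derivative_iff_has_vector_derivative)
  have "isCont (\<lambda>t. sqrt (h (u0, t))) t" if "t \<in> ?Iv" for t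
  proof -
    have "(u0, t) \<in> W" using VW that u0 by auto
    then have "isCont (\<lambda>t. h (u0, t)) t" using has_vector_derivative_continuous[OF has_pd_v[OF pde(2)[of
        "(u0,t)"]]] by simp
    then show ?thesis by (intro continuous_intros)
  qed
  then obtain Y where Y: "\<And>t. v0 - r < t \<Longrightarrow> t < v0 + r \<Longrightarrow> (Y has_real_derivative sqrt (h (u0, t))) (at t)"
    using einterval_antiderivative[of "ereal (v0 - r)" "ereal (v0 + r)" "\<lambda>t. sqrt (h (u0, t))"] r
    by (auto simp: has_real_derivative_iff_has_vector_derivative)
  have epos: "sqrt (e (t, v0)) > 0" if "u0 - r < t" "t < u0 + r" for t
  proof -
    have "(t, v0) \<in> W" using VW that u0 by auto
    then show ?thesis using pos(1) by simp
  qed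
  have hpos: "sqrt (h (u0, t)) > 0" if "v0 - r < t" "t < v0 + r" for t
  proof -
    have "(u0, t) \<in> W" using VW that u0 by auto
    then show ?thesis using pos(2) by simp
  qed
  have lt: "u0 - r < u0 + r" "v0 - r < v0 + r" using r by auto
  have dX: "\<forall>t\<in>?Iu. (X has_real_derivative sqrt (e (t, v0))) (at t) \<and> sqrt (e (t, v0)) > 0" using X epos by auto
  obtain Ju x where "open Ju" "connected Ju" "Ju = X ` ?Iu" "\<forall>t\<in>?Iu. x (X t) = t"
    "\<forall>s\<in>Ju. x s \<in> ?Iu \<and> X (x s) = s" "\<forall>s\<in>Ju. (x has_real_derivative inverse (sqrt (e (x s, v0)))) (at s)"
    using inverse_of_increasing[OF lt(1) dX] by (elim exE conjE) (rule that)
  note x = this(1-3) this(4-6)[rule_format]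
  have dY: "\<forall>t\<in>?Iv. (Y has_real_derivative sqrt (h (u0, t))) (at t) \<and> sqrt (h (u0, t)) > 0" using Y hpos by auto
  obtain Jv y where "open Jv" "connected Jv" "Jv = Y ` ?Iv" "\<forall>t\<in>?Iv. y (Y t) = t"
    "\<forall>s\<in>Jv. y s \<in> ?Iv \<and> Y (y s) = s" "\<forall>s\<in>Jv. (y has_real_derivative inverse (sqrt (h (u0, y s)))) (at s)"
    using inverse_of_increasing[OF lt(2) dY] by (elim exE conjE) (rule that)
  note y = this(1-3) this(4-6)[rule_format]
  define U where "U = Ju \<times> Jv"
  define \<phi> where "\<phi> = (\<lambda>p. (x (fst p), y (snd p)))"
  define \<psi> where "\<psi> = (\<lambda>p. (X (fst p), Y (snd p)))"
  have U: "open U" "connected U" unfolding U_def using x y by (auto intro: open_Times connected_Times)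
  have \<phi>V: "\<phi> p \<in> ?V" "\<psi> (\<phi> p) = p" if "p \<in> U" for p using that x(5) y(5) by (cases p; force simp: U_def \<phi>_def \<psi>_def)+
  have \<psi>U: "\<psi> p \<in> U" "\<phi> (\<psi> p) = p" if "p \<in> ?V" for p using that x(3,4) y(3,4) by (cases p; force simp: U_def
      \<phi>_def \<psi>_def)+
  have \<phi>sub: "\<phi> ` U \<subseteq> ?V" by (rule image_subsetI) (rule \<phi>V(1))
  have "\<psi> ` ?V \<subseteq> U" by (rule image_subsetI) (rule \<psi>U(1))
  with \<phi>sub have bij: "bij_betw \<phi> U ?V"
    by (intro bij_betw_byWitness[where f' = \<psi>] ballI \<phi>V(2) \<psi>U(2))
  define a where "a = (\<lambda>p. inverse (sqrt (e p)))"
  define b where "b = (\<lambda>p. inverse (sqrt (h p)))"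
  have px: "has_pd (\<lambda>p. x (fst p)) (a (\<phi> p)) 0 p" if "p \<in> U" for p
  proof -
    have "e (\<phi> p) = e (x (fst p), v0)" using \<phi>V(1)[OF that] unfolding \<phi>_def by (auto intro: econst)
    then show ?thesis using has_pd_real_comp[OF x(6) has_pd_fst, of p] that by (auto simp: U_def a_def)
  qed
  have py: "has_pd (\<lambda>p. y (snd p)) 0 (b (\<phi> p)) p" if "p \<in> U" for p
  proof -
    have "h (\<phi> p) = h (u0, y (snd p))" using \<phi>V(1)[OF that] unfolding \<phi>_def by (auto intro: hconst)
    then show ?thesis using has_pd_real_comp[OF y(6) has_pd_snd, of p] that by (auto simp: U_def b_def)
  qed
  have "smooth_on W a" "smooth_on W b" unfolding a_def b_def
    by (intro smooth_inverse smooth_sqrt sm pos W; use pos in force)+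
  then have ab: "smooth_on ?V a" "smooth_on ?V b" using VW smooth_on_subset by blast+
  \<comment> \<open>Bootstrapping: the partial derivatives of \<phi> are
    \<open>a \<circ> \<phi>\<close> and \<open>b \<circ> \<phi>\<close> with smooth \<open>a\<close>
    and \<open>b\<close>, so class \<open>k\<close> of \<phi> yields class
    \<open>k + 1\<close>.\<close>
  have ck: "Ck_on k U (\<lambda>p. x (fst p)) \<and> Ck_on k U (\<lambda>p. y (snd p))" for k
  proof (induction k)
    case 0
    show ?case using px py by (auto intro!: continuous_at_imp_continuous_on has_pd_continuous)
  next
    case (Suc k)
    have "Ck_on k U \<phi>" unfolding \<phi>_def using Suc by (intro Ck_Pair U) auto
    then have "Ck_on k U (a \<circ> \<phi>)" "Ck_on k U (b \<circ> \<phi>)"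
      using ab by (auto intro!: Ck_comp[OF V U(1) _ _ \<phi>sub] simp: smooth_on_def)
    then show ?case using Ck_SucI[OF U(1) px, of k] Ck_SucI[OF U(1) py, of k] by (simp add: o_def Ck_const)
  qed
  have sm\<phi>: "smooth_on U \<phi>" unfolding \<phi>_def smooth_on_def by (intro allI Ck_Pair U(1) conjunct1[OF ck]
      conjunct2[OF ck])
  have pX: "has_pd (\<lambda>p. X (fst p)) (sqrt (e p)) 0 p" "has_pd (\<lambda>p. Y (snd p)) 0 (sqrt (h p)) p" if "p \<in> ?V" for p
  proof -
    have "e (fst p, snd p) = e (fst p, v0)" "h (fst p, snd p) = h (u0, snd p)"
      using that by (intro econst hconst; auto)+
    then have "e p = e (fst p, v0)" "h p = h (u0, snd p)" by simp_all
    moreover have "has_pd (\<lambda>p. X (fst p)) (sqrt (e (fst p, v0)) * 1) (sqrt (e (fst p, v0)) * 0) p"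
      "has_pd (\<lambda>p. Y (snd p)) (sqrt (h (u0, snd p)) * 0) (sqrt (h (u0, snd p)) * 1) p"
      by (rule has_pd_real_comp[OF X has_pd_fst] has_pd_real_comp[OF Y has_pd_snd]; use that in force)+
    ultimately show "has_pd (\<lambda>p. X (fst p)) (sqrt (e p)) 0 p" "has_pd (\<lambda>p. Y (snd p)) 0 (sqrt (h p)) p" by auto
  qed
  have ehV: "smooth_on ?V (\<lambda>p. sqrt (e p))" "smooth_on ?V (\<lambda>p. sqrt (h p))"
    using VW by (auto intro!: smooth_sqrt V smooth_on_subset[OF sm(1)] smooth_on_subset[OF sm(2)] pos)
  \<comment> \<open>The partial derivatives of the inverse map are the smooth functions sqrt e and
    sqrt h themselves, so one step suffices for each \<open>k\<close>; \<open>Ck_pred\<close> spares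
    a separate treatment of k = 0.\<close>
  have ck': "Ck_on k ?V (\<lambda>p. X (fst p))" "Ck_on k ?V (\<lambda>p. Y (snd p))" for k
    using Ck_pred[OF Ck_SucI[OF V pX(1), of k]] Ck_pred[OF Ck_SucI[OF V pX(2), of k]] ehV
    by (simp_all add: smooth_on_def Ck_const del: Ck_on.simps)
  have sm\<psi>: "smooth_on ?V \<psi>" unfolding \<psi>_def smooth_on_def by (intro allI Ck_Pair V ck')
  have "smooth_on ?V (the_inv_into U \<phi>)"
  proof (rule smooth_on_cong[OF V _ sm\<psi>])
    fix p assume p: "p \<in> ?V"
    show "\<psi> p = the_inv_into U \<phi> p"
      by (rule the_inv_into_f_eq[OF bij_betw_imp_inj_on[OF bij] \<psi>U(2)[OF p] \<psi>U(1)[OF p], symmetric])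
  qed
  then have rep: "reparam \<phi> U ?V" unfolding reparam_def by (intro conjI U V bij sm\<phi>)
  have "\<phi> p \<in> ?V \<and> has_pd \<phi> (a (\<phi> p), 0) (0, b (\<phi> p)) p \<and> a (\<phi> p) > 0 \<and> b (\<phi> p) > 0
    \<and> (a (\<phi> p))\<^sup>2 * e (\<phi> p) = 1 \<and> (b (\<phi> p))\<^sup>2 * h (\<phi> p) = 1" if "p \<in> U" for p
  proof -
    have q: "\<phi> p \<in> W" by (rule subsetD[OF VW \<phi>V(1)[OF that]])
    have "has_pd \<phi> (a (\<phi> p), 0) (0, b (\<phi> p)) p"
      using has_pd_Pair[OF px[OF that] py[OF that]] by (simp add: \<phi>_def)
    moreover have "a (\<phi> p) > 0" "b (\<phi> p) > 0" "(a (\<phi> p))\<^sup>2 * e (\<phi> p) = 1" "(b (\<phi> p))\<^sup>2 * h (\<phi> p) = 1"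
      using pos[OF q] by (simp_all add: a_def b_def power_inverse)
    ultimately show ?thesis using \<phi>V(1)[OF that] by blast
  qed
  note A = this
  have p0V: "p0 \<in> ?V" using p0 u0 by simp
  show ?thesis
    by (rule exI[of _ \<phi>], rule exI[of _ U], rule exI[of _ ?V], rule exI[of _ "\<lambda>p. a (\<phi> p)"], rule exI[of _ "\<lambda>p.
        b (\<phi> p)"])
       (rule conjI[OF rep conjI[OF p0V conjI[OF VW ballI[OF A]]]])
qed

section \<open>Surfaces parallel to those of a basic class\<close>

text \<open>The maps below invert \<open>x \<mapsto> \<epsilon> x / (c (1 - a x))\<close>, where \<open>k = \<epsilon> c\<close>.\<close>

lemma DERIV_moebius:
  fixes F F1 :: "real \<Rightarrow> real"
  assumes "(F has_real_derivative F1 t) (at t)" "1 + k * a * F t \<noteq> 0"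
  shows "((\<lambda>t. k * F t / (1 + k * a * F t)) has_real_derivative k * F1 t / (1 + k * a * F t)\<^sup>2) (at t)"
proof -
  have "((\<lambda>t. 1 + k * a * F t) has_real_derivative k * a * F1 t) (at t)"
    using DERIV_add[OF DERIV_const DERIV_cmult[OF assms(1)]] by simp
  from DERIV_divide[OF DERIV_cmult[OF assms(1), of k] this assms(2)] show ?thesis
    by (rule DERIV_cong) (use assms(2) in \<open>simp add: power2_eq_square algebra_simps\<close>)
qed

lemma differentiable_moebius:
  fixes F F1 :: "real \<Rightarrow> real"
  assumes "(F has_real_derivative F1 t) (at t)" "F1 differentiable (at t)" "1 + k * a * F t \<noteq> 0"
  shows "(\<lambda>t. k * F1 t / (1 + k * a * F t)\<^sup>2) differentiable (at t)"
proof -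
  have "F differentiable (at t)" using assms(1) by (auto simp: real_differentiable_def)
  then show ?thesis using assms(2,3) by (auto intro!: derivative_intros)
qed

context class_data
begin

definition mF where "mF k a t = k * F t / (1 + k * a * F t)"
definition mF1 where "mF1 k a t = k * F1 t / (1 + k * a * F t)\<^sup>2"
definition mG where "mG k a t = k * G t / (1 + k * a * G t)"
definition mG1 where "mG1 k a t = k * G1 t / (1 + k * a * G t)\<^sup>2"
text \<open>The Moebius map multiplies F1 / (F - G) by (1 + k a G) / (1 + k a F) = 1 - k a (F - G) /
  (1 + k a F). Thus the logarithmic derivative of (1 + k a F)^2 is subtracted from that of
  \<Phi>.\<close>

definition mPhi where "mPhi k a t = \<Phi> t / (1 + k * a * F t)\<^sup>2"

lemma moebius_diff:
  assumes "1 + k * a * F t \<noteq> 0" "1 + k * a * G t \<noteq> 0"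
  shows "mF k a t - mG k a t = k * (F t - G t) / ((1 + k * a * F t) * (1 + k * a * G t))"
  using assms unfolding mF_def mG_def by (simp add: diff_frac_eq) (simp add: algebra_simps)

lemma curv_pair_moebius:
  assumes I: "open I" "is_interval I" "I \<subseteq> dom" and k: "k \<noteq> 0"
    and nz: "\<And>t. t \<in> I \<Longrightarrow> 1 + k * a * F t \<noteq> 0" "\<And>t. t \<in> I \<Longrightarrow> 1 + k * a * G t \<noteq> 0"
  shows "curv_pair I (mF k a) (mF1 k a) (mG k a) (mG1 k a) (mPhi k a)"
proof
  fix t assume t: "t \<in> I"
  then have td: "t \<in> dom" using I by auto
  note FGt = FG[OF td] and n = nz[OF t]
  show "(mF k a has_real_derivative mF1 k a t) (at t)" "(mG k a has_real_derivative mG1 k a t) (at t)"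
    unfolding mF_def mF1_def mG_def mG1_def using FGt n by (auto intro: DERIV_moebius)
  show "mF1 k a differentiable at t" "mG1 k a differentiable at t"
    unfolding mF1_def[abs_def] mG1_def[abs_def] using FGt n by (auto intro: differentiable_moebius)
  show "mF k a t \<noteq> mG k a t" using moebius_diff[OF n] FGt n k by auto
  show "mF1 k a t \<noteq> 0" "mG1 k a t \<noteq> 0" using FGt n k by (auto simp: mF1_def mG1_def)
  show "mPhi k a t > 0" using Phi[OF td] n by (simp add: mPhi_def)
  let ?d = "1 + k * a * F t" and ?e = "1 + k * a * G t"
  have "((\<lambda>t. 1 + k * a * F t) has_real_derivative k * a * F1 t) (at t)"
    using DERIV_add[OF DERIV_const DERIV_cmult] FGt by fastforce
  from DERIV_power[OF this, of 2] have d: "((\<lambda>t. (1 + k * a * F t)\<^sup>2) has_real_derivative 2 * (k * a * F1 t) *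
      ?d) (at t)"
    by (simp add: mult.assoc)
  have nz2: "?d\<^sup>2 \<noteq> 0" using n by simp
  have "(mPhi k a has_real_derivative (2 * F1 t / (F t - G t) * \<Phi> t * ?d\<^sup>2 - \<Phi> t * (2 * (k * a * F1 t) * ?d)) /
      (?d\<^sup>2 * ?d\<^sup>2)) (at t)"
    unfolding mPhi_def[abs_def] using DERIV_divide[OF conjunct2[OF Phi[OF td]] d nz2] .
  moreover have "(2 * F1 t / (F t - G t) * \<Phi> t * ?d\<^sup>2 - \<Phi> t * (2 * (k * a * F1 t) * ?d)) / (?d\<^sup>2 * ?d\<^sup>2) =
    2 * mF1 k a t / (mF k a t - mG k a t) * mPhi k a t"
  proof -
    have FGne: "F t - G t \<noteq> 0" using FGt by auto
    have "2 * (k * F1 t / ?d\<^sup>2) / (k * (F t - G t) / (?d * ?e)) = 2 * F1 t * ?e / ((F t - G t) * ?d)"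
      using n k FGne by (simp add: power2_eq_square mult.commute)
    moreover have "?e = ?d - k * a * (F t - G t)" by (simp add: algebra_simps)
    ultimately show ?thesis unfolding moebius_diff[OF n] mF1_def mPhi_def
      using FGne n by (simp only:) (simp add: divide_simps power2_eq_square, simp add: algebra_simps)
  qed
  ultimately show "(mPhi k a has_real_derivative 2 * mF1 k a t / (mF k a t - mG k a t) * mPhi k a t) (at t)" by simp
qed (use I in auto)

text \<open>Prescribing k^2 A makes the u-term, whose own factor is 1 / k, carry k like the other
  two terms; then k cancels. The distance a drops out because numerator and denominator of F G / (F
  - G) acquire the same factors.\<close>

lemma pde_becomes_moebius:
  assumes J: "open I" "is_interval I" "I \<subseteq> dom" and k: "k \<noteq> 0"
    and mz: "\<And>t. t \<in> I \<Longrightarrow> 1 + k * a * F t \<noteq> 0" "\<And>t. t \<in> I \<Longrightarrow> 1 + k * a * G t \<noteq> 0"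
    and t0: "t0 \<in> I" and pq: "p\<^sup>2 / mPhi k a t0 = k\<^sup>2 * A" "q\<^sup>2 / curv_pair.\<Psi> (mF k a) (mG k a) (mPhi k a) t0 = B"
  shows "pde_becomes c I (mF k a) (mG k a) p q t0"
  unfolding pde_becomes_def
proof (intro allI impI ballI)
  interpret curv_pair I "mF k a" "mF1 k a" "mG k a" "mG1 k a" "mPhi k a" by (rule curv_pair_moebius[OF J k mz])
  fix \<Omega> l r assume \<Omega>: "open \<Omega> \<and> Ck_on 2 \<Omega> l \<and> (\<forall>q\<in>\<Omega>. substitution c (l q) \<in> I)" and r: "r \<in> \<Omega>"
  let ?t = "substitution c (l r)"
  have t: "?t \<in> I" using \<Omega> r by auto
  then have td: "?t \<in> dom" using J(3) by blast
  have S: "substitution c x \<in> dom" if "substitution c x \<in> I" for x using that J(3) by blast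
  have id1: "mF1 k a (substitution c x) * s1 x = (k * \<mu>) * m1 x * mPhi k a (substitution c x)" if "substitution
      c x \<in> I" for x
  proof -
    have "F1 (substitution c x) * s1 x = \<mu> * m1 x * \<Phi> (substitution c x)" using mn[OF S[OF that]] by simp
    then show ?thesis unfolding mF1_def mPhi_def by (simp add: mult.assoc)
  qed
  have id2: "mG1 k a (substitution c x) * s1 x = (\<eta> / k) * n1 x * \<Psi> (substitution c x)" if "substitution c x \<in>
      I" for x
  proof -
    let ?u = "substitution c x"
    let ?d = "1 + k * a * F ?u" and ?e = "1 + k * a * G ?u"
    have g: "G1 ?u * s1 x * \<Phi> ?u = \<eta> * n1 x * (F ?u - G ?u)\<^sup>2" using mn[OF S[OF that]] by simp
    have P: "\<Phi> ?u \<noteq> 0" using Phi[OF S[OF that]] by auto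
    have de: "?d \<noteq> 0" "?e \<noteq> 0" using that mz by auto
    have P': "\<Psi> ?u = k\<^sup>2 * (F ?u - G ?u)\<^sup>2 / (?e\<^sup>2 * \<Phi> ?u)"
      unfolding \<Psi>_def moebius_diff[OF de] mPhi_def using de P by (simp add: power_divide power_mult_distrib)
    have g': "G1 ?u * s1 x = \<eta> * n1 x * (F ?u - G ?u)\<^sup>2 / \<Phi> ?u"
      using g P by (simp add: nonzero_eq_divide_eq)
    have gen: "k * (h * D / P) / d = h / k * (k\<^sup>2 * D / (d * P))" for d h D P
      using k by (simp add: power2_eq_square mult.commute)
    have "mG1 k a ?u * s1 x = k * (G1 ?u * s1 x) / ?e\<^sup>2" by (simp add: mG1_def)
    also have "\<dots> = \<eta> * n1 x / k * \<Psi> ?u" unfolding g' P' by (rule gen)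
    finally show ?thesis by simp
  qed
  have rhs: "mF k a ?t * mG k a ?t / (mF k a ?t - mG k a ?t) = k * (F ?t * G ?t / (F ?t - G ?t))"
  proof -
    have de: "1 + k * a * F ?t \<noteq> 0" "1 + k * a * G ?t \<noteq> 0" using t mz by auto
    show ?thesis unfolding moebius_diff[OF de] unfolding mF_def mG_def using de k by simp
  qed
  have "natural_pde (mF k a) (mG k a) p q t0 (\<lambda>r. substitution c (l r)) r \<longleftrightarrow>
    q\<^sup>2 / \<Psi> t0 * (k * \<mu>) * pd_v (pd_v (\<lambda>r. m (l r))) r - p\<^sup>2 / mPhi k a t0 * (\<eta> / k) * pd_u (pd_u (\<lambda>r. n (l r))) r
     = mF k a ?t * mG k a ?t / (mF k a ?t - mG k a ?t)"
    by (rule natural_pde_iff[of \<Omega> r l "substitution c" s1 m m1 "k * \<mu>" n n1 "\<eta> / k"])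
       (use \<Omega> r sub mn S id1 id2 t0 pos k in auto)
  also have "\<dots> \<longleftrightarrow> k * (B * \<mu> * pd_v (pd_v (\<lambda>r. m (l r))) r - A * \<eta> * pd_u (pd_u (\<lambda>r. n (l r))) r) = k * (F ?t * G
      ?t / (F ?t - G ?t))"
    unfolding pq rhs using k by (simp add: power2_eq_square algebra_simps)
  also have "\<dots> \<longleftrightarrow> class_pde c l r" unfolding mult_cancel_left pde[where l = l and q = r, OF td] using k by simp
  finally show "natural_pde (mF k a) (mG k a) p q t0 (\<lambda>r. substitution c (l r)) r = class_pde c l r" .
qed

text \<open>A name for the \<Psi> of the transformed pair that can be used in statements made before
  \<open>curv_pair\<close> is interpreted.\<close>

definition mPsi where "mPsi k a = curv_pair.\<Psi> (mF k a) (mG k a) (mPhi k a)"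

text \<open>Here \<open>y\<close> is the surface of the basic class and \<open>w\<close> the surface
  under study, whose curvatures are Moebius images of those of \<open>y\<close>. A critical point of
  \<nu> would be critical for both curvatures of \<open>w\<close>, which \<open>codazzi_type\<close>
  excludes; so \<nu> has no extremum, and its image is an open interval.\<close>

lemma geo_image:
  assumes y: "principal_surface y U" and w: "principal_surface w U" "codazzi_type w U" and k: "k \<noteq> 0"
    and cr: "\<And>p. p \<in> U \<Longrightarrow> curvature_relation c (curvK y p) (curvH y p) (curvH' y p)"
    and nz: "\<And>p. p \<in> U \<Longrightarrow> 1 + k * a * nu1 y p \<noteq> 0" "\<And>p. p \<in> U \<Longrightarrow> 1 + k * a * nu2 y p \<noteq> 0"
    and nu: "\<And>p. p \<in> U \<Longrightarrow> nu1 w p = k * nu1 y p / (1 + k * a * nu1 y p)"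
      "\<And>p. p \<in> U \<Longrightarrow> nu2 w p = k * nu2 y p / (1 + k * a * nu2 y p)"
  defines "\<nu> \<equiv> geometric_function c y"
  shows "weingarten_pair w U (\<nu> ` U) (mF k a) (mF1 k a) (mG k a) (mG1 k a) (mPhi k a) \<nu>"
    "\<And>p. p \<in> U \<Longrightarrow> (pd_u \<nu> p, pd_v \<nu> p) \<noteq> (0, 0)" "\<nu> ` U \<subseteq> dom"
    "\<And>t. t \<in> \<nu> ` U \<Longrightarrow> 1 + k * a * F t \<noteq> 0" "\<And>t. t \<in> \<nu> ` U \<Longrightarrow> 1 + k * a * G t \<noteq> 0"
    "\<And>p. p \<in> U \<Longrightarrow> nu1 y p = F (\<nu> p)"
proof -
  interpret Y: principal y U using y by unfold_locales
  interpret W: principal w U using w by unfold_locales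
  have \<nu>eq: "\<nu> p = geo (nu1 y p) (nu2 y p)" for p by (simp add: \<nu>_def geo)
  have R: "\<nu> p \<in> dom \<and> F (\<nu> p) = nu1 y p \<and> G (\<nu> p) = nu2 y p" if "p \<in> U" for p
    unfolding \<nu>eq using rel[OF Y.nu_less[OF that]] cr[OF that] by (simp add: curvK_def curvH_def curvH'_def)
  show sub: "\<nu> ` U \<subseteq> dom" and n: "\<And>t. t \<in> \<nu> ` U \<Longrightarrow> 1 + k * a * F t \<noteq> 0" "\<And>t. t \<in> \<nu> ` U \<Longrightarrow> 1 + k * a * G t \<noteq> 0"
    and "\<And>p. p \<in> U \<Longrightarrow> nu1 y p = F (\<nu> p)"
    using R nz by auto
  have sm: "smooth_on U \<nu>"
    using geo_smooth[OF Y.D(1) Y.coeffs_smooth(3,4)] by (simp add: \<nu>eq[abs_def])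
  have eq: "nu1 w p = mF k a (\<nu> p)" "nu2 w p = mG k a (\<nu> p)" if "p \<in> U" for p
    using nu[OF that] R[OF that] by (auto simp: mF_def mG_def)
  show grad: "(pd_u \<nu> p, pd_v \<nu> p) \<noteq> (0, 0)" if p: "p \<in> U" for p
  proof
    assume 0: "(pd_u \<nu> p, pd_v \<nu> p) = (0, 0)"
    have \<nu>p: "has_pd \<nu> 0 0 p" using smooth_has_pd[OF sm W.D(1) p] 0 by simp
    have d: "\<nu> p \<in> dom" "1 + k * a * F (\<nu> p) \<noteq> 0" "1 + k * a * G (\<nu> p) \<noteq> 0" using R[OF p] nz[OF p] by auto
    have "has_pd (\<lambda>q. mF k a (\<nu> q)) (mF1 k a (\<nu> p) * 0) (mF1 k a (\<nu> p) * 0) p"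
      "has_pd (\<lambda>q. mG k a (\<nu> q)) (mG1 k a (\<nu> p) * 0) (mG1 k a (\<nu> p) * 0) p"
      by (rule has_pd_real_comp[OF _ \<nu>p]; use FG[OF d(1)] d in \<open>auto simp: mF_def mF1_def mG_def mG1_def intro!:
          DERIV_moebius\<close>)+
    then have z: "has_pd (nu1 w) 0 0 p" "has_pd (nu2 w) 0 0 p"
      using eq by (auto intro: has_pd_cong[OF _ W.D(1) p])
    have "pd_v (nu1 w) p = 0" "pd_u (nu2 w) p = 0" by (rule has_pd_imp(2)[OF z(1)], rule has_pd_imp(1)[OF z(2)])
    then show False using w(2) p by (auto simp: codazzi_type_def)
  qed
  have "\<exists>q\<in>U. \<exists>r\<in>U. \<nu> q < \<nu> p \<and> \<nu> p < \<nu> r" if "p \<in> U" for p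
    using gradient_nonzero_values_both_sides[OF W.D(1) that smooth_has_pd[OF sm W.D(1) that]] grad[OF that] by auto
  from open_interval_image[OF W.D(2) smooth_continuous_on[OF sm] this]
  have I: "open (\<nu> ` U)" "is_interval (\<nu> ` U)" by auto
  interpret curv_pair "\<nu> ` U" "mF k a" "mF1 k a" "mG k a" "mG1 k a" "mPhi k a"
    by (rule curv_pair_moebius[OF I sub k n])
  show "weingarten_pair w U (\<nu> ` U) (mF k a) (mF1 k a) (mG k a) (mG1 k a) (mPhi k a) \<nu>"
    by unfold_locales (use sm eq in auto)
qed

text \<open>At every base point p^2 = 1 / E and q^2 = 1 / G, so the normalisation \<open>EG\<close>
  says that p^2 / mPhi = k^2 A and q^2 / mPsi = B, precisely the condition under which the natural
  PDE is the listed one.\<close>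

lemma has_natural_pde:
  assumes y: "principal_surface y U" and w: "principal_surface w U" "codazzi_type w U" and k: "k \<noteq> 0"
    and cr: "\<And>p. p \<in> U \<Longrightarrow> curvature_relation c (curvK y p) (curvH y p) (curvH' y p)"
    and nz: "\<And>p. p \<in> U \<Longrightarrow> 1 + k * a * nu1 y p \<noteq> 0" "\<And>p. p \<in> U \<Longrightarrow> 1 + k * a * nu2 y p \<noteq> 0"
    and nu: "\<And>p. p \<in> U \<Longrightarrow> nu1 w p = k * nu1 y p / (1 + k * a * nu1 y p)"
      "\<And>p. p \<in> U \<Longrightarrow> nu2 w p = k * nu2 y p / (1 + k * a * nu2 y p)"
    and EG: "\<And>p. p \<in> U \<Longrightarrow> coeffE w p * mPhi k a (geometric_function c y p) = 1 / (k\<^sup>2 * A)"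
      "\<And>p. p \<in> U \<Longrightarrow> coeffG w p * mPsi k a (geometric_function c y p) = 1 / B"
  shows "has_natural_pde_of w U (geometric_function c y) c"
proof -
  define \<nu> where "\<nu> = geometric_function c y"
  note gi = geo_image[OF y w k cr nz nu, folded \<nu>_def]
  interpret weingarten_pair w U "\<nu> ` U" "mF k a" "mF1 k a" "mG k a" "mG1 k a" "mPhi k a" \<nu>
    using gi(1) by simp
  have weq: "\<Psi> = mPsi k a" by (simp add: mPsi_def)
  have EG': "\<And>p. p \<in> U \<Longrightarrow> coeffE w p * mPhi k a (\<nu> p) = 1 / (k\<^sup>2 * A)" "\<And>p. p \<in> U \<Longrightarrow> coeffG w p * \<Psi> (\<nu> p) = 1 / B"
    using EG by (auto simp: \<nu>_def weq)
  have wg: "weingarten w U (\<nu> ` U) (mF k a) (mG k a) \<nu>"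
    unfolding weingarten_def
  proof (intro conjI ballI)
    fix t assume t: "t \<in> \<nu> ` U"
    show "mF k a differentiable at t" "mG k a differentiable at t" "deriv (mF k a) differentiable at t" "deriv
        (mG k a) differentiable at t"
      using f(1)[OF t] g(1)[OF t] deriv_deriv[OF t] by (auto simp: real_differentiable_def)
    show "mF k a t - mG k a t \<noteq> 0" using nz(1)[OF t] by simp
    show "deriv (mF k a) t * deriv (mG k a) t \<noteq> 0" using nz(2,3)[OF t] by (simp add: deriv_f[OF t] deriv_g[OF t])
  qed (use S I nu gi(2) in auto)
  have pb: "pde_becomes c (\<nu> ` U) (mF k a) (mG k a) p q (\<nu> p0)"
    if "p0 \<in> U" "p\<^sup>2 * coeffE w p0 = 1" "q\<^sup>2 * coeffG w p0 = 1" for p0 p q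
  proof (rule pde_becomes_moebius[OF I gi(3) k gi(4,5)])
    show "\<nu> p0 \<in> \<nu> ` U" using that by simp
    have "p\<^sup>2 = 1 / coeffE w p0" "q\<^sup>2 = 1 / coeffG w p0" using that E_pos[OF that(1)] G_pos[OF that(1)] by (auto
        simp: field_simps)
    then have "p\<^sup>2 / mPhi k a (\<nu> p0) = 1 / (coeffE w p0 * mPhi k a (\<nu> p0))" "q\<^sup>2 / \<Psi> (\<nu> p0) = 1 / (coeffG w p0 *
        \<Psi> (\<nu> p0))" by auto
    then show "p\<^sup>2 / mPhi k a (\<nu> p0) = k\<^sup>2 * A" "q\<^sup>2 / \<Psi> (\<nu> p0) = B" unfolding EG'[OF that(1)] by auto
  qed
  define l where "l = (\<lambda>p. linv (\<nu> p))"
  have ls: "smooth_on U l" unfolding l_def by (rule linv_smooth[OF D(1) nu(1) gi(3)])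
  have \<nu>l: "\<nu> p = substitution c (l p)" if "p \<in> U" for p
    using linv gi(3) that by (auto simp: l_def)
  have "class_pde c l p" if p: "p \<in> U" for p
  proof -
    \<comment> \<open>The base point is \<open>p\<close> itself, with matching constants; the
      natural PDE that holds for \<nu> at \<open>p\<close> is then carried over to \<open>l\<close>
      by the equivalence \<open>pb\<close>.\<close>
    let ?a = "1 / sqrt (coeffE w p)" and ?b = "1 / sqrt (coeffG w p)"
    have ab: "?a\<^sup>2 * coeffE w p = 1" "?b\<^sup>2 * coeffG w p = 1" using E_pos[OF p] G_pos[OF p] by (auto simp:
        power_divide)
    have "natural_pde (mF k a) (mG k a) ?a ?b (\<nu> p) \<nu> p" by (rule natural_pde[OF EG' p ab p])
    moreover have "natural_pde (mF k a) (mG k a) ?a ?b (\<nu> p) \<nu> p \<longleftrightarrow> natural_pde (mF k a) (mG k a) ?a ?b (\<nu> p)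
        (\<lambda>r. substitution c (l r)) p"
    proof -
      have pd: "pd_u \<nu> q = pd_u (\<lambda>r. substitution c (l r)) q" "pd_v \<nu> q = pd_v (\<lambda>r. substitution c (l r)) q" if
          "q \<in> U" for q
        using has_pd_imp[OF has_pd_cong[OF has_pd_nu'[OF that] D(1) that \<nu>l]] by auto
      have "pd_u (pd_u \<nu>) p = pd_u (pd_u (\<lambda>r. substitution c (l r))) p"
        using has_pd_imp(1)[OF has_pd_cong[OF has_pdI[OF smooth_pd(1)[OF nu(1)] p] D(1) p pd(1)]] by simp
      moreover have "pd_v (pd_v \<nu>) p = pd_v (pd_v (\<lambda>r. substitution c (l r))) p"
        using has_pd_imp(2)[OF has_pd_cong[OF has_pdI[OF smooth_pd(2)[OF nu(1)] p] D(1) p pd(2)]] by simp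
      ultimately show ?thesis unfolding natural_pde_def using pd[OF p] \<nu>l[OF p] by simp
    qed
    ultimately show ?thesis
      using pb[OF p ab] p D(1) ls \<nu>l unfolding pde_becomes_def smooth_on_def by (metis imageI)
  qed
  then show ?thesis unfolding has_natural_pde_of_def \<nu>_def[symmetric]
    using wg natural_params[OF EG'] pb ls \<nu>l by blast
qed

end

section \<open>Natural parameters near a point whose parallel surface belongs to a basic
  class\<close>

lemma principal_surface_subset:
  "principal_surface z D \<Longrightarrow> open S \<Longrightarrow> connected S \<Longrightarrow> S \<subseteq> D \<Longrightarrow> principal_surface z S"
  unfolding principal_surface_def by (meson smooth_on_subset subsetD)

lemma codazzi_type_subset: "codazzi_type z D \<Longrightarrow> S \<subseteq> D \<Longrightarrow> codazzi_type z S"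
  unfolding codazzi_type_def by blast

text \<open>The new denominator is the reciprocal of \<open>1 - a * n\<close>, hence nonzero, and
  \<epsilon> is its own inverse.\<close>

lemma moebius_inverse:
  fixes n :: real
  assumes "x = \<epsilon> * n / (c * (1 - a * n))" "1 - a * n \<noteq> 0" "c > 0" "\<bar>\<epsilon>\<bar> = 1"
  shows "1 + \<epsilon> * c * a * x \<noteq> 0" "n = \<epsilon> * c * x / (1 + \<epsilon> * c * a * x)"
proof -
  have \<epsilon>: "\<epsilon> * \<epsilon> = 1" using assms(4) by (metis abs_mult_self_eq mult_1)
  have cx: "\<epsilon> * c * x = n / (1 - a * n)"
    using assms \<epsilon> by (simp add: mult.assoc[symmetric])
  have "1 + \<epsilon> * c * a * x = 1 + a * (\<epsilon> * c * x)" by simp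
  also have "\<dots> = 1 / (1 - a * n)" unfolding cx using assms(2) by (simp add: field_simps)
  finally have d: "1 + \<epsilon> * c * a * x = 1 / (1 - a * n)" .
  show "1 + \<epsilon> * c * a * x \<noteq> 0" "n = \<epsilon> * c * x / (1 + \<epsilon> * c * a * x)"
    unfolding d cx using assms(2) by auto
qed

context principal
begin

definition parallel_factor where "parallel_factor a p = (1 - a * nu1 z p) * (1 - a * nu2 z p)"

lemma open_parallel_factor_sign:
  assumes "open W" "W \<subseteq> D" and \<epsilon>: "\<bar>\<epsilon>\<bar> = 1"
  shows "open {p \<in> W. sgn (parallel_factor a p) = \<epsilon>}"
proof -
  have "continuous_on W (parallel_factor a)" unfolding parallel_factor_def[abs_def]
    by (intro continuous_intros continuous_on_subset[OF smooth_continuous_on assms(2)] coeffs_smooth)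
  then have "open (W \<inter> parallel_factor a -` {t. \<epsilon> * t > 0})"
    by (intro continuous_open_preimage assms open_Collect_less continuous_intros)
  moreover have "W \<inter> parallel_factor a -` {t. \<epsilon> * t > 0} = {p \<in> W. sgn (parallel_factor a p) = \<epsilon>}"
  proof -
    have "\<epsilon> * t > 0 \<longleftrightarrow> sgn t = \<epsilon>" for t
    proof -
      have "\<epsilon> = 1 \<or> \<epsilon> = - 1" using \<epsilon> by auto
      then show ?thesis by (auto simp: sgn_if)
    qed
    then show ?thesis by auto
  qed
  ultimately show ?thesis by simp
qed

end

context class_data
begin

text \<open>The change of parameters is built from the coefficients of \<open>z\<close> but applied
  to \<open>y\<close> as well. It preserves parameter lines and orientation, so
  \<open>y \<circ> \<phi>\<close> keeps the curvatures and the relation of the class, and its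
  geometric function is \<open>\<nu> \<circ> \<phi>\<close>.\<close>

lemma natural_parameters_exist:
  assumes z: "oriented_surface z D" and c0: "c0 > 0"
    and W: "open W" "W \<subseteq> parallel_domain a z D" "p0 \<in> W"
  defines "y \<equiv> (\<lambda>x. c0 *\<^sub>R x) \<circ> parallel a z"
  assumes cr: "\<And>p. p \<in> W \<Longrightarrow> curvature_relation c (curvK y p) (curvH y p) (curvH' y p)"
  shows "\<exists>\<phi> U V. reparam \<phi> U V \<and> p0 \<in> V \<and> V \<subseteq> W \<and> basic_surface c (y \<circ> \<phi>) U \<and>
    has_natural_pde_of (z \<circ> \<phi>) U (geometric_function c (y \<circ> \<phi>)) c"
proof -
  have z': "principal_surface z D" "codazzi_type z D" using z by (auto simp: oriented_surface_iff)
  interpret Z: principal z D using z' by unfold_locales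
  have WD: "W \<subseteq> D" using W(2) by (auto simp: parallel_domain_def)
  define \<epsilon> where "\<epsilon> = sgn (Z.parallel_factor a p0)"
  have \<epsilon>: "\<bar>\<epsilon>\<bar> = 1" using W(2,3) unfolding \<epsilon>_def Z.parallel_factor_def parallel_domain_def by (auto simp: abs_sgn_eq)
  have "open {p \<in> W. sgn (Z.parallel_factor a p) = \<epsilon>}" by (rule Z.open_parallel_factor_sign[OF W(1) WD \<epsilon>])
  moreover have "p0 \<in> {p \<in> W. sgn (Z.parallel_factor a p) = \<epsilon>}" using W(3) by (simp add: \<epsilon>_def)
  \<comment> \<open>A ball is connected, as a parameter domain has to be, and on it the sign
    \<epsilon> is fixed, so that a single Moebius map relates the curvatures.\<close>
  ultimately obtain r where r: "r > 0" "ball p0 r \<subseteq> {p \<in> W. sgn (Z.parallel_factor a p) = \<epsilon>}" using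
      open_contains_ball by blast
  define S where "S = ball p0 r"
  have S: "open S" "connected S" "p0 \<in> S" "S \<subseteq> W" using r by (auto simp: S_def)
  have sS: "sgn ((1 - a * nu1 z p) * (1 - a * nu2 z p)) = \<epsilon>" if "p \<in> S" for p
    using that r by (auto simp: S_def Z.parallel_factor_def)
  have SD: "S \<subseteq> D" using S WD by blast
  have zS: "principal_surface z S" "codazzi_type z S"
    using principal_surface_subset[OF z'(1) S(1,2) SD] codazzi_type_subset[OF z'(2) SD] by auto
  interpret ZS: principal z S using zS by unfold_locales
  note ps = ZS.parallel_surf[OF S(1) order_refl c0 \<epsilon> sS, folded y_def]
  have yS: "principal_surface y S" "codazzi_type y S" using ps S(2) zS(2) by auto
  interpret YS: principal y S using yS by unfold_locales
  define k where "k = \<epsilon> * c0"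
  have k: "k \<noteq> 0" using \<epsilon> c0 by (auto simp: k_def)
  have ne: "1 - a * nu1 z p \<noteq> 0" "1 - a * nu2 z p \<noteq> 0" if "p \<in> S" for p
    using sS[OF that] \<epsilon> by auto
  have inv: "1 + k * a * nu1 y p \<noteq> 0" "nu1 z p = k * nu1 y p / (1 + k * a * nu1 y p)"
    "1 + k * a * nu2 y p \<noteq> 0" "nu2 z p = k * nu2 y p / (1 + k * a * nu2 y p)" if "p \<in> S" for p
    using moebius_inverse[OF ps(2) ne(1) c0 \<epsilon>] moebius_inverse[OF ps(3) ne(2) c0 \<epsilon>] that unfolding k_def by auto
  have crS: "curvature_relation c (curvK y p) (curvH y p) (curvH' y p)" if "p \<in> S" for p using that S(4) cr by blast
  define \<nu> where "\<nu> = geometric_function c y"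
  note gi = geo_image[OF yS(1) zS k crS inv(1,3) inv(2,4), folded \<nu>_def]
  interpret weingarten_pair z S "\<nu> ` S" "mF k a" "mF1 k a" "mG k a" "mG1 k a" "mPhi k a" \<nu>
    using gi(1) by simp
  \<comment> \<open>The factors k^2 A and B are built in so that \<alpha>^2 e = 1 and \<beta>^2 h =
    1 become the normalisation of E and G required by \<open>has_natural_pde\<close>.\<close>
  define e where "e = (\<lambda>p. k\<^sup>2 * A * (coeffE z p * mPhi k a (\<nu> p)))"
  define h where "h = (\<lambda>p. B * (coeffG z p * \<Psi> (\<nu> p)))"
  have smPhi: "smooth_on S (\<lambda>p. mPhi k a (\<nu> p))"
  proof (rule smooth_on_cong[OF S(1)])
    show "smooth_on S (\<lambda>p. \<Phi> (\<nu> p) / ((1 + k * a * nu1 y p) * (1 + k * a * nu1 y p)))"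
      by (intro smooth_divide Phi_smooth smooth_mult smooth_add smooth_const S(1) nu(1) YS.coeffs_smooth gi(3))
         (use inv(1) in auto)
  qed (simp add: mPhi_def power2_eq_square gi(6))
  have smPsi: "smooth_on S (\<lambda>p. \<Psi> (\<nu> p))"
  proof (rule smooth_on_cong[OF S(1)])
    show "smooth_on S (\<lambda>p. (nu1 z p - nu2 z p) * (nu1 z p - nu2 z p) / mPhi k a (\<nu> p))"
      by (intro smooth_divide smooth_mult smooth_diff S(1) smPhi ZS.coeffs_smooth)
         (use \<Phi>(1) in force)
  qed (simp add: \<Psi>_def power2_eq_square nu(3,4))
  note Wnu = nu and CPhi = \<Phi>(1)
  have pos: "e p > 0" "h p > 0" if "p \<in> S" for p
    using ZS.E_pos[OF that] ZS.G_pos[OF that] CPhi[OF Wnu(2)[OF that]] Psi_pos[OF Wnu(2)[OF that]]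
        class_data.pos(1,2)[OF class_data_axioms] k
    by (auto simp: e_def h_def)
  have sm_eh: "smooth_on S e" "smooth_on S h" unfolding e_def h_def
    by (intro smooth_mult smooth_const S(1) ZS.coeffs_smooth smPhi smPsi)+
  have dv: "pd_v e p = 0" if p: "p \<in> S" for p
  proof -
    obtain d where "has_pd (\<lambda>q. coeffE z q * mPhi k a (\<nu> q)) d 0 p" using EPhi_v[OF p] by blast
    from has_pd_mult[OF has_pd_const this, of "k\<^sup>2 * A"] show ?thesis unfolding e_def by (simp add: has_pd_imp)
  qed
  have du: "pd_u h p = 0" if p: "p \<in> S" for p
  proof -
    obtain d where "has_pd (\<lambda>q. coeffG z q * \<Psi> (\<nu> q)) 0 d p" using GPsi_u[OF p] by blast
    from has_pd_mult[OF has_pd_const this, of B] show ?thesis unfolding h_def by (simp add: has_pd_imp)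
  qed
  obtain \<phi> U V \<alpha> \<beta> where \<phi>: "reparam \<phi> U V" "p0 \<in> V" "V \<subseteq> S"
    "\<forall>p\<in>U. \<phi> p \<in> V \<and> has_pd \<phi> (\<alpha> p, 0) (0, \<beta> p) p \<and> \<alpha> p > 0 \<and> \<beta> p > 0 \<and> (\<alpha> p)\<^sup>2 * e (\<phi> p) = 1 \<and> (\<beta> p)\<^sup>2 * h (\<phi> p) = 1"
    using local_rescaling[OF S(1,3) sm_eh pos dv du] by metis
  have U: "open U" "connected U" "smooth_on U \<phi>" using \<phi>(1) by (auto simp: reparam_def)
  have \<phi>S: "\<phi> p \<in> S" "has_pd \<phi> (\<alpha> p, 0) (0, \<beta> p) p" "\<alpha> p > 0 \<and> \<beta> p > 0" "(\<alpha> p)\<^sup>2 * e (\<phi> p) = 1" "(\<beta> p)\<^sup>2 * h (\<phi>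
      p) = 1"
    if "p \<in> U" for p using \<phi>(3,4) that by auto
  note dz = ZS.diag_surf[OF U(1,2) \<phi>S(1) U(3) \<phi>S(2,3)] and dy = YS.diag_surf[OF U(1,2) \<phi>S(1) U(3) \<phi>S(2,3)]
  have zU: "principal_surface (z \<circ> \<phi>) U" "codazzi_type (z \<circ> \<phi>) U" using dz zS(2) by auto
  have yU: "principal_surface (y \<circ> \<phi>) U" "codazzi_type (y \<circ> \<phi>) U" using dy yS(2) by auto
  have zn: "nu1 (z \<circ> \<phi>) p = nu1 z (\<phi> p)" "nu2 (z \<circ> \<phi>) p = nu2 z (\<phi> p)"
    and zEG: "coeffE (z \<circ> \<phi>) p = (\<alpha> p)\<^sup>2 * coeffE z (\<phi> p)" "coeffG (z \<circ> \<phi>) p = (\<beta> p)\<^sup>2 * coeffG z (\<phi> p)"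
    and yn: "nu1 (y \<circ> \<phi>) p = nu1 y (\<phi> p)" "nu2 (y \<circ> \<phi>) p = nu2 y (\<phi> p)" if "p \<in> U" for p
    using dz(2-5) dy(4,5) that by auto
  have crU: "curvature_relation c (curvK (y \<circ> \<phi>) p) (curvH (y \<circ> \<phi>) p) (curvH' (y \<circ> \<phi>) p)" if "p \<in> U" for p
    using crS[OF \<phi>S(1)[OF that]] yn[OF that] by (simp add: curvK_def curvH_def curvH'_def)
  have g\<nu>: "geometric_function c (y \<circ> \<phi>) p = \<nu> (\<phi> p)" if "p \<in> U" for p
    using yn[OF that] by (simp add: \<nu>_def geo)
  have hn: "has_natural_pde_of (z \<circ> \<phi>) U (geometric_function c (y \<circ> \<phi>)) c"
  proof (rule has_natural_pde[OF yU(1) zU k crU])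
    fix p assume p: "p \<in> U"
    note q = \<phi>S(1)[OF p]
    show "1 + k * a * nu1 (y \<circ> \<phi>) p \<noteq> 0" "1 + k * a * nu2 (y \<circ> \<phi>) p \<noteq> 0"
      "nu1 (z \<circ> \<phi>) p = k * nu1 (y \<circ> \<phi>) p / (1 + k * a * nu1 (y \<circ> \<phi>) p)"
      "nu2 (z \<circ> \<phi>) p = k * nu2 (y \<circ> \<phi>) p / (1 + k * a * nu2 (y \<circ> \<phi>) p)"
      unfolding yn[OF p] zn[OF p] using inv[OF q] by auto
    show "coeffE (z \<circ> \<phi>) p * mPhi k a (geometric_function c (y \<circ> \<phi>) p) = 1 / (k\<^sup>2 * A)"
      using \<phi>S(4)[OF p] k class_data.pos(1)[OF class_data_axioms] unfolding zEG[OF p] g\<nu>[OF p] e_def by (simp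
          add: field_simps)
    show "coeffG (z \<circ> \<phi>) p * mPsi k a (geometric_function c (y \<circ> \<phi>) p) = 1 / B"
      using \<phi>S(5)[OF p] class_data.pos(2)[OF class_data_axioms] unfolding zEG[OF p] g\<nu>[OF p] h_def mPsi_def by
          (simp add: field_simps)
  qed
  have "basic_surface c (y \<circ> \<phi>) U" unfolding basic_surface_def oriented_surface_iff using yU crU by blast
  then show ?thesis using \<phi>(1,2,3) S(4) hn by blast
qed

end

section \<open>The linear relation under parallel displacement, scaling and reversal of the
  normal\<close>

lemma parallel_curvature_relation:
  fixes n1 n2 :: real
  assumes lin: "\<delta> * (n1 * n2) = \<alpha> * ((n1 + n2) / 2) + \<beta> * ((n1 - n2) / 2) + \<gamma>"
    and nz: "1 - a * n1 \<noteq> 0" "1 - a * n2 \<noteq> 0" and c: "c > 0" and \<epsilon>: "\<bar>\<epsilon>\<bar> = 1"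
    and xy: "x = \<epsilon> * n1 / (c * (1 - a * n1))" "y = \<epsilon> * n2 / (c * (1 - a * n2))"
  shows "(\<delta> - \<alpha> * a - \<gamma> * a\<^sup>2) * c\<^sup>2 * (x * y) = \<epsilon> * c * (\<alpha> + 2 * \<gamma> * a) * ((x + y) / 2) + \<epsilon> * c * \<beta> * ((x - y)
      / 2) + \<gamma>"
proof -
  \<comment> \<open>\<open>X\<close> and \<open>Y\<close> are the curvatures of the parallel surface
    before scaling and choice of sign. Since n1 = X / (1 + a X), multiplication by (1 + a X) (1 + a
    Y) clears all denominators; in the difference of the curvatures the mixed terms cancel, so
    \<beta> survives unchanged.\<close>
  define X Y where "X = n1 / (1 - a * n1)" and "Y = n2 / (1 - a * n2)"
  have \<epsilon>1: "\<epsilon> * \<epsilon> = 1" using \<epsilon> by (metis abs_mult_self_eq mult_1)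
  have x: "\<epsilon> * c * x = X" "\<epsilon> * c * y = Y" using c \<epsilon>1 unfolding xy X_def Y_def by (simp_all add: mult.assoc[symmetric])
  have "c\<^sup>2 * (x * y) = (\<epsilon> * c * x) * (\<epsilon> * c * y)" using \<epsilon>1 by (simp add: power2_eq_square)
  then have xy2: "c\<^sup>2 * (x * y) = X * Y" unfolding x .
  have X: "n1 * (1 + a * X) = X" "n2 * (1 + a * Y) = Y" using nz by (simp_all add: X_def Y_def field_simps)
  have "\<delta> * ((n1 * (1 + a * X)) * (n2 * (1 + a * Y))) = (\<delta> * (n1 * n2)) * ((1 + a * X) * (1 + a * Y))" by (simp
      add: mult_ac)
  also have "\<dots> = \<alpha> * ((n1 * (1 + a * X) * (1 + a * Y) + n2 * (1 + a * Y) * (1 + a * X)) / 2) +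
     \<beta> * ((n1 * (1 + a * X) * (1 + a * Y) - n2 * (1 + a * Y) * (1 + a * X)) / 2) + \<gamma> * ((1 + a * X) * (1 + a * Y))"
    unfolding lin by (simp add: field_simps)
  finally have "\<delta> * (X * Y) = \<alpha> * ((X * (1 + a * Y) + Y * (1 + a * X)) / 2) + \<beta> * ((X * (1 + a * Y) - Y * (1 + a
      * X)) / 2)
    + \<gamma> * ((1 + a * X) * (1 + a * Y))" unfolding X .
  then have "(\<delta> - \<alpha> * a - \<gamma> * a\<^sup>2) * (X * Y) = (\<alpha> + 2 * \<gamma> * a) * ((X + Y) / 2) + \<beta> * ((X - Y) / 2) + \<gamma>"
    by (simp add: field_simps power2_eq_square)
  moreover have "\<epsilon> * c * (\<alpha> + 2 * \<gamma> * a) * ((x + y) / 2) = (\<alpha> + 2 * \<gamma> * a) * ((X + Y) / 2)"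
    unfolding x[symmetric] by (simp add: algebra_simps add_divide_distrib diff_divide_distrib)
  moreover have "\<epsilon> * c * \<beta> * ((x - y) / 2) = \<beta> * ((X - Y) / 2)"
    unfolding x[symmetric] by (simp add: algebra_simps add_divide_distrib diff_divide_distrib)
  ultimately show ?thesis using xy2 by (simp only: mult.assoc)
qed

text \<open>\<open>R\<close> is the algebra left to the individual cases: for numbers ordered like
  \<nu>2 < \<nu>1, the transformed relation has to imply that of the class. Restriction to the
  points with the same sign \<epsilon> as \<open>p0\<close> makes the transformed relation
  uniform.\<close>

lemma parallel_step:
  assumes z: "oriented_surface z D" and lin: "\<And>p. p \<in> D \<Longrightarrow> \<delta> * curvK z p = \<alpha> * curvH z p + \<beta> * curvH' z p + \<gamma>"
    and p0: "p0 \<in> parallel_domain a z D" and \<epsilon>: "\<epsilon> = sgn ((1 - a * nu1 z p0) * (1 - a * nu2 z p0))" and k: "k > 0"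
    and c: "valid_class c"
    and R: "\<And>x y. y < x \<Longrightarrow> (\<delta> - \<alpha> * a - \<gamma> * a\<^sup>2) * k\<^sup>2 * (x * y) =
        \<epsilon> * k * (\<alpha> + 2 * \<gamma> * a) * ((x + y) / 2) + \<epsilon> * k * \<beta> * ((x - y) / 2) + \<gamma> \<Longrightarrow>
      curvature_relation c (x * y) ((x + y) / 2) ((x - y) / 2)"
  shows "\<exists>\<phi> U V. reparam \<phi> U V \<and> p0 \<in> V \<and> V \<subseteq> parallel_domain a z D \<and>
    basic_surface c ((\<lambda>x. k *\<^sub>R x) \<circ> parallel a z \<circ> \<phi>) U \<and>
    has_natural_pde_of (z \<circ> \<phi>) U (geometric_function c ((\<lambda>x. k *\<^sub>R x) \<circ> parallel a z \<circ> \<phi>)) c"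
proof -
  have z': "principal_surface z D" using z by (auto simp: oriented_surface_iff)
  interpret principal z D using z' by unfold_locales
  have \<epsilon>1: "\<bar>\<epsilon>\<bar> = 1" using p0 unfolding \<epsilon> parallel_domain_def by (auto simp: abs_sgn_eq)
  define W where "W = {p \<in> D. sgn (parallel_factor a p) = \<epsilon>}"
  have W: "open W" "W \<subseteq> D" "p0 \<in> W" using open_parallel_factor_sign[OF D(1) order_refl \<epsilon>1] p0 unfolding W_def \<epsilon>
    by (auto simp: parallel_factor_def parallel_domain_def)
  have s: "sgn ((1 - a * nu1 z p) * (1 - a * nu2 z p)) = \<epsilon>" if "p \<in> W" for p
    using that by (simp add: W_def parallel_factor_def)
  have nz: "1 - a * nu1 z p \<noteq> 0" "1 - a * nu2 z p \<noteq> 0" if "p \<in> W" for p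
    using s[OF that] \<epsilon>1 by auto
  have WP: "W \<subseteq> parallel_domain a z D" using W nz by (auto simp: parallel_domain_def)
  let ?y = "(\<lambda>x. k *\<^sub>R x) \<circ> parallel a z"
  note ps = parallel_surf[OF W(1,2) k \<epsilon>1 s]
  have cr: "curvature_relation c (curvK ?y p) (curvH ?y p) (curvH' ?y p)" if p: "p \<in> W" for p
  proof -
    have "\<delta> * (nu1 z p * nu2 z p) = \<alpha> * ((nu1 z p + nu2 z p) / 2) + \<beta> * ((nu1 z p - nu2 z p) / 2) + \<gamma>"
      using lin[of p] p W(2) by (auto simp: curvK_def curvH_def curvH'_def)
    from R[OF ps(5) parallel_curvature_relation[OF this nz[OF p] k \<epsilon>1 ps(2,3)]] p
    show ?thesis by (simp add: curvK_def curvH_def curvH'_def)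
  qed
  obtain dom geo F F1 G G1 \<Phi> s1 linv m m1 n n1 \<mu> \<eta> A B where cd: "class_data c dom geo F F1 G G1 \<Phi> s1 linv m m1
      n n1 \<mu> \<eta> A B"
    using class_data_exists[OF c] by metis
  from class_data.natural_parameters_exist[OF cd z k W(1) WP W(3) cr] show ?thesis using WP by (meson order_trans)
qed

lemma reparam_swap:
  assumes "reparam \<phi> U V" shows "reparam (prod.swap \<circ> \<phi>) U (prod.swap -` V)"
proof -
  have r: "open U" "connected U" "open V" "bij_betw \<phi> U V" "smooth_on U \<phi>" "smooth_on V (the_inv_into U \<phi>)"
    using assms by (auto simp: reparam_def)
  have V': "open (prod.swap -` V)" by (rule open_swap[OF r(3)])
  have bs: "bij_betw prod.swap V (prod.swap -` V)"
    by (rule bij_betw_byWitness[where f' = prod.swap]) auto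
  have bij: "bij_betw (prod.swap \<circ> \<phi>) U (prod.swap -` V)" by (rule bij_betw_trans[OF r(4) bs])
  have sm: "smooth_on U (prod.swap \<circ> \<phi>)"
    using smooth_comp[OF r(3,1) smooth_swap[OF r(3)] r(5)] r(4) by (auto simp: bij_betw_def)
  have "smooth_on (prod.swap -` V) (the_inv_into U (prod.swap \<circ> \<phi>))"
  proof (rule smooth_on_cong[OF V'])
    show "smooth_on (prod.swap -` V) (the_inv_into U \<phi> \<circ> prod.swap)"
      by (rule smooth_comp[OF r(3) V' r(6) smooth_swap[OF V']]) auto
    fix p assume p: "p \<in> prod.swap -` V"
    have q: "prod.swap p \<in> \<phi> ` U" using p r(4) by (auto simp: bij_betw_def)
    have inj: "inj_on \<phi> U" using r(4) by (simp add: bij_betw_def)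
    have "the_inv_into U (prod.swap \<circ> \<phi>) p = the_inv_into U \<phi> (prod.swap p)"
      by (rule the_inv_into_f_eq[OF bij_betw_imp_inj_on[OF bij]])
         (use f_the_inv_into_f[OF inj q] the_inv_into_into[OF inj q] in auto)
    then show "(the_inv_into U \<phi> \<circ> prod.swap) p = the_inv_into U (prod.swap \<circ> \<phi>) p" by simp
  qed
  then show ?thesis unfolding reparam_def using r V' bij sm by blast
qed

text \<open>The unswapped version is applied to \<open>z \<circ> prod.swap\<close> at distance -a.
  There K and H' are as before while H has changed sign, whence the minus sign in \<open>R\<close>;
  the exchange of the parameters is finally absorbed into \<phi>.\<close>

lemma parallel_step_swap:
  assumes z: "oriented_surface z D" and lin: "\<And>p. p \<in> D \<Longrightarrow> \<delta> * curvK z p = \<alpha> * curvH z p + \<beta> * curvH' z p + \<gamma>"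
    and p0: "p0 \<in> parallel_domain a z D" and \<epsilon>: "\<epsilon> = sgn ((1 - a * nu1 z p0) * (1 - a * nu2 z p0))" and k: "k > 0"
    and c: "valid_class c"
    and R: "\<And>x y. y < x \<Longrightarrow> (\<delta> - \<alpha> * a - \<gamma> * a\<^sup>2) * k\<^sup>2 * (x * y) =
        - (\<epsilon> * k * (\<alpha> + 2 * \<gamma> * a) * ((x + y) / 2)) + \<epsilon> * k * \<beta> * ((x - y) / 2) + \<gamma> \<Longrightarrow>
      curvature_relation c (x * y) ((x + y) / 2) ((x - y) / 2)"
  shows "\<exists>\<phi> U V. reparam \<phi> U V \<and> p0 \<in> V \<and> V \<subseteq> parallel_domain a z D \<and>
    basic_surface c ((\<lambda>x. k *\<^sub>R x) \<circ> parallel a z \<circ> \<phi>) U \<and>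
    has_natural_pde_of (z \<circ> \<phi>) U (geometric_function c ((\<lambda>x. k *\<^sub>R x) \<circ> parallel a z \<circ> \<phi>)) c"
proof -
  let ?z = "z \<circ> prod.swap" and ?D = "prod.swap -` D"
  have pd: "parallel_domain (- a) ?z ?D = prod.swap -` parallel_domain a z D"
    by (auto simp: parallel_domain_def swap_surf)
  have "\<exists>\<phi> U V. reparam \<phi> U V \<and> prod.swap p0 \<in> V \<and> V \<subseteq> parallel_domain (- a) ?z ?D \<and>
    basic_surface c ((\<lambda>x. k *\<^sub>R x) \<circ> parallel (- a) ?z \<circ> \<phi>) U \<and>
    has_natural_pde_of (?z \<circ> \<phi>) U (geometric_function c ((\<lambda>x. k *\<^sub>R x) \<circ> parallel (- a) ?z \<circ> \<phi>)) c"
  proof (rule parallel_step[OF swap_oriented[OF z] _ _ _ k c])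
    show "\<delta> * curvK ?z p = - \<alpha> * curvH ?z p + \<beta> * curvH' ?z p + \<gamma>" if "p \<in> ?D" for p
      using lin[of "prod.swap p"] that by (simp add: curvK_def curvH_def curvH'_def swap_surf mult.commute
          field_simps)
    show "prod.swap p0 \<in> parallel_domain (- a) ?z ?D" using p0 by (simp add: pd)
    show "\<epsilon> = sgn ((1 - - a * nu1 ?z (prod.swap p0)) * (1 - - a * nu2 ?z (prod.swap p0)))"
      by (simp add: swap_surf \<epsilon> mult.commute)
    show "curvature_relation c (x * y) ((x + y) / 2) ((x - y) / 2)"
      if "y < x" "(\<delta> - - \<alpha> * - a - \<gamma> * (- a)\<^sup>2) * k\<^sup>2 * (x * y) =
        \<epsilon> * k * (- \<alpha> + 2 * \<gamma> * - a) * ((x + y) / 2) + \<epsilon> * k * \<beta> * ((x - y) / 2) + \<gamma>" for x y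
    proof (rule R[OF that(1)])
      have e: "\<epsilon> * k * (- \<alpha> + 2 * \<gamma> * - a) * ((x + y) / 2) = - (\<epsilon> * k * (\<alpha> + 2 * \<gamma> * a) * ((x + y) / 2))"
        by (simp add: algebra_simps)
      show "(\<delta> - \<alpha> * a - \<gamma> * a\<^sup>2) * k\<^sup>2 * (x * y) =
        - (\<epsilon> * k * (\<alpha> + 2 * \<gamma> * a) * ((x + y) / 2)) + \<epsilon> * k * \<beta> * ((x - y) / 2) + \<gamma>"
        using that(2) unfolding e by simp
    qed
  qed
  then obtain \<phi> U V where \<phi>: "reparam \<phi> U V" "prod.swap p0 \<in> V" "V \<subseteq> parallel_domain (- a) ?z ?D"
    "basic_surface c ((\<lambda>x. k *\<^sub>R x) \<circ> parallel (- a) ?z \<circ> \<phi>) U"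
    "has_natural_pde_of (?z \<circ> \<phi>) U (geometric_function c ((\<lambda>x. k *\<^sub>R x) \<circ> parallel (- a) ?z \<circ> \<phi>)) c" by blast
  have "(\<lambda>x. k *\<^sub>R x) \<circ> parallel (- a) ?z \<circ> \<phi> = (\<lambda>x. k *\<^sub>R x) \<circ> parallel a z \<circ> (prod.swap \<circ> \<phi>)"
    unfolding parallel_swap[symmetric] by (simp add: o_assoc)
  moreover have "?z \<circ> \<phi> = z \<circ> (prod.swap \<circ> \<phi>)" by (simp add: o_assoc)
  moreover have "prod.swap -` V \<subseteq> parallel_domain a z D" using \<phi>(3) unfolding pd by fastforce
  ultimately show ?thesis using \<phi> reparam_swap[OF \<phi>(1)] by (metis vimageI2)
qed

section \<open>Density of the points where the parallel surface is regular\<close>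

lemma linear_relation_solve:
  fixes i :: real
  shows "\<delta> * (i * y) = \<alpha> * ((i + y) / 2) + \<beta> * ((i - y) / 2) + \<gamma> \<longleftrightarrow> (\<delta> * i - (\<alpha> - \<beta>) / 2) * y = (\<alpha> + \<beta>) / 2 * i + \<gamma>"
  by (simp add: field_simps)

text \<open>Outside the parallel domain \<nu>2 can take only two values: 1 / a, or the one that the
  relation assigns to \<nu>1 = 1 / a. As \<nu>2 has nonzero u-derivative, arbitrarily close points
  on the u-line avoid both.\<close>

lemma parallel_domain_dense:
  assumes det: "\<alpha>\<^sup>2 - \<beta>\<^sup>2 + 4 * \<gamma> * \<delta> \<noteq> 0" and z: "surface z D"
    and lin: "\<And>p. p \<in> D \<Longrightarrow> \<delta> * curvK z p = \<alpha> * curvH z p + \<beta> * curvH' z p + \<gamma>"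
  shows "D \<subseteq> closure (parallel_domain a z D)"
proof (cases "a = 0")
  case True
  then show ?thesis using closure_subset by (auto simp: parallel_domain_def)
next
  case a: False
  interpret principal z D using z by unfold_locales (simp add: surface_def)
  let ?q = "\<delta> / a - (\<alpha> - \<beta>) / 2" and ?r = "(\<alpha> + \<beta>) / (2 * a) + \<gamma>"
  have bad: "nu2 z p \<in> {1 / a, ?r / ?q}" if p: "p \<in> D" "p \<notin> parallel_domain a z D" for p
  proof (cases "1 - a * nu2 z p = 0")
    case True
    then show ?thesis using a by (simp add: field_simps)
  next
    case False
    then have "1 - a * nu1 z p = 0" using p by (simp add: parallel_domain_def)
    then have n1: "nu1 z p = 1 / a" using a by (simp add: field_simps)
    have "\<delta> * (1 / a * nu2 z p) = \<alpha> * ((1 / a + nu2 z p) / 2) + \<beta> * ((1 / a - nu2 z p) / 2) + \<gamma>"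
      using lin[OF p(1)] by (simp add: curvK_def curvH_def curvH'_def n1)
    then have "(\<delta> * (1 / a) - (\<alpha> - \<beta>) / 2) * nu2 z p = (\<alpha> + \<beta>) / 2 * (1 / a) + \<gamma>"
      by (simp only: linear_relation_solve)
    then have e: "?q * nu2 z p = ?r" by simp
    \<comment> \<open>If the relation failed to determine \<nu>2 from \<nu>1 = 1 / a, both
      coefficients would vanish, and the product of these two equations would make the discriminant
      zero.\<close>
    have "?q \<noteq> 0"
    proof
      assume q0: "?q = 0"
      then have "?r = 0" using e unfolding q0 by simp
      then have "\<alpha> + \<beta> = - 2 * a * \<gamma>" "2 * \<delta> = a * (\<alpha> - \<beta>)" using q0 a by (simp_all add: field_simps)
      then have "(\<alpha> + \<beta>) * (a * (\<alpha> - \<beta>)) = - 2 * a * \<gamma> * (2 * \<delta>)" by simp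
      then have "a * (\<alpha>\<^sup>2 - \<beta>\<^sup>2 + 4 * \<gamma> * \<delta>) = 0" by (simp add: power2_eq_square algebra_simps)
      then show False using det a by simp
    qed
    then have "nu2 z p = ?r / ?q" using e by (simp add: field_simps)
    then show ?thesis by simp
  qed
  show ?thesis
  proof
    fix p assume p: "p \<in> D"
    show "p \<in> closure (parallel_domain a z D)" unfolding closure_approachable
    proof (intro allI impI)
      fix e :: real assume e: "e > 0"
      let ?h = "\<lambda>t. nu2 z (t, snd p)"
      have h: "(?h has_real_derivative pd_u (nu2 z) p) (at (fst p))"
        using has_pd_u[OF has_pd_nu(2)[OF p]] by (simp add: has_real_derivative_iff_has_vector_derivative)
      \<comment> \<open>Immediately to the right of \<open>p\<close> every fixed value
        \<open>b\<close> is avoided: by the nonzero derivative if \<open>b\<close> is the value at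
        \<open>p\<close>, by continuity otherwise.\<close>
      have ev: "eventually (\<lambda>t. ?h t \<noteq> b) (at_right (fst p))" for b
      proof (cases "b = nu2 z p")
        case True
        have "pd_u (nu2 z) p \<noteq> 0" by (rule surface_nu2[OF z p])
        then have "\<exists>d>0. \<forall>y>0. y < d \<longrightarrow> ?h (fst p + y) \<noteq> b"
          using DERIV_pos_inc_right[OF h] DERIV_neg_dec_right[OF h] True by (cases "pd_u (nu2 z) p > 0") fastforce+
        then obtain d where d: "d > 0" "\<forall>y>0. y < d \<longrightarrow> ?h (fst p + y) \<noteq> b" by blast
        have "?h t \<noteq> b" if "fst p < t" "t < fst p + d" for t using d(2)[rule_format, of "t - fst p"] that by simp
        then show ?thesis unfolding eventually_at_right_field using d(1) by (intro exI[of _ "fst p + d"]) auto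
      next
        case False
        have "(?h \<longlongrightarrow> ?h (fst p)) (at_right (fst p))"
          by (rule tendsto_within_subset[OF DERIV_isCont[OF h, unfolded isCont_def] subset_UNIV])
        then show ?thesis by (rule tendsto_imp_eventually_ne) (use False in simp)
      qed
      have "isCont (\<lambda>t. (t, snd p)) (fst p)" by (intro continuous_intros)
      then have t: "((\<lambda>t. (t, snd p)) \<longlongrightarrow> p) (at_right (fst p))"
        unfolding isCont_def by (auto intro: tendsto_within_subset)
      have "eventually (\<lambda>t. (t, snd p) \<in> D) (at_right (fst p))"
        using topological_tendstoD[OF t D(1) p] .
      moreover have "eventually (\<lambda>t. dist (t, snd p) p < e) (at_right (fst p))" using tendstoD[OF t e] .
      ultimately have "eventually (\<lambda>t. (t, snd p) \<in> D \<and> dist (t, snd p) p < e \<and> ?h t \<noteq> 1 / a \<and> ?h t \<noteq> ?r / ?q)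
          (at_right (fst p))"
        using ev by (intro eventually_conj) auto
      then obtain t where "(t, snd p) \<in> D \<and> dist (t, snd p) p < e \<and> ?h t \<noteq> 1 / a \<and> ?h t \<noteq> ?r / ?q"
        using eventually_happens'[OF trivial_limit_at_right_real] by blast
      then show "\<exists>q\<in>parallel_domain a z D. dist q p < e" using bad[of "(t, snd p)"] by blast
    qed
  qed
qed

section \<open>The case distinction leading to the ten classes\<close>

definition described_by_basic_class :: "surf \<Rightarrow> (real \<times> real) set \<Rightarrow> real \<Rightarrow> real \<times> real \<Rightarrow> bool" where
  "described_by_basic_class z D a p0 \<longleftrightarrow> (\<exists>c \<phi> U V T.
     valid_class c \<and> similarity T \<and> reparam \<phi> U V \<and> p0 \<in> V \<and> V \<subseteq> parallel_domain a z D \<and>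
     (let z' = T \<circ> parallel a z \<circ> \<phi> in
        basic_surface c z' U \<and> has_natural_pde_of (z \<circ> \<phi>) U (geometric_function c z') c))"

lemma similarity_scaleR: "k > 0 \<Longrightarrow> similarity (\<lambda>x. k *\<^sub>R x)"
  unfolding similarity_def by (intro exI[of _ k]) (simp add: dist_norm scaleR_diff_right[symmetric])

text \<open>The value s = -1 stands for an additional reversal of the normal, which flips the sign
  of the H-term only. The similarity used is the scaling by \<open>k\<close>.\<close>

lemma described_by_basic_classI:
  assumes "surface z D" "\<And>p. p \<in> D \<Longrightarrow> \<delta> * curvK z p = \<alpha> * curvH z p + \<beta> * curvH' z p + \<gamma>"
    and "p0 \<in> parallel_domain a z D" "\<epsilon> = sgn ((1 - a * nu1 z p0) * (1 - a * nu2 z p0))" "k > 0" "valid_class c"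
    and "s = 1 \<or> s = - 1"
    and R: "\<And>x y. y < x \<Longrightarrow> (\<delta> - \<alpha> * a - \<gamma> * a\<^sup>2) * k\<^sup>2 * (x * y) =
        s * \<epsilon> * k * (\<alpha> + 2 * \<gamma> * a) * ((x + y) / 2) + \<epsilon> * k * \<beta> * ((x - y) / 2) + \<gamma> \<Longrightarrow>
      curvature_relation c (x * y) ((x + y) / 2) ((x - y) / 2)"
  shows "described_by_basic_class z D a p0"
proof -
  have z: "oriented_surface z D" using assms(1) by (simp add: oriented_surface_def)
  have "\<exists>\<phi> U V. reparam \<phi> U V \<and> p0 \<in> V \<and> V \<subseteq> parallel_domain a z D \<and>
    basic_surface c ((\<lambda>x. k *\<^sub>R x) \<circ> parallel a z \<circ> \<phi>) U \<and>
    has_natural_pde_of (z \<circ> \<phi>) U (geometric_function c ((\<lambda>x. k *\<^sub>R x) \<circ> parallel a z \<circ> \<phi>)) c"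
    using assms(7)
  proof
    assume "s = 1"
    then show ?thesis by (intro parallel_step[OF z assms(2-6)] R) auto
  next
    assume "s = - 1"
    then show ?thesis by (intro parallel_step_swap[OF z assms(2-6)] R) auto
  qed
  then show ?thesis unfolding described_by_basic_class_def Let_def using assms(5,6) similarity_scaleR by blast
qed

lemma parallel_domain_sgn:
  "p0 \<in> parallel_domain a z D \<Longrightarrow> \<epsilon> = sgn ((1 - a * nu1 z p0) * (1 - a * nu2 z p0)) \<Longrightarrow> \<epsilon> = 1 \<or> \<epsilon> = - 1"
  by (auto simp: parallel_domain_def sgn_if)

text \<open>By (\<alpha> + 2 \<gamma> a)^2 + 4 \<gamma> (\<delta> - \<alpha> a - \<gamma> a^2) =
  \<Delta>, the sign of \<Delta> decides whether K can be removed when \<gamma> is nonzero. Case A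
  leads to classes 1, 4, 5, case B to 9, case C to 2, 6, 7, case D to 3, and case E to 8 and
  10.\<close>

lemma parallel_basic_class_exists:
  assumes det: "\<alpha>\<^sup>2 - \<beta>\<^sup>2 + 4 * \<gamma> * \<delta> \<noteq> 0" and z: "surface z D"
    and lin: "\<And>p. p \<in> D \<Longrightarrow> \<delta> * curvK z p = \<alpha> * curvH z p + \<beta> * curvH' z p + \<gamma>"
  shows "\<exists>a. \<forall>p0\<in>parallel_domain a z D. described_by_basic_class z D a p0"
proof -
  interpret principal z D using z by unfold_locales (simp add: surface_def)
  define \<Delta> where "\<Delta> = \<alpha>\<^sup>2 + 4 * \<gamma> * \<delta>"
  consider (A) "\<gamma> = 0" "\<alpha> \<noteq> 0" | (B) "\<gamma> = 0" "\<alpha> = 0" | (C) "\<gamma> \<noteq> 0" "\<Delta> > 0" | (D) "\<gamma> \<noteq> 0" "\<Delta> = 0" | (E) "\<gamma> \<noteq> 0" "\<Delta> < 0"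
    by linarith
  then show ?thesis
  proof cases
    case A
    define b where "b = - \<beta> / \<alpha>"
    \<comment> \<open>With \<gamma> = 0 the discriminant is \<alpha>^2 - \<beta>^2; it excludes b =
      1 and b = -1, where H = b H' would make a principal curvature vanish.\<close>
    have b1: "b\<^sup>2 \<noteq> 1" using det A by (auto simp: b_def power_divide)
    define c where "c = (if b = 0 then Class1 else if b\<^sup>2 > 1 then Class4 b else Class5 b)"
    have c: "valid_class c" using b1 by (auto simp: c_def)
    have "described_by_basic_class z D (\<delta> / \<alpha>) p0" if p0: "p0 \<in> parallel_domain (\<delta> / \<alpha>) z D" for p0
    proof (rule described_by_basic_classI[OF z lin p0 refl _ c, of 1 1])
      fix x y :: real
      let ?\<epsilon> = "sgn ((1 - \<delta> / \<alpha> * nu1 z p0) * (1 - \<delta> / \<alpha> * nu2 z p0))"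
      assume R: "(\<delta> - \<alpha> * (\<delta> / \<alpha>) - \<gamma> * (\<delta> / \<alpha>)\<^sup>2) * 1\<^sup>2 * (x * y) =
        1 * ?\<epsilon> * 1 * (\<alpha> + 2 * \<gamma> * (\<delta> / \<alpha>)) * ((x + y) / 2) + ?\<epsilon> * 1 * \<beta> * ((x - y) / 2) + \<gamma>"
      have "?\<epsilon> \<noteq> 0" using parallel_domain_sgn[OF p0 refl] by auto
      moreover have "?\<epsilon> * (\<alpha> * ((x + y) / 2) + \<beta> * ((x - y) / 2)) = 0" using R A by (simp add: algebra_simps)
      ultimately have "\<alpha> * ((x + y) / 2) + \<beta> * ((x - y) / 2) = 0" by simp
      then have "(x + y) / 2 = b * ((x - y) / 2)" using A by (simp add: b_def field_simps)
      moreover from this have "b = 0 \<Longrightarrow> (x + y) / 2 = 0" by simp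
      ultimately show "curvature_relation c (x * y) ((x + y) / 2) ((x - y) / 2)" unfolding c_def by (simp split:
          if_split)
    qed auto
    then show ?thesis by blast
  next
    case B
    have \<beta>: "\<beta> \<noteq> 0" using det B by auto
    show ?thesis
    proof (cases "\<delta> = 0")
      case True
      \<comment> \<open>The relation has shrunk to \<beta> H' = 0, whereas H' > 0 on every surface
        considered.\<close>
      have "D = {}" using lin B \<beta> True nu_less by (force simp: curvH'_def)
      then show ?thesis by (auto simp: parallel_domain_def)
    next
      case \<delta>: False
      define k where "k = \<bar>\<beta> / \<delta>\<bar> / 2"
      have k: "k > 0" using \<beta> \<delta> by (simp add: k_def)
      \<comment> \<open>Reversal of the normal changes neither K nor H', so a negative \<beta> /
        \<delta> needs another cure: a parallel surface with \<epsilon> = -1. For K = -2 k H' the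
        distance 1 / k has this property on its whole parallel domain.\<close>
      define a where "a = (if \<beta> / \<delta> > 0 then 0 else 1 / k)"
      have "described_by_basic_class z D a p0" if p0: "p0 \<in> parallel_domain a z D" for p0
      proof (rule described_by_basic_classI[OF z lin p0 refl k, of Class9 1])
        let ?\<epsilon> = "sgn ((1 - a * nu1 z p0) * (1 - a * nu2 z p0))"
        have e: "?\<epsilon> * (\<beta> / \<delta>) = 2 * k"
        proof (cases "\<beta> / \<delta> > 0")
          case True
          then show ?thesis by (simp add: a_def k_def del: abs_divide)
        next
          case False
          have bd: "\<beta> / \<delta> < 0" using False \<beta> \<delta> by (metis divide_eq_0_iff linorder_neqE_linordered_idom)
          let ?x = "nu1 z p0" and ?y = "nu2 z p0"
          have p0D: "p0 \<in> D" using p0 by (simp add: parallel_domain_def)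
          have xy: "?x * ?y = - k * (?x - ?y)"
          proof -
            have "?x * ?y = \<beta> / \<delta> * ((?x - ?y) / 2)" using lin[OF p0D] B \<delta> by (simp add: curvK_def curvH'_def
                field_simps)
            moreover have "\<beta> / \<delta> = - 2 * k" using bd by (simp add: k_def del: abs_divide)
            ultimately show ?thesis by simp
          qed
          have "(1 - a * ?x) * (1 - a * ?y) = (k - ?x) * (k - ?y) / (k * k)" using k False by (simp add: a_def
              field_simps)
          also have "(k - ?x) * (k - ?y) = k * k - 2 * k * ?x"
            using xy by (simp add: algebra_simps)
          also have "(k * k - 2 * k * ?x) / (k * k) = (k - 2 * ?x) / k" using k by (simp add: field_simps)
          finally have f: "(1 - a * ?x) * (1 - a * ?y) = (k - 2 * ?x) / k" .
          have xgy: "?y < ?x" by (rule nu_less[OF p0D])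
          have "?x * ?y < 0" unfolding xy using k xgy by (simp add: mult_neg_pos)
          then have "?x > 0" "?y < 0" using xgy by (auto simp: mult_less_0_iff)
          moreover have "?y * (?x - k) = - k * ?x" using xy by (simp add: algebra_simps)
          then have "?y * (?x - k) < 0" using \<open>?x > 0\<close> k by (simp add: mult_neg_pos)
          \<comment> \<open>As \<nu>2 < 0, the negative product forces \<nu>1 > k.\<close>
          ultimately have "k - 2 * ?x < 0" by (auto simp: mult_less_0_iff)
          then have "?\<epsilon> = - 1" unfolding f using k by (simp add: sgn_if zero_less_divide_iff)
          then show ?thesis using bd by (simp add: k_def del: abs_divide)
        qed
        fix x y :: real
        assume "(\<delta> - \<alpha> * a - \<gamma> * a\<^sup>2) * k\<^sup>2 * (x * y) =
          1 * ?\<epsilon> * k * (\<alpha> + 2 * \<gamma> * a) * ((x + y) / 2) + ?\<epsilon> * k * \<beta> * ((x - y) / 2) + \<gamma>"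
        then have "\<delta> * k * (x * y) = ?\<epsilon> * \<beta> * ((x - y) / 2)" using B k by (simp add: power2_eq_square)
        then have "k * (x * y) = ?\<epsilon> * (\<beta> / \<delta>) * ((x - y) / 2)" using \<delta> by (simp add: field_simps)
        then show "curvature_relation Class9 (x * y) ((x + y) / 2) ((x - y) / 2)" unfolding e using k by simp
      qed auto
      then show ?thesis by blast
    qed
  next
    case C
    define d where "d = sqrt \<Delta>"
    have d: "d > 0" "d * d = \<Delta>" using C by (auto simp: d_def)
    \<comment> \<open>Of the two roots of \<delta> - \<alpha> a - \<gamma> a^2, the one for which
      the coefficient of H is the positive number \<open>d\<close>.\<close>
    define a where "a = (d - \<alpha>) / (2 * \<gamma>)"
    have a: "\<alpha> + 2 * \<gamma> * a = d" using C by (simp add: a_def)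
    have "4 * \<gamma> * (\<delta> - \<alpha> * a - \<gamma> * a\<^sup>2) = \<Delta> - (\<alpha> + 2 * \<gamma> * a) * (\<alpha> + 2 * \<gamma> * a)"
      by (simp add: \<Delta>_def power2_eq_square algebra_simps)
    then have a0: "\<delta> - \<alpha> * a - \<gamma> * a\<^sup>2 = 0" unfolding a using d C by simp
    have "described_by_basic_class z D a p0" if p0: "p0 \<in> parallel_domain a z D" for p0
    proof -
      define \<epsilon> where "\<epsilon> = sgn ((1 - a * nu1 z p0) * (1 - a * nu2 z p0))"
      have \<epsilon>: "\<epsilon> = 1 \<or> \<epsilon> = - 1" by (rule parallel_domain_sgn[OF p0 \<epsilon>_def])
      \<comment> \<open>The relation becomes s \<epsilon> k d H + \<epsilon> k \<beta> H' + \<gamma>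
        = 0. Multiplied by s \<epsilon>, its constant term is minus the absolute value of \<gamma>
        for this \<open>s\<close>, so H equals b H' plus a positive constant.\<close>
      define s where "s = - \<epsilon> * sgn \<gamma>"
      have s: "s = 1 \<or> s = - 1" using \<epsilon> C by (auto simp: s_def sgn_if)
      define b where "b = - s * \<beta> / d"
      have bb: "b\<^sup>2 = \<beta>\<^sup>2 / \<Delta>" using s d by (auto simp: b_def power_divide power2_eq_square)
      have b1: "b\<^sup>2 \<noteq> 1" unfolding bb using det C by (simp add: \<Delta>_def)
      define c where "c = (if b = 0 then Class2 else if b\<^sup>2 > 1 then Class6 b else Class7 b)"
      have c: "valid_class c" using b1 by (auto simp: c_def)
      \<comment> \<open>Scaling brings that positive constant to 1/2 for class 2 and to 1 for
        classes 6 and 7.\<close>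
      define k where "k = (if b = 0 then 2 else 1) * \<bar>\<gamma>\<bar> / d"
      have k: "k > 0" using C d by (simp add: k_def)
      show ?thesis
      proof (rule described_by_basic_classI[OF z lin p0 \<epsilon>_def k c s])
        fix x y :: real
        assume R: "(\<delta> - \<alpha> * a - \<gamma> * a\<^sup>2) * k\<^sup>2 * (x * y) =
          s * \<epsilon> * k * (\<alpha> + 2 * \<gamma> * a) * ((x + y) / 2) + \<epsilon> * k * \<beta> * ((x - y) / 2) + \<gamma>"
        let ?H = "(x + y) / 2" and ?H' = "(x - y) / 2"
        have "s * \<epsilon> * k * d * ?H + \<epsilon> * k * \<beta> * ?H' + \<gamma> = 0" using R unfolding a0 a by simp
        then have 1: "s * \<epsilon> * (s * \<epsilon> * k * d * ?H + \<epsilon> * k * \<beta> * ?H' + \<gamma>) = 0" by simp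
        have 2: "s * \<epsilon> * (s * \<epsilon> * k * d * ?H + \<epsilon> * k * \<beta> * ?H' + \<gamma>) = k * d * ?H + s * k * \<beta> * ?H' + s * \<epsilon> * \<gamma>"
          using s \<epsilon> by (auto simp: algebra_simps)
        have 3: "s * \<epsilon> * \<gamma> = - \<bar>\<gamma>\<bar>" using \<epsilon> by (auto simp: s_def sgn_if abs_if)
        have "k * d * ?H + s * k * \<beta> * ?H' + - \<bar>\<gamma>\<bar> = 0" using 1 unfolding 2 3 .
        then have "k * d * ?H = - (s * k * \<beta> * ?H') + \<bar>\<gamma>\<bar>" by linarith
        then have "?H = (- (s * k * \<beta> * ?H') + \<bar>\<gamma>\<bar>) / (k * d)" using k d by (simp add: nonzero_eq_divide_eq
            mult.commute)
        also have "\<dots> = b * ?H' + \<bar>\<gamma>\<bar> / (k * d)"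
        proof -
          have "(- (s * k * \<beta> * h) + g) / (k * d) = - s * \<beta> / d * h + g / (k * d)" for h g
            using k d by (simp add: field_simps)
          then show ?thesis unfolding b_def .
        qed
        also have "\<bar>\<gamma>\<bar> / (k * d) = (if b = 0 then 1 / 2 else 1)" using C d by (simp add: k_def)
        finally show "curvature_relation c (x * y) ?H ?H'" by (simp add: c_def)
      qed
    qed
    then show ?thesis by blast
  next
    case D
    define a where "a = - \<alpha> / (2 * \<gamma>)"
    have a: "\<alpha> + 2 * \<gamma> * a = 0" using D by (simp add: a_def)
    have "4 * \<gamma> * (\<delta> - \<alpha> * a - \<gamma> * a\<^sup>2) = \<Delta> - (\<alpha> + 2 * \<gamma> * a) * (\<alpha> + 2 * \<gamma> * a)"
      by (simp add: \<Delta>_def power2_eq_square algebra_simps)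
    then have a0: "\<delta> - \<alpha> * a - \<gamma> * a\<^sup>2 = 0" unfolding a using D by simp
    have \<beta>: "\<beta> \<noteq> 0" using det D by (auto simp: \<Delta>_def)
    define k where "k = \<bar>\<gamma> / \<beta>\<bar>"
    have k: "k > 0" using D \<beta> by (simp add: k_def)
    have "described_by_basic_class z D a p0" if p0: "p0 \<in> parallel_domain a z D" for p0
    proof -
      define \<epsilon> where "\<epsilon> = sgn ((1 - a * nu1 z p0) * (1 - a * nu2 z p0))"
      have \<epsilon>: "\<bar>\<epsilon>\<bar> = 1" using parallel_domain_sgn[OF p0 \<epsilon>_def] by auto
      show ?thesis
      proof (rule described_by_basic_classI[OF z lin p0 \<epsilon>_def k, of Class3 1])
        fix x y :: real
        assume xy: "y < x" and R: "(\<delta> - \<alpha> * a - \<gamma> * a\<^sup>2) * k\<^sup>2 * (x * y) =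
          1 * \<epsilon> * k * (\<alpha> + 2 * \<gamma> * a) * ((x + y) / 2) + \<epsilon> * k * \<beta> * ((x - y) / 2) + \<gamma>"
        have "\<epsilon> * k * \<beta> * ((x - y) / 2) = - \<gamma>" using R unfolding a0 a by simp
        then have "\<bar>\<epsilon> * k * \<beta> * ((x - y) / 2)\<bar> = \<bar>\<gamma>\<bar>" by simp
        then have "k * \<bar>\<beta>\<bar> * ((x - y) / 2) = \<bar>\<gamma>\<bar>" using xy k \<epsilon> by (simp add: abs_mult)
        moreover have "k * \<bar>\<beta>\<bar> = \<bar>\<gamma>\<bar>" using \<beta> by (simp add: k_def)
        ultimately show "curvature_relation Class3 (x * y) ((x + y) / 2) ((x - y) / 2)" using D by simp
      qed auto
    qed
    then show ?thesis by blast
  next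
    case E
    \<comment> \<open>Without a real root K cannot be removed; the vertex of the quadratic removes H
      instead.\<close>
    define a where "a = - \<alpha> / (2 * \<gamma>)"
    have a: "\<alpha> + 2 * \<gamma> * a = 0" using E by (simp add: a_def)
    define \<delta>' where "\<delta>' = \<delta> - \<alpha> * a - \<gamma> * a\<^sup>2"
    have "4 * \<gamma> * \<delta>' = \<Delta> - (\<alpha> + 2 * \<gamma> * a) * (\<alpha> + 2 * \<gamma> * a)"
      by (simp add: \<delta>'_def \<Delta>_def power2_eq_square algebra_simps)
    then have neg: "\<gamma> * \<delta>' < 0" unfolding a using E by simp
    then have \<delta>0: "\<delta>' \<noteq> 0" and g: "\<gamma> / \<delta>' < 0" by (auto simp: mult_less_0_iff divide_less_0_iff)
    have "described_by_basic_class z D a p0" if p0: "p0 \<in> parallel_domain a z D" for p0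
    proof -
      define \<epsilon> where "\<epsilon> = sgn ((1 - a * nu1 z p0) * (1 - a * nu2 z p0))"
      have \<epsilon>: "\<epsilon> = 1 \<or> \<epsilon> = - 1" by (rule parallel_domain_sgn[OF p0 \<epsilon>_def])
      \<comment> \<open>\<epsilon> enters the constant of class 10, so points of the parallel domain
        with different signs may lead to different constants. For \<beta> = 0 scaling normalises K
        to -1.\<close>
      define c where "c = (if \<beta> = 0 then Class8 else Class10 (\<epsilon> * \<beta> / \<delta>') (\<gamma> / \<delta>'))"
      define k where "k = (if \<beta> = 0 then sqrt (- (\<gamma> / \<delta>')) else 1)"
      have c: "valid_class c" using g \<epsilon> \<delta>0 by (auto simp: c_def)
      have k: "k > 0" using g by (simp add: k_def)
      show ?thesis
      proof (rule described_by_basic_classI[OF z lin p0 \<epsilon>_def k c, of 1])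
        fix x y :: real
        assume "(\<delta> - \<alpha> * a - \<gamma> * a\<^sup>2) * k\<^sup>2 * (x * y) =
          1 * \<epsilon> * k * (\<alpha> + 2 * \<gamma> * a) * ((x + y) / 2) + \<epsilon> * k * \<beta> * ((x - y) / 2) + \<gamma>"
        then have "\<delta>' * k\<^sup>2 * (x * y) = \<epsilon> * k * \<beta> * ((x - y) / 2) + \<gamma>" unfolding a \<delta>'_def[symmetric] by simp
        then have R: "k\<^sup>2 * (x * y) = \<epsilon> * k * \<beta> / \<delta>' * ((x - y) / 2) + \<gamma> / \<delta>'" using \<delta>0 by (simp add: field_simps)
        show "curvature_relation c (x * y) ((x + y) / 2) ((x - y) / 2)"
        proof (cases "\<beta> = 0")
          case True
          then have "k\<^sup>2 = - (\<gamma> / \<delta>')" using g by (simp add: k_def)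
          then have "- (\<gamma> / \<delta>') * (x * y + 1) = 0" using R True by (simp add: algebra_simps)
          then have "x * y = - 1" using g by (auto simp: add_eq_0_iff)
          then show ?thesis using True by (simp add: c_def)
        next
          case False
          then show ?thesis using R by (simp add: c_def k_def)
        qed
      qed auto
    qed
    then show ?thesis by blast
  qed
qed

text \<open>Distance 0 and scale 1 turn the parallel surface into \<open>z\<close> itself, so the
  construction for parallel surfaces applies directly.\<close>

lemma basic_surface_natural_parameters:
  assumes c: "valid_class c" and z: "basic_surface c z D" and p0: "p0 \<in> D"
  shows "\<exists>\<phi> U V. reparam \<phi> U V \<and> p0 \<in> V \<and> V \<subseteq> D \<and> basic_surface c (z \<circ> \<phi>) U \<and>
    has_natural_pde_of (z \<circ> \<phi>) U (geometric_function c (z \<circ> \<phi>)) c"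
proof -
  have os: "oriented_surface z D" and cr: "\<And>p. p \<in> D \<Longrightarrow> curvature_relation c (curvK z p) (curvH z p) (curvH' z p)"
    using z by (auto simp: basic_surface_def)
  have D: "open D" using os by (auto simp: oriented_surface_iff principal_surface_def)
  have y: "(\<lambda>x. 1 *\<^sub>R x) \<circ> parallel 0 z = z" by (simp add: fun_eq_iff parallel_def)
  have P: "parallel_domain 0 z D = D" by (simp add: parallel_domain_def)
  obtain dom geo F F1 G G1 \<Phi> s1 linv m m1 n n1 \<mu> \<eta> A B where cd: "class_data c dom geo F F1 G G1 \<Phi> s1 linv m m1
      n n1 \<mu> \<eta> A B"
    using class_data_exists[OF c] by metis
  from class_data.natural_parameters_exist[OF cd os, of 1 D 0 p0, unfolded y P] D p0 cr
  show ?thesis by simp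
qed

theorem theoremA:
  fixes \<alpha> \<beta> \<gamma> \<delta> :: real
  assumes "\<alpha>\<^sup>2 - \<beta>\<^sup>2 + 4 * \<gamma> * \<delta> \<noteq> 0"
  shows "(\<forall>z D. surface z D \<and>
            (\<forall>p\<in>D. \<delta> * curvK z p = \<alpha> * curvH z p + \<beta> * curvH' z p + \<gamma>) \<longrightarrow>
            (\<exists>a. D \<subseteq> closure (parallel_domain a z D) \<and>
              (\<forall>p0 \<in> parallel_domain a z D. \<exists>c \<phi> U V T.
                 valid_class c \<and> similarity T \<and>
                 reparam \<phi> U V \<and> p0 \<in> V \<and> V \<subseteq> parallel_domain a z D \<and>
                 (let z' = T \<circ> parallel a z \<circ> \<phi> in
                    basic_surface c z' U \<and>
                    has_natural_pde_of (z \<circ> \<phi>) U (geometric_function c z') c))))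
       \<and> (\<forall>c z D. valid_class c \<and> basic_surface c z D \<longrightarrow>
            (\<forall>p0\<in>D. \<exists>\<phi> U V.
               reparam \<phi> U V \<and> p0 \<in> V \<and> V \<subseteq> D \<and> basic_surface c (z \<circ> \<phi>) U \<and>
               has_natural_pde_of (z \<circ> \<phi>) U (geometric_function c (z \<circ> \<phi>)) c))"
  unfolding described_by_basic_class_def[symmetric]
proof (intro conjI allI impI ballI)
  fix z D
  assume "surface z D \<and> (\<forall>p\<in>D. \<delta> * curvK z p = \<alpha> * curvH z p + \<beta> * curvH' z p + \<gamma>)"
  then have z: "surface z D" and lin: "\<And>p. p \<in> D \<Longrightarrow> \<delta> * curvK z p = \<alpha> * curvH z p + \<beta> * curvH' z p + \<gamma>" by auto
  show "\<exists>a. D \<subseteq> closure (parallel_domain a z D) \<and> (\<forall>p0\<in>parallel_domain a z D. described_by_basic_class z D a p0)"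
    using parallel_basic_class_exists[OF assms z lin] parallel_domain_dense[OF assms z lin] by blast
qed (use basic_surface_natural_parameters in blast)

end
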